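(* Let $\Lambda$ be a QID random measure on the $\sigma$-algebra $\mathcal{S}$ satisfying the assumptions described in the context, with $\lambda,a,\sigma^2,\rho,\tilde F^{\pm}$ as defined there. Let $f:S\to\mathbb{R}$ be an $\mathcal{S}$-measurable function, and for $u\in\mathbb{R}$, $s\in S$ put $$U(u,s)=u\,a(s)+\int_{\mathbb{R}}\big(\tau(xu)-u\tau(x)\big)\rho(s,dx),\qquad V_0(u,s)=\int_{\mathbb{R}}(1\wedge|xu|^2)\,|\rho|(s,dx).$$ Then $f$ is $\Lambda$-integrable if the following three conditions hold: (i) $\int_S|U(f(s),s)|\,\lambda(ds)<\infty$; (ii) $\int_S|f(s)|^2\sigma^2(s)\,\lambda(ds)<\infty$; (iii) $\int_S V_0(f(s),s)\,\lambda(ds)<\infty$. Further, in that case, for every $\theta\in\mathbb{R}$, $$\mathbb{E}\Big[e^{i\theta\int_S f d\Lambda}\Big]=\exp\Big(i\theta a_f-\tfrac12\theta^2\sigma_f^2+\int_{\mathbb{R}}\big(e^{i\theta x}-1-i\theta\tau(x)\big)F_f(dx)\Big),$$ where $a_f=\int_S U(f(s),s)\lambda(ds)$, $\sigma_f^2=\int_S|f(s)|^2\sigma^2(s)\lambda(ds)$, and $F_f$ is the unique quasi-Lévy measure determined by the difference of the Lévy measures $\tilde F_f^{+}$ and $\tilde F_f^{-}$ (i.e. $F_f(B)=\tilde F_f^+(B)-\tilde F_f^-(B)$ for Borel $B$ with $0\notin\overline B$), where $\tilde F_f^{\pm}(B)=\tilde F^{\pm}(\{(s,x)\in S\times\mathbb{R}: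 f(s)x\in B\setminus\{0\}\})$ for $B\in\mathcal{B}(\mathbb{R})$.
   Context: $\mathcal{B}_0(\mathbb{R})$ is the class of Borel sets $B\subset\mathbb{R}$ with $0\notin\overline B$. $\tau(x)=x$ if $|x|\le1$, $\tau(x)=x/|x|$ if $|x|>1$. A quasi-Lévy type measure is a function $\nu:\mathcal{B}_0(\mathbb{R})\to\mathbb{R}$ whose restriction to $\{B\text{ Borel}: B\cap(-r,r)=\emptyset\}$ is a finite signed measure for each $r>0$ and with $\int_{\mathbb{R}}(1\wedge x^2)|\nu|(dx)<\infty$; $\nu^+,\nu^-,|\nu|$ denote the unique measures on $\mathcal{B}(\mathbb{R})$ with no mass at $0$ which coincide on those classes with the positive part, negative part and total variation of the restriction. If $\nu$ extends to a signed measure on $\mathcal{B}(\mathbb{R})$ it is identified with the extension. For $g$ $|\nu|$-integrable, $\int g\,d\nu:=\int g\,d\nu^+-\int g\,d\nu^-$. A distribution on $\mathbb{R}$ is quasi-infinitely divisible (QID) with characteristic triplet $(\gamma,a,\nu)$ if its characteristic function is $\exp(i\theta\gamma-\frac{\theta^2}{2}a+\int(e^{i\theta x}-1-i\theta\tau(x))\nu(dx))$ with $\gamma,a\in\mathbb{R}$, $\nu$ a quasi-Lévy type measure; then $\nu$ is called a quasi-Lévy measure. $S$ is a non-empty set and $\mathcal{S}$ a $\sigma$-algebra on $S$. A QID random measure is a real process $\{\Lambda(A):A\in\mathcal{S}\}$ such that for disjoint $A_n\in\mathcal{S}$ the $\Lambda(A_n)$ are independent, $\Lambda(\bigcup_nA_n)=\sum_n\Lambda(A_n)$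 a.s., and each $\Lambda(A)$ is QID. Setting. $\Lambda$ is a QID random measure such that $\Lambda(A)$ has characteristic triplet $(\nu_0(A),\nu_1(A),F_A)$ for every $A\in\mathcal{S}$, where $\nu_0:\mathcal{S}\to\mathbb{R}$ is a signed measure, $\nu_1:\mathcal{S}\to[0,\infty)$ is a measure, $F_A$ is a quasi-Lévy measure and a signed measure on $\mathcal{B}(\mathbb{R})$ for every $A\in\mathcal{S}$, and $A\mapsto F_A(B)\in(-\infty,\infty)$ is a signed measure on $\mathcal{S}$ for every $B\in\mathcal{B}_0(\mathbb{R})$. Put $J(A,B)=\int_B(1\wedge x^2)F_A(dx)$ for $A\in\mathcal{S}$, $B\in\mathcal{B}(\mathbb{R})$; $J$ is a signed bimeasure (a signed measure in each variable). It is assumed that $\sup_I\sum_{i\in I}|J(A_i,B_i)|<\infty$, the supremum over all finite families $(A_i,B_i)_{i\in I}$ in $\mathcal{S}\times\mathcal{B}(\mathbb{R})$ with pairwise disjoint rectangles $A_i\times B_i$. For $A\in\mathcal{S}$ let $\xi(A)=\sup_{I_A}\sum_{i\in I_A}|J(A_i,B_i)|$, the supremum over such families with all $A_i\subset A$; $\xi$ is a finite measure. Control measure: $\lambda(A)=|\nu_0|(A)+\nu_1(A)+\xi(A)$. $a=d\nu_0/d\lambda$, $\sigma^2=d\nu_1/d\lambda$. $\rho$ is a family of quasi-Lévy type measures $\rho(s,\cdot)$, $s\in S$, whose positive and negative parts $\rho^{\pm}(\cdot,B)$ are measurable in $s$ for every $B\in\mathcal{B}(\mathbb{R})$, with $\int_{\mathbb{R}}(1\wedge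 x^2)|\rho|(s,dx)\le 2$ for all $s$ and $J(A,B)=\int_A\int_B(1\wedge x^2)\rho(s,dx)\lambda(ds)$ for all $A\in\mathcal{S},B\in\mathcal{B}(\mathbb{R})$; such a $\rho$ exists and satisfies $\int g\,dF_A=\int_A\int g(x)\rho(s,dx)\lambda(ds)$ whenever $\int_A\int|g(x)||\rho|(s,dx)\lambda(ds)<\infty$. $\tilde F^{\pm}(C)=\int_S\int_{\mathbb{R}}\mathbf{1}_C(s,x)\rho^{\pm}(s,dx)\lambda(ds)$, $C\in\mathcal{S}\otimes\mathcal{B}(\mathbb{R})$. Integral: for a simple function $f=\sum_{j=1}^nx_j\mathbf{1}_{A_j}$ with disjoint $A_j\in\mathcal{S}$ and $A\in\mathcal{S}$, $\int_Af\,d\Lambda=\sum_jx_j\Lambda(A\cap A_j)$. A measurable $f$ is $\Lambda$-integrable if there are simple $f_n\to f$ $\lambda$-a.e. such that for every $A\in\mathcal{S}$ the sequence $\int_Af_n\,d\Lambda$ converges in probability; $\int_Af\,d\Lambda$ is the limit in probability (independent of the sequence). *)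

theory Defs
  imports "HOL-Probability.Probability"
begin

section \<open>Signed measures and their Jordan decomposition\<close>

text \<open>
  A measure value \<open>M\<close> is used below only through \<^term>\<open>space M\<close> and \<^term>\<open>sets M\<close> whenever it
  stands for a measurable space.  Signed measures may take one of the values \<open>\<plusminus>\<infinity>\<close>; in particular
  every measure is a signed measure.
\<close>

definition signed_measure :: "'a measure \<Rightarrow> ('a set \<Rightarrow> ereal) \<Rightarrow> bool" where
  "signed_measure M \<mu> \<longleftrightarrow>
     \<mu> {} = 0 \<and>
     ((\<forall>A\<in>sets M. \<mu> A \<noteq> \<infinity>) \<or> (\<forall>A\<in>sets M. \<mu> A \<noteq> - \<infinity>)) \<and>
     (\<forall>A :: nat \<Rightarrow> 'a set. range A \<subseteq> sets M \<longrightarrow> disjoint_family A \<longrightarrow>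
        (\<lambda>n. \<mu> (A n)) sums \<mu> (\<Union>n. A n))"

definition finite_signed_measure :: "'a measure \<Rightarrow> ('a set \<Rightarrow> real) \<Rightarrow> bool" where
  "finite_signed_measure M \<mu> \<longleftrightarrow> signed_measure M (\<lambda>A. ereal (\<mu> A))"

lemma finite_signed_measure_iff:
  "finite_signed_measure M \<mu> \<longleftrightarrow>
     \<mu> {} = 0 \<and>
     (\<forall>A :: nat \<Rightarrow> 'a set. range A \<subseteq> sets M \<longrightarrow> disjoint_family A \<longrightarrow>
        (\<lambda>n. \<mu> (A n)) sums \<mu> (\<Union>n. A n))"
  by (simp add: finite_signed_measure_def signed_measure_def sums_ereal)

definition hahn_set :: "'a measure \<Rightarrow> ('a set \<Rightarrow> real) \<Rightarrow> 'a set \<Rightarrow> bool" where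
  "hahn_set M \<mu> H \<longleftrightarrow> H \<in> sets M \<and>
     (\<forall>A\<in>sets M. A \<subseteq> H \<longrightarrow> 0 \<le> \<mu> A) \<and>
     (\<forall>A\<in>sets M. A \<subseteq> space M - H \<longrightarrow> \<mu> A \<le> 0)"

text \<open>
  For a finite signed measure the following three set functions do not depend on the chosen Hahn set.
\<close>

definition pos_variation :: "'a measure \<Rightarrow> ('a set \<Rightarrow> real) \<Rightarrow> 'a set \<Rightarrow> real" where
  "pos_variation M \<mu> A = \<mu> (A \<inter> (SOME H. hahn_set M \<mu> H))"

definition neg_variation :: "'a measure \<Rightarrow> ('a set \<Rightarrow> real) \<Rightarrow> 'a set \<Rightarrow> real" where
  "neg_variation M \<mu> A = - \<mu> (A - (SOME H. hahn_set M \<mu> H))"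

definition total_variation :: "'a measure \<Rightarrow> ('a set \<Rightarrow> real) \<Rightarrow> 'a set \<Rightarrow> real" where
  "total_variation M \<mu> A = pos_variation M \<mu> A + neg_variation M \<mu> A"

text \<open>
  \<open>g\<close> is a version of the Radon-Nikodym derivative of the finite signed measure \<open>\<mu>\<close>
  with respect to \<open>lam\<close>.
\<close>

definition signed_RN_deriv :: "'a measure \<Rightarrow> ('a set \<Rightarrow> real) \<Rightarrow> ('a \<Rightarrow> real) \<Rightarrow> bool" where
  "signed_RN_deriv lam \<mu> g \<longleftrightarrow> integrable lam g \<and>
     (\<forall>A\<in>sets lam. \<mu> A = set_lebesgue_integral lam A g)"


section \<open>Quasi-Levy type measures\<close>

definition borel0 :: "real set set" where
  "borel0 = {B \<in> sets borel. 0 \<notin> closure B}"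

definition trunc :: "real \<Rightarrow> real" where
  "trunc x = (if \<bar>x\<bar> \<le> 1 then x else x / \<bar>x\<bar>)"

text \<open>The Borel sets \<open>B\<close> with \<open>B \<inter> (-r, r) = \<emptyset>\<close>, as a measurable space.\<close>

definition outer_borel :: "real \<Rightarrow> real measure" where
  "outer_borel r = restrict_space borel (- {-r<..<r})"

lemma sets_outer_borel: "sets (outer_borel r) = {B \<in> sets borel. B \<inter> {-r<..<r} = {}}"
  by (auto simp: outer_borel_def sets_restrict_space)

text \<open>
  The measure on the Borel sets without mass at \<open>0\<close> whose restriction to each \<^term>\<open>outer_borel r\<close>,
  \<open>r > 0\<close>, is \<open>m r\<close>.  It is unique because \<open>- {0}\<close> is exhausted by the sets \<open>- {-1/n<..<1/n}\<close>.
\<close>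

definition glued_measure :: "(real \<Rightarrow> real set \<Rightarrow> real) \<Rightarrow> real measure" where
  "glued_measure m = (THE N. sets N = sets borel \<and> emeasure N {0} = 0 \<and>
     (\<forall>r>0. \<forall>B\<in>sets (outer_borel r). emeasure N B = ennreal (m r B)))"

text \<open>
  A quasi-Levy type measure is represented by a total function \<^typ>\<open>real set \<Rightarrow> real\<close>
  of which only the values on \<^const>\<open>borel0\<close> matter.  The following are \<open>\<nu>\<^sup>+\<close>, \<open>\<nu>\<^sup>-\<close>
  and \<open>|\<nu>|\<close>; they are genuine measures on the Borel sets without mass at \<open>0\<close>.
\<close>

definition ql_pos :: "(real set \<Rightarrow> real) \<Rightarrow> real measure" where
  "ql_pos \<nu> = glued_measure (\<lambda>r. pos_variation (outer_borel r) \<nu>)"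

definition ql_neg :: "(real set \<Rightarrow> real) \<Rightarrow> real measure" where
  "ql_neg \<nu> = glued_measure (\<lambda>r. neg_variation (outer_borel r) \<nu>)"

definition ql_abs :: "(real set \<Rightarrow> real) \<Rightarrow> real measure" where
  "ql_abs \<nu> = glued_measure (\<lambda>r. total_variation (outer_borel r) \<nu>)"

definition quasi_levy_type :: "(real set \<Rightarrow> real) \<Rightarrow> bool" where
  "quasi_levy_type \<nu> \<longleftrightarrow>
     (\<forall>r>0. finite_signed_measure (outer_borel r) \<nu>) \<and>
     (\<integral>\<^sup>+x. ennreal (min 1 (x\<^sup>2)) \<partial>ql_abs \<nu>) < \<infinity>"

definition ql_integral ::
    "(real set \<Rightarrow> real) \<Rightarrow> (real \<Rightarrow> 'b::{banach, second_countable_topology}) \<Rightarrow> 'b" where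
  "ql_integral \<nu> g = (\<integral>x. g x \<partial>ql_pos \<nu>) - (\<integral>x. g x \<partial>ql_neg \<nu>)"

definition extends_to_signed_measure :: "(real set \<Rightarrow> real) \<Rightarrow> bool" where
  "extends_to_signed_measure \<nu> \<longleftrightarrow>
     (\<exists>\<mu>. signed_measure borel \<mu> \<and> (\<forall>B\<in>borel0. \<mu> B = ereal (\<nu> B)))"

definition levy_measure :: "real measure \<Rightarrow> bool" where
  "levy_measure N \<longleftrightarrow> sets N = sets borel \<and> emeasure N {0} = 0 \<and>
     (\<integral>\<^sup>+x. ennreal (min 1 (x\<^sup>2)) \<partial>N) < \<infinity>"


section \<open>Quasi-infinitely divisible distributions and random measures\<close>

definition has_char_triplet ::
    "real measure \<Rightarrow> real \<Rightarrow> real \<Rightarrow> (real set \<Rightarrow> real) \<Rightarrow> bool" where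
  "has_char_triplet \<mu> \<gamma> a \<nu> \<longleftrightarrow> real_distribution \<mu> \<and> quasi_levy_type \<nu> \<and>
     (\<forall>\<theta>. char \<mu> \<theta> =
        exp (\<i> * \<theta> * \<gamma> - \<theta>\<^sup>2 / 2 * a
             + ql_integral \<nu> (\<lambda>x. iexp (\<theta> * x) - 1 - \<i> * \<theta> * trunc x)))"

definition qid :: "real measure \<Rightarrow> bool" where
  "qid \<mu> \<longleftrightarrow> (\<exists>\<gamma> a \<nu>. has_char_triplet \<mu> \<gamma> a \<nu>)"

definition quasi_levy_measure :: "(real set \<Rightarrow> real) \<Rightarrow> bool" where
  "quasi_levy_measure \<nu> \<longleftrightarrow> (\<exists>\<mu> \<gamma> a. has_char_triplet \<mu> \<gamma> a \<nu>)"

locale qid_random_measure = prob_space P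
  for P :: "'w measure" and M :: "'s measure" and \<Lambda> :: "'s set \<Rightarrow> 'w \<Rightarrow> real" +
  assumes space_nonempty: "space M \<noteq> {}"
    and random_variable_\<Lambda>: "A \<in> sets M \<Longrightarrow> \<Lambda> A \<in> borel_measurable P"
    and indep_\<Lambda>: "range D \<subseteq> sets M \<Longrightarrow> disjoint_family (D :: nat \<Rightarrow> 's set) \<Longrightarrow>
           indep_vars (\<lambda>_. borel) (\<lambda>n. \<Lambda> (D n)) UNIV"
    and countably_additive_\<Lambda>: "range D \<subseteq> sets M \<Longrightarrow> disjoint_family (D :: nat \<Rightarrow> 's set) \<Longrightarrow>
           AE w in P. (\<lambda>n. \<Lambda> (D n) w) sums \<Lambda> (\<Union>n. D n) w"
    and qid_\<Lambda>: "A \<in> sets M \<Longrightarrow> qid (distr P borel (\<Lambda> A))"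


section \<open>The setting\<close>

definition bimeasure_J :: "('s set \<Rightarrow> real set \<Rightarrow> real) \<Rightarrow> 's set \<Rightarrow> real set \<Rightarrow> real" where
  "bimeasure_J F A B = ql_integral (F A) (\<lambda>x. indicator B x * min 1 (x\<^sup>2))"

text \<open>
  Finite families of pairwise disjoint measurable rectangles \<open>A \<times> B\<close> with \<open>A \<subseteq> X\<close>.  Taking sets
  of pairs instead of indexed families only forbids the repetition of an empty rectangle, which
  contributes \<open>0\<close> to the sums in \<open>bimeasure_var\<close>.
\<close>

definition rect_families :: "'s measure \<Rightarrow> 's set \<Rightarrow> ('s set \<times> real set) set set" where
  "rect_families M X = {R. finite R \<and> (\<forall>(A, B)\<in>R. A \<in> sets M \<and> A \<subseteq> X \<and> B \<in> sets borel) \<and>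
     disjoint_family_on (\<lambda>(A, B). A \<times> B) R}"

definition bimeasure_var ::
    "'s measure \<Rightarrow> ('s set \<Rightarrow> real set \<Rightarrow> real) \<Rightarrow> 's set \<Rightarrow> ennreal" where
  "bimeasure_var M F X =
     (SUP R\<in>rect_families M X. \<Sum>(A, B)\<in>R. ennreal \<bar>bimeasure_J F A B\<bar>)"

text \<open>
  \<open>lam\<close> is the control measure, \<open>a\<close> and \<open>sig2\<close> are arbitrary versions of the derivatives
  \<open>d\<nu>0/d\<lambda>\<close> and \<open>d\<nu>1/d\<lambda>\<close>.
\<close>

locale qid_setting = qid_random_measure P M \<Lambda>
  for P :: "'w measure" and M :: "'s measure" and \<Lambda> :: "'s set \<Rightarrow> 'w \<Rightarrow> real" +
  fixes \<nu>0 :: "'s set \<Rightarrow> real"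
    and \<nu>1 :: "'s measure"
    and F :: "'s set \<Rightarrow> real set \<Rightarrow> real"
    and lam :: "'s measure"
    and a :: "'s \<Rightarrow> real"
    and sig2 :: "'s \<Rightarrow> real"
    and \<rho> :: "'s \<Rightarrow> real set \<Rightarrow> real"
  assumes signed_\<nu>0: "finite_signed_measure M \<nu>0"
    and sets_\<nu>1: "sets \<nu>1 = sets M"
    and finite_\<nu>1: "finite_measure \<nu>1"
    and triplet: "A \<in> sets M \<Longrightarrow>
          has_char_triplet (distr P borel (\<Lambda> A)) (\<nu>0 A) (measure \<nu>1 A) (F A)"
    and F_extends: "A \<in> sets M \<Longrightarrow> extends_to_signed_measure (F A)"
    and F_signed: "B \<in> borel0 \<Longrightarrow> finite_signed_measure M (\<lambda>A. F A B)"
    and finite_var: "bimeasure_var M F (space M) < \<infinity>"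
    and sets_lam: "sets lam = sets M"
    and emeasure_lam: "A \<in> sets M \<Longrightarrow>
          emeasure lam A =
            ennreal (total_variation M \<nu>0 A) + emeasure \<nu>1 A + bimeasure_var M F A"
    and deriv_a: "signed_RN_deriv lam \<nu>0 a"
    and deriv_sig2: "signed_RN_deriv lam (measure \<nu>1) sig2"
    and \<rho>_quasi_levy_type: "s \<in> space M \<Longrightarrow> quasi_levy_type (\<rho> s)"
    and \<rho>_pos_measurable: "B \<in> sets borel \<Longrightarrow>
          (\<lambda>s. emeasure (ql_pos (\<rho> s)) B) \<in> borel_measurable M"
    and \<rho>_neg_measurable: "B \<in> sets borel \<Longrightarrow>
          (\<lambda>s. emeasure (ql_neg (\<rho> s)) B) \<in> borel_measurable M"
    and \<rho>_bound: "s \<in> space M \<Longrightarrow>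
          (\<integral>\<^sup>+x. ennreal (min 1 (x\<^sup>2)) \<partial>ql_abs (\<rho> s)) \<le> 2"
    and J_disintegration: "A \<in> sets M \<Longrightarrow> B \<in> sets borel \<Longrightarrow>
          bimeasure_J F A B =
            set_lebesgue_integral lam A
              (\<lambda>s. ql_integral (\<rho> s) (\<lambda>x. indicator B x * min 1 (x\<^sup>2)))"

definition drift_U :: "('s \<Rightarrow> real) \<Rightarrow> ('s \<Rightarrow> real set \<Rightarrow> real) \<Rightarrow> real \<Rightarrow> 's \<Rightarrow> real" where
  "drift_U a \<rho> u s = u * a s + ql_integral (\<rho> s) (\<lambda>x. trunc (x * u) - u * trunc x)"

definition jump_V0 :: "('s \<Rightarrow> real set \<Rightarrow> real) \<Rightarrow> real \<Rightarrow> 's \<Rightarrow> ennreal" where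
  "jump_V0 \<rho> u s = (\<integral>\<^sup>+x. ennreal (min 1 (\<bar>x * u\<bar>\<^sup>2)) \<partial>ql_abs (\<rho> s))"

text \<open>
  \<open>\<kappa>\<close> stands for one of the kernels \<open>\<rho>\<^sup>+\<close>, \<open>\<rho>\<^sup>-\<close>, that is \<open>\<lambda>s. ql_pos (\<rho> s)\<close> or
  \<open>\<lambda>s. ql_neg (\<rho> s)\<close>.
\<close>

definition F_tilde :: "'s measure \<Rightarrow> ('s \<Rightarrow> real measure) \<Rightarrow> ('s \<times> real) measure" where
  "F_tilde lam \<kappa> =
     measure_of (space (lam \<Otimes>\<^sub>M borel)) (sets (lam \<Otimes>\<^sub>M borel))
       (\<lambda>C. \<integral>\<^sup>+s. (\<integral>\<^sup>+x. indicator C (s, x) \<partial>\<kappa> s) \<partial>lam)"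

definition F_tilde_f ::
    "'s measure \<Rightarrow> ('s \<Rightarrow> real measure) \<Rightarrow> ('s \<Rightarrow> real) \<Rightarrow> real measure" where
  "F_tilde_f lam \<kappa> f =
     measure_of UNIV (sets borel)
       (\<lambda>B. emeasure (F_tilde lam \<kappa>) {(s, x) \<in> space lam \<times> UNIV. f s * x \<in> B - {0}})"


section \<open>The stochastic integral\<close>

definition converges_in_prob :: "'w measure \<Rightarrow> (nat \<Rightarrow> 'w \<Rightarrow> real) \<Rightarrow> ('w \<Rightarrow> real) \<Rightarrow> bool" where
  "converges_in_prob P X Y \<longleftrightarrow> Y \<in> borel_measurable P \<and>
     (\<forall>\<epsilon>>0. (\<lambda>n. measure P {w \<in> space P. \<epsilon> < \<bar>X n w - Y w\<bar>}) \<longlonglongrightarrow> 0)"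

text \<open>
  The canonical representation of the simple function is used; by additivity of \<open>\<Lambda>\<close> any other
  representation with disjoint sets gives almost surely the same random variable.
\<close>

definition simple_\<Lambda>_integral ::
    "'s measure \<Rightarrow> ('s set \<Rightarrow> 'w \<Rightarrow> real) \<Rightarrow> ('s \<Rightarrow> real) \<Rightarrow> 's set \<Rightarrow> 'w \<Rightarrow> real" where
  "simple_\<Lambda>_integral M \<Lambda> g A w =
     (\<Sum>y\<in>g ` space M. y * \<Lambda> (A \<inter> (g -` {y} \<inter> space M)) w)"

definition \<Lambda>_approx_seq ::
    "'w measure \<Rightarrow> 's measure \<Rightarrow> ('s set \<Rightarrow> 'w \<Rightarrow> real) \<Rightarrow> 's measure \<Rightarrow>
     (nat \<Rightarrow> 's \<Rightarrow> real) \<Rightarrow> ('s \<Rightarrow> real) \<Rightarrow> bool" where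
  "\<Lambda>_approx_seq P M \<Lambda> lam g f \<longleftrightarrow>
     (\<forall>n. simple_function M (g n)) \<and>
     (AE s in lam. (\<lambda>n. g n s) \<longlonglongrightarrow> f s) \<and>
     (\<forall>A\<in>sets M. \<exists>X. converges_in_prob P (\<lambda>n. simple_\<Lambda>_integral M \<Lambda> (g n) A) X)"

definition \<Lambda>_integrable ::
    "'w measure \<Rightarrow> 's measure \<Rightarrow> ('s set \<Rightarrow> 'w \<Rightarrow> real) \<Rightarrow> 's measure \<Rightarrow> ('s \<Rightarrow> real) \<Rightarrow> bool" where
  "\<Lambda>_integrable P M \<Lambda> lam f \<longleftrightarrow>
     f \<in> borel_measurable M \<and> (\<exists>g. \<Lambda>_approx_seq P M \<Lambda> lam g f)"

text \<open>
  \<open>X\<close> is a version of the integral of \<open>f\<close> over \<open>A\<close>; the integral is only determined up to almost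
  sure equality.
\<close>

definition has_\<Lambda>_integral ::
    "'w measure \<Rightarrow> 's measure \<Rightarrow> ('s set \<Rightarrow> 'w \<Rightarrow> real) \<Rightarrow> 's measure \<Rightarrow>
     ('s \<Rightarrow> real) \<Rightarrow> 's set \<Rightarrow> ('w \<Rightarrow> real) \<Rightarrow> bool" where
  "has_\<Lambda>_integral P M \<Lambda> lam f A X \<longleftrightarrow>
     f \<in> borel_measurable M \<and>
     (\<exists>g. \<Lambda>_approx_seq P M \<Lambda> lam g f \<and>
        converges_in_prob P (\<lambda>n. simple_\<Lambda>_integral M \<Lambda> (g n) A) X)"

end

theory Submission
  imports Defs
begin

text \<open>
  The whole argument runs through the cumulant density
  \<open>K(u,s) = i U(u,s) - u\<^sup>2 \<sigma>\<^sup>2(s) / 2 + \<integral> (e\<^sup>i\<^sup>u\<^sup>x - 1 - i \<tau>(ux)) \<rho>(s,dx)\<close>.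
  The disintegration of \<open>J\<close> turns the triplet of \<open>\<Lambda>(A)\<close> into
  \<open>E exp(i\<theta>\<Lambda>(A)) = exp \<integral>\<^sub>A K(\<theta>,s) \<lambda>(ds)\<close>, and independence over disjoint sets gives
  \<open>E exp(i\<theta> \<integral>\<^sub>A g d\<Lambda>) = exp \<integral>\<^sub>A K(\<theta>g(s),s) \<lambda>(ds)\<close> for simple \<open>g\<close>
  (\<open>char_simple_\<Lambda>_integral\<close>).  Every question about convergence in probability thereby becomes a
  question about integrals of \<open>K\<close>.

  The decisive estimate is \<open>norm_K_le\<close>: if \<open>\<bar>v\<bar> \<le> c \<bar>u\<bar>\<close>, then \<open>\<bar>K(v,s)\<bar>\<close> is at most a constant
  times \<open>\<bar>U(u,s)\<bar> + u\<^sup>2 \<bar>\<sigma>\<^sup>2(s)\<bar> + V\<^sub>0(u,s)\<close>.  It holds because \<open>\<tau>\<close> is homogeneous up to a bounded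
  error that vanishes near \<open>0\<close>, so that \<open>U(ru,s) - r U(u,s)\<close> is controlled by \<open>V\<^sub>0(u,s)\<close>.
  Conditions (i)-(iii) say exactly that the bound is integrable at \<open>u = f(s)\<close>.  For simple
  \<open>f\<^sub>n \<rightarrow> f\<close> with \<open>\<bar>f\<^sub>n\<bar> \<le> 2\<bar>f\<bar>\<close>, dominated convergence yields
  \<open>\<integral> K(\<theta>(f\<^sub>n - f\<^sub>m),s) \<lambda>(ds) \<rightarrow> 0\<close>, hence the integrals of \<open>f\<^sub>n\<close> are Cauchy in probability, and
  \<open>\<integral> K(\<theta>f\<^sub>n,s) \<lambda>(ds) \<rightarrow> \<integral> K(\<theta>f,s) \<lambda>(ds)\<close>, which is the exponent of the limit
  (\<open>exists_\<Lambda>_approx_seq\<close>).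

  The integral may also be computed along approximating sequences without any domination.  That
  these give the same law is a gliding hump argument: if \<open>k\<^sub>n \<rightarrow> 0\<close> almost everywhere and
  \<open>exp \<integral>\<^sub>A k\<^sub>n\<close> converges for every measurable \<open>A\<close>, then \<open>exp \<integral> k\<^sub>n \<rightarrow> 1\<close>
  (\<open>gliding_hump\<close>), applied to \<open>k\<^sub>n(s) = K(\<theta>(g\<^sub>n - h\<^sub>n)(s),s)\<close>.

  On the side of the Levy measures, \<open>\<rho>\<^sup>+\<close> and \<open>\<rho>\<^sup>-\<close> give the Jordan decomposition of \<open>\<rho>(s,\<cdot>)\<close>
  for each \<open>s\<close>, but \<open>F\<^sub>f\<^sup>+\<close> and \<open>F\<^sub>f\<^sup>-\<close> need not be mutually singular.  Integrals with respect to
  a quasi-Levy type measure nevertheless agree for all its representations as a difference of two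
  Levy measures (\<open>quasi_levy_type_diff\<close>, \<open>ql_integral_eq_diff\<close>); this serves both to disintegrate
  \<open>F\<^sub>A\<close> and to evaluate the final exponent.
\<close>

section \<open>Hahn decomposition of a finite signed measure\<close>

lemma finite_signed_measure_sums:
  assumes "finite_signed_measure M \<mu>" "range A \<subseteq> sets M" "disjoint_family (A :: nat \<Rightarrow> 'a set)"
  shows "(\<lambda>n. \<mu> (A n)) sums \<mu> (\<Union>n. A n)"
  using assms by (simp add: finite_signed_measure_iff)

lemma finite_signed_measure_empty: "finite_signed_measure M \<mu> \<Longrightarrow> \<mu> {} = 0"
  by (simp add: finite_signed_measure_iff)

lemma finite_signed_measure_Un:
  assumes \<mu>: "finite_signed_measure M \<mu>" and AB: "A \<in> sets M" "B \<in> sets M" "A \<inter> B = {}"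
  shows "\<mu> (A \<union> B) = \<mu> A + \<mu> B"
proof -
  have "(\<lambda>n. \<mu> (binaryset A B n)) sums \<mu> (\<Union>n. binaryset A B n)"
    using AB by (intro finite_signed_measure_sums[OF \<mu>])
      (auto simp: range_binaryset_eq disjoint_family_on_def binaryset_def)
  moreover have "(\<lambda>n. \<mu> (binaryset A B n)) sums (\<mu> A + \<mu> B)"
    by (rule binaryset_sums) (simp add: finite_signed_measure_empty[OF \<mu>])
  ultimately show ?thesis
    by (auto simp: UN_binaryset_eq dest: sums_unique2)
qed

lemma finite_signed_measure_Diff:
  assumes "finite_signed_measure M \<mu>" "A \<in> sets M" "B \<in> sets M" "B \<subseteq> A"
  shows "\<mu> (A - B) = \<mu> A - \<mu> B"
  using finite_signed_measure_Un[OF assms(1), of B "A - B"] assms by (simp add: Un_absorb1)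

lemma finite_signed_measure_uminus:
  assumes "finite_signed_measure M \<mu>" shows "finite_signed_measure M (\<lambda>A. - \<mu> A)"
  using assms by (auto simp: finite_signed_measure_iff intro: sums_minus)

text \<open>
  Remove from \<open>X\<close>, one after the other, members of \<open>Q\<close> whose measure is at least half of what is
  possible (or at least \<open>1\<close>).  The removed sets are disjoint, so their measures are summable and tend
  to \<open>0\<close>; therefore nothing of positive measure can be left in \<open>Q\<close>.
\<close>

lemma greedy_exhaustion:
  assumes \<mu>: "finite_signed_measure M \<mu>" and Q: "Q \<subseteq> sets M" "{} \<in> Q" and X: "X \<in> sets M"
  obtains B :: "nat \<Rightarrow> 'a set" where "range B \<subseteq> Q" "disjoint_family B" "(\<Union>n. B n) \<subseteq> X"
    "\<And>n. 0 \<le> \<mu> (B n)" "\<And>C. C \<in> Q \<Longrightarrow> C \<subseteq> X - (\<Union>n. B n) \<Longrightarrow> \<mu> C \<le> 0"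
proof -
  have "\<exists>B\<in>Q. B \<subseteq> Y \<and> 0 \<le> \<mu> B \<and> (1 \<le> \<mu> B \<or> (\<forall>C\<in>Q. C \<subseteq> Y \<longrightarrow> \<mu> C \<le> 2 * \<mu> B))" for Y
  proof (cases "\<exists>C\<in>Q. C \<subseteq> Y \<and> 1 \<le> \<mu> C")
    case True
    then obtain C where "C \<in> Q" "C \<subseteq> Y" "1 \<le> \<mu> C" by blast
    then show ?thesis by (intro bexI[of _ C]) auto
  next
    case lt1: False
    show ?thesis
    proof (cases "\<forall>C\<in>Q. C \<subseteq> Y \<longrightarrow> \<mu> C \<le> 0")
      case True
      then show ?thesis
        using Q(2) finite_signed_measure_empty[OF \<mu>] by (intro bexI[of _ "{}"]) auto
    next
      case False
      then obtain C0 where C0: "C0 \<in> Q" "C0 \<subseteq> Y" "0 < \<mu> C0" by (auto simp: not_le)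
      define T where "T = \<mu> ` {C\<in>Q. C \<subseteq> Y}"
      have T: "C0 \<in> {C\<in>Q. C \<subseteq> Y}" "bdd_above T"
        using C0 lt1 by (auto simp: T_def intro!: bdd_aboveI[of _ 1])
      have "\<mu> C0 \<le> Sup T" using T by (auto simp: T_def intro!: cSup_upper)
      then have "Sup T / 2 < Sup T" using C0 by simp
      then obtain B where B: "B \<in> Q" "B \<subseteq> Y" "Sup T / 2 < \<mu> B"
        using T less_cSup_iff[of T "Sup T / 2"] by (auto simp: T_def)
      have "\<mu> C \<le> Sup T" if "C \<in> Q" "C \<subseteq> Y" for C
        using T that by (auto simp: T_def intro!: cSup_upper)
      with B \<open>\<mu> C0 \<le> Sup T\<close> C0 show ?thesis by (intro bexI[of _ B]) fastforce+
    qed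
  qed
  then obtain b where b: "\<And>Y. b Y \<in> Q" "\<And>Y. b Y \<subseteq> Y" "\<And>Y. 0 \<le> \<mu> (b Y)"
    "\<And>Y C. C \<in> Q \<Longrightarrow> C \<subseteq> Y \<Longrightarrow> 1 \<le> \<mu> (b Y) \<or> \<mu> C \<le> 2 * \<mu> (b Y)"
    by metis
  define Y where "Y = rec_nat X (\<lambda>_ Y. Y - b Y)"
  have Y: "Y 0 = X" "\<And>n. Y (Suc n) = Y n - b (Y n)" by (simp_all add: Y_def)
  define B where "B n = b (Y n)" for n
  have decY: "Y n \<subseteq> Y m" if "m \<le> n" for m n
    by (rule lift_Suc_antimono_le[of Y, OF _ that]) (auto simp: Y)
  have BY: "B n \<subseteq> Y m" if "m \<le> n" for m n
    using b(2)[of "Y n"] decY[OF that] by (auto simp: B_def)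
  have disj: "B m \<inter> B n = {}" if "m < n" for m n
    using BY[of "Suc m" n] that by (auto simp: Y B_def)
  then have dB: "disjoint_family B"
    unfolding disjoint_family_on_def by (metis Int_commute nat_neq_iff)
  have Yrem: "X - (\<Union>n. B n) \<subseteq> Y n" for n
    by (induction n) (auto simp: Y B_def)
  have BQ: "range B \<subseteq> Q" using b(1) by (auto simp: B_def)
  show thesis
  proof (rule that[OF BQ dB])
    show "(\<Union>n. B n) \<subseteq> X" using BY[of 0] by (auto simp: Y)
    show "0 \<le> \<mu> (B n)" for n using b(3) by (simp add: B_def)
    fix C assume C: "C \<in> Q" "C \<subseteq> X - (\<Union>n. B n)"
    have "summable (\<lambda>n. \<mu> (B n))"
      using finite_signed_measure_sums[OF \<mu> _ dB] BQ Q(1) by (auto simp: summable_def)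
    then have lim: "(\<lambda>n. \<mu> (B n)) \<longlonglongrightarrow> 0" by (rule summable_LIMSEQ_zero)
    show "\<mu> C \<le> 0"
    proof (rule ccontr)
      assume "\<not> \<mu> C \<le> 0"
      then have "\<forall>\<^sub>F n in sequentially. \<mu> (B n) < min 1 (\<mu> C / 2)"
        by (intro order_tendstoD(2)[OF lim]) auto
      then obtain n where "\<mu> (B n) < min 1 (\<mu> C / 2)"
        by (auto simp: eventually_sequentially)
      moreover have "1 \<le> \<mu> (B n) \<or> \<mu> C \<le> 2 * \<mu> (B n)"
        unfolding B_def using C Yrem[of n] by (intro b(4)) auto
      ultimately show False by auto
    qed
  qed
qed

text \<open>
  Exhausting \<open>D\<close> by sets on which \<open>-\<mu>\<close> is nonnegative leaves a set without negative parts, and the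
  removal can only increase the measure.
\<close>

lemma exists_positive_subset:
  assumes \<mu>: "finite_signed_measure M \<mu>" and D: "D \<in> sets M"
  obtains A where "A \<in> sets M" "A \<subseteq> D" "\<mu> D \<le> \<mu> A" "\<And>C. C \<in> sets M \<Longrightarrow> C \<subseteq> A \<Longrightarrow> 0 \<le> \<mu> C"
proof -
  note m = finite_signed_measure_uminus[OF \<mu>]
  obtain B :: "nat \<Rightarrow> 'a set" where B: "range B \<subseteq> sets M" "disjoint_family B" "(\<Union>n. B n) \<subseteq> D"
    "\<And>n. 0 \<le> - \<mu> (B n)" "\<And>C. C \<in> sets M \<Longrightarrow> C \<subseteq> D - (\<Union>n. B n) \<Longrightarrow> - \<mu> C \<le> 0"
    using greedy_exhaustion[OF m order_refl sets.empty_sets D] by metis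
  have U: "(\<Union>n. B n) \<in> sets M" using B(1) by auto
  have "\<mu> (\<Union>n. B n) \<le> 0"
    using sums_le[OF _ finite_signed_measure_sums[OF \<mu> B(1,2)] sums_zero] B(4) by force
  then have "\<mu> D \<le> \<mu> (D - (\<Union>n. B n))"
    using finite_signed_measure_Diff[OF \<mu> D U B(3)] by simp
  with B(5) U D show thesis by (intro that[of "D - (\<Union>n. B n)"]) force+
qed

text \<open>
  The greedy exhaustion is applied to the family of positive sets.  A set of positive measure outside
  of the resulting union would contain a positive set of positive measure, by
  \<open>exists_positive_subset\<close>.
\<close>

theorem hahn_set_exists:
  assumes \<mu>: "finite_signed_measure M \<mu>"
  shows "\<exists>H. hahn_set M \<mu> H"
proof -
  define Q where "Q = {A\<in>sets M. \<forall>C\<in>sets M. C \<subseteq> A \<longrightarrow> 0 \<le> \<mu> C}"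
  have Q: "Q \<subseteq> sets M" "{} \<in> Q" by (auto simp: Q_def finite_signed_measure_empty[OF \<mu>])
  obtain B :: "nat \<Rightarrow> 'a set" where B: "range B \<subseteq> Q" "disjoint_family B" "(\<Union>n. B n) \<subseteq> space M"
    "\<And>n. 0 \<le> \<mu> (B n)" "\<And>C. C \<in> Q \<Longrightarrow> C \<subseteq> space M - (\<Union>n. B n) \<Longrightarrow> \<mu> C \<le> 0"
    using greedy_exhaustion[OF \<mu> Q sets.top] by metis
  have Bs: "B n \<in> sets M" for n using B(1) Q(1) by auto
  show ?thesis unfolding hahn_set_def
  proof (intro exI[of _ "\<Union>n. B n"] conjI ballI impI)
    show "(\<Union>n. B n) \<in> sets M" using Bs by auto
  next
    fix A assume A: "A \<in> sets M" "A \<subseteq> (\<Union>n. B n)"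
    have "(\<lambda>n. \<mu> (A \<inter> B n)) sums \<mu> (\<Union>n. A \<inter> B n)"
      using A Bs B(2) by (intro finite_signed_measure_sums[OF \<mu>])
        (auto intro: disjoint_family_on_bisimulation)
    moreover have "(\<Union>n. A \<inter> B n) = A" using A by auto
    moreover have "0 \<le> \<mu> (A \<inter> B n)" for n
    proof -
      have "B n \<in> Q" using B(1) by auto
      then show ?thesis using A Bs by (auto simp: Q_def)
    qed
    ultimately show "0 \<le> \<mu> A" using sums_le[OF _ sums_zero, of "\<lambda>n. \<mu> (A \<inter> B n)"] by simp
  next
    fix A assume A: "A \<in> sets M" "A \<subseteq> space M - (\<Union>n. B n)"
    obtain C where C: "C \<in> sets M" "C \<subseteq> A" "\<mu> A \<le> \<mu> C" "\<And>E. E \<in> sets M \<Longrightarrow> E \<subseteq> C \<Longrightarrow> 0 \<le> \<mu> E"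
      using exists_positive_subset[OF \<mu> A(1)] by metis
    then have "\<mu> C \<le> 0" using A by (intro B(5)) (auto simp: Q_def)
    with C(3) show "\<mu> A \<le> 0" by simp
  qed
qed

lemma hahn_set_unique:
  assumes \<mu>: "finite_signed_measure M \<mu>" and H: "hahn_set M \<mu> H" "hahn_set M \<mu> H'" and A: "A \<in> sets M"
  shows "\<mu> (A \<inter> H) = \<mu> (A \<inter> H')"
proof -
  have HM: "H \<in> sets M" "H' \<in> sets M" using H by (auto simp: hahn_set_def)
  have zero: "\<mu> (A \<inter> G - G') = 0" if "hahn_set M \<mu> G" "hahn_set M \<mu> G'" for G G'
  proof -
    have "A \<inter> G - G' \<in> sets M" "A \<inter> G - G' \<subseteq> G" "A \<inter> G - G' \<subseteq> space M - G'"
      using that A sets.sets_into_space[OF A] by (auto simp: hahn_set_def)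
    then show ?thesis using that unfolding hahn_set_def by (meson antisym)
  qed
  have split: "\<mu> (A \<inter> G) = \<mu> (A \<inter> G \<inter> G') + \<mu> (A \<inter> G - G')"
    if "G \<in> sets M" "G' \<in> sets M" for G G'
  proof -
    have "\<mu> ((A \<inter> G \<inter> G') \<union> (A \<inter> G - G')) = \<mu> (A \<inter> G \<inter> G') + \<mu> (A \<inter> G - G')"
      using that A by (intro finite_signed_measure_Un[OF \<mu>]) auto
    moreover have "(A \<inter> G \<inter> G') \<union> (A \<inter> G - G') = A \<inter> G" by blast
    ultimately show ?thesis by simp
  qed
  have "A \<inter> H \<inter> H' = A \<inter> H' \<inter> H" by blast
  then show ?thesis using split[of H H'] split[of H' H] zero H HM by simp
qed

lemma variation_eq:
  assumes \<mu>: "finite_signed_measure M \<mu>" and H: "hahn_set M \<mu> H" and A: "A \<in> sets M"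
  shows "pos_variation M \<mu> A = \<mu> (A \<inter> H)" "neg_variation M \<mu> A = - \<mu> (A - H)"
proof -
  have S: "hahn_set M \<mu> (SOME H. hahn_set M \<mu> H)" using H by (rule someI)
  show pos: "pos_variation M \<mu> A = \<mu> (A \<inter> H)"
    unfolding pos_variation_def by (rule hahn_set_unique[OF \<mu> S H A])
  have "\<mu> (A - G) = \<mu> A - \<mu> (A \<inter> G)" if "hahn_set M \<mu> G" for G
    using finite_signed_measure_Diff[OF \<mu> A, of "A \<inter> G"] that A
    by (auto simp: hahn_set_def Diff_Int_distrib Diff_Int)
  then show "neg_variation M \<mu> A = - \<mu> (A - H)"
    using pos S H by (simp add: neg_variation_def pos_variation_def)
qed

section \<open>Jordan decomposition of a quasi-Levy type measure\<close>

definition rad :: "nat \<Rightarrow> real" where "rad n = 1 / real (Suc n)"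

text \<open>
  The annuli \<open>1/(n+1) \<le> \<bar>x\<bar> < 1/n\<close> (with the outermost one unbounded) partition \<open>-{0}\<close>, and each of
  them lies in one of the spaces \<^const>\<open>outer_borel\<close>.  Families of set functions on these spaces are
  glued along this partition.
\<close>

definition annulus :: "nat \<Rightarrow> real set" where
  "annulus n = {x. rad n \<le> \<bar>x\<bar> \<and> (\<forall>m<n. \<bar>x\<bar> < rad m)}"

lemma rad_pos [simp]: "0 < rad n"
  by (simp add: rad_def)

lemma annulus_borel [measurable]: "annulus n \<in> sets borel"
  unfolding annulus_def by measurable

lemma annulus_ge: "x \<in> annulus n \<Longrightarrow> rad n \<le> \<bar>x\<bar>"
  by (auto simp: annulus_def)

lemma disjoint_annulus: "disjoint_family annulus"
proof -
  have "annulus m \<inter> annulus n = {}" if "m < n" for m n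
    using that by (force simp: annulus_def)
  then show ?thesis unfolding disjoint_family_on_def by (metis Int_commute nat_neq_iff)
qed

lemma UN_annulus: "(\<Union>n. annulus n) = - {0}"
proof -
  have "\<exists>n. x \<in> annulus n" if "x \<noteq> 0" for x
  proof -
    have "\<exists>k. rad k < \<bar>x\<bar>"
      using reals_Archimedean[of "\<bar>x\<bar>"] that by (simp add: inverse_eq_divide rad_def)
    then obtain k where k: "rad k \<le> \<bar>x\<bar>" by (auto intro: less_imp_le)
    obtain n where "rad n \<le> \<bar>x\<bar>" "\<forall>m<n. \<not> rad m \<le> \<bar>x\<bar>"
      using exists_least_iff[of "\<lambda>n. rad n \<le> \<bar>x\<bar>"] k by blast
    then have "x \<in> annulus n" by (simp add: annulus_def not_le)
    then show ?thesis ..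
  qed
  moreover have "0 \<notin> annulus n" for n using annulus_ge[of 0 n] rad_pos[of n] by auto
  ultimately show ?thesis by auto
qed

lemma Int_annulus_outer: "B \<in> sets borel \<Longrightarrow> B \<inter> annulus n \<in> sets (outer_borel (rad n))"
  using annulus_ge[of _ n] by (fastforce simp: sets_outer_borel)

lemma emeasure_annulus_sum:
  assumes N: "sets N = sets borel" "emeasure N {0} = 0" and B: "B \<in> sets borel"
  shows "emeasure N B = (\<Sum>n. emeasure N (B \<inter> annulus n))"
proof -
  note [measurable_cong] = N(1)
  have [measurable]: "B \<in> sets N" "{0} \<in> sets N" using B by (simp_all add: N)
  have "emeasure N B = emeasure N (B - {0})"
    using N(2) by (intro emeasure_Diff_null_set[symmetric]) (auto simp: null_sets_def)
  also have "B - {0} = (\<Union>n. B \<inter> annulus n)" using UN_annulus by auto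
  also have "emeasure N \<dots> = (\<Sum>n. emeasure N (B \<inter> annulus n))"
    using disjoint_annulus by (intro suminf_emeasure[symmetric])
      (auto intro: disjoint_family_on_bisimulation)
  finally show ?thesis .
qed

lemma measure_eqI_outer:
  assumes "sets N = sets borel" "emeasure N {0} = 0" "sets N' = sets borel" "emeasure N' {0} = 0"
    and eq: "\<And>r B. 0 < r \<Longrightarrow> B \<in> sets (outer_borel r) \<Longrightarrow> emeasure N B = emeasure N' B"
  shows "N = N'"
proof (rule measure_eqI)
  fix B assume "B \<in> sets N"
  then have B: "B \<in> sets borel" using assms by simp
  have "emeasure N (B \<inter> annulus n) = emeasure N' (B \<inter> annulus n)" for n
    by (rule eq[OF rad_pos Int_annulus_outer[OF B]])
  then show "emeasure N B = emeasure N' B"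
    by (simp add: emeasure_annulus_sum[OF assms(1,2) B] emeasure_annulus_sum[OF assms(3,4) B])
qed (use assms in simp)

text \<open>
  The measure is the sum of the values of \<open>m\<close> over the annuli; its countable additivity is that of \<open>m\<close>
  on each annulus together with an exchange of two sums of nonnegative terms.
\<close>

lemma glued_measure_exists:
  assumes fs: "\<And>r. 0 < r \<Longrightarrow> finite_signed_measure (outer_borel r) m"
    and pos: "\<And>r B. 0 < r \<Longrightarrow> B \<in> sets (outer_borel r) \<Longrightarrow> 0 \<le> m B"
  obtains N where "sets N = sets borel" "emeasure N {0} = 0"
     "\<And>r B. 0 < r \<Longrightarrow> B \<in> sets (outer_borel r) \<Longrightarrow> emeasure N B = ennreal (m B)"
proof -
  define N where "N = measure_of UNIV (sets borel) (\<lambda>B. \<Sum>n. ennreal (m (B \<inter> annulus n)))"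
  note out = Int_annulus_outer
  have pos': "0 \<le> m (B \<inter> annulus n)" if "B \<in> sets borel" for B n
    by (rule pos[OF rad_pos out[OF that]])
  have m0: "m {} = 0" using finite_signed_measure_empty[OF fs[of 1]] by simp
  have sN: "sets N = sets borel" unfolding N_def using sets.sigma_sets_eq[of borel] by simp
  have eN: "emeasure N B = (\<Sum>n. ennreal (m (B \<inter> annulus n)))" if "B \<in> sets borel" for B
  proof (rule emeasure_measure_of[OF N_def])
    show "positive (sets N) (\<lambda>B. \<Sum>n. ennreal (m (B \<inter> annulus n)))"
      by (simp add: positive_def m0)
    show "countably_additive (sets N) (\<lambda>B. \<Sum>n. ennreal (m (B \<inter> annulus n)))"
      unfolding sN
    proof (rule countably_additiveI)
      fix A :: "nat \<Rightarrow> real set" assume A: "range A \<subseteq> sets borel" "disjoint_family A"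
      have "(\<Sum>i. ennreal (m (A i \<inter> annulus n))) = ennreal (m ((\<Union>i. A i) \<inter> annulus n))" for n
      proof -
        have "(\<lambda>i. m (A i \<inter> annulus n)) sums m (\<Union>i. A i \<inter> annulus n)"
          using A by (intro finite_signed_measure_sums[OF fs[OF rad_pos[of n]]])
            (auto intro!: out intro: disjoint_family_on_bisimulation)
        moreover have "0 \<le> m (A i \<inter> annulus n)" for i
          using A by (intro pos') auto
        ultimately have "(\<Sum>i. ennreal (m (A i \<inter> annulus n))) = ennreal (m (\<Union>i. A i \<inter> annulus n))"
          by (intro suminf_ennreal_eq)
        then show ?thesis by simp
      qed
      moreover have "(\<Sum>i. \<Sum>n. ennreal (m (A i \<inter> annulus n))) = (\<Sum>n. \<Sum>i. ennreal (m (A i \<inter> annulus n)))"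
      proof -
        have "(\<Sum>i. \<Sum>n. ennreal (m (A i \<inter> annulus n))) =
            (\<integral>\<^sup>+i. (\<Sum>n. ennreal (m (A i \<inter> annulus n))) \<partial>count_space UNIV)"
          by (simp add: nn_integral_count_space_nat)
        also have "\<dots> = (\<Sum>n. \<integral>\<^sup>+i. ennreal (m (A i \<inter> annulus n)) \<partial>count_space UNIV)"
          by (rule nn_integral_suminf) simp
        finally show ?thesis by (simp add: nn_integral_count_space_nat)
      qed
      ultimately show "(\<Sum>i. \<Sum>n. ennreal (m (A i \<inter> annulus n))) = (\<Sum>n. ennreal (m ((\<Union>i. A i) \<inter> annulus n)))"
        by simp
    qed
  qed (use that sN in auto)
  show thesis
  proof (rule that[OF sN])
    have "{0} \<inter> annulus n = {}" for n using UN_annulus by auto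
    then show "emeasure N {0} = 0" by (simp add: eN m0)
    fix r :: real and B assume r: "0 < r" and B: "B \<in> sets (outer_borel r)"
    then have "B \<in> sets borel" "0 \<notin> B" by (auto simp: sets_outer_borel)
    then have "B = (\<Union>n. B \<inter> annulus n)" using UN_annulus by auto
    moreover have "(\<lambda>n. m (B \<inter> annulus n)) sums m (\<Union>n. B \<inter> annulus n)"
      using B r disjoint_annulus by (intro finite_signed_measure_sums[OF fs[OF r]])
        (auto simp: sets_outer_borel intro: disjoint_family_on_bisimulation)
    ultimately have "(\<lambda>n. m (B \<inter> annulus n)) sums m B" by simp
    then show "emeasure N B = ennreal (m B)"
      using \<open>B \<in> sets borel\<close> by (subst eN) (auto intro!: suminf_ennreal_eq pos')
  qed
qed

lemma glued_measure_eqI: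
  assumes "sets N = sets borel" "emeasure N {0} = 0"
    "\<And>r B. 0 < r \<Longrightarrow> B \<in> sets (outer_borel r) \<Longrightarrow> emeasure N B = ennreal (m r B)"
  shows "glued_measure m = N"
  unfolding glued_measure_def
  by (rule the_equality) (use assms in \<open>auto intro!: measure_eqI_outer\<close>)

text \<open>
  Hahn sets of different spaces \<^const>\<open>outer_borel\<close> need not be compatible, but the Hahn set of the
  \<open>n\<close>-th space can be used on the \<open>n\<close>-th annulus only; the union is a Hahn set for all of them.
\<close>

lemma global_hahn_set:
  assumes fs: "\<And>r. 0 < r \<Longrightarrow> finite_signed_measure (outer_borel r) \<nu>"
  obtains H where "H \<in> sets borel"
    "\<And>r. 0 < r \<Longrightarrow> hahn_set (outer_borel r) \<nu> (H \<inter> space (outer_borel r))"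
proof -
  have "\<exists>H. hahn_set (outer_borel (rad n)) \<nu> H" for n
    by (intro hahn_set_exists fs rad_pos)
  then obtain h where h: "\<And>n. hahn_set (outer_borel (rad n)) \<nu> (h n)" by metis
  define H where "H = (\<Union>n. h n \<inter> annulus n)"
  have [measurable]: "h n \<in> sets borel" for n using h[of n] by (auto simp: hahn_set_def sets_outer_borel)
  have Hb: "H \<in> sets borel" by (auto simp: H_def)
  have Hann: "H \<inter> annulus n = h n \<inter> annulus n" for n
  proof -
    have "m = n" if "x \<in> annulus m" "x \<in> annulus n" for x m
      using disjoint_annulus that unfolding disjoint_family_on_def by blast
    then show ?thesis by (auto simp: H_def)
  qed
  have sp: "space (outer_borel r) = - {-r<..<r}" for r by (simp add: outer_borel_def space_restrict_space)
  show thesis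
  proof (rule that[OF Hb])
    fix r :: real assume r: "0 < r"
    have sumsB: "(\<lambda>n. \<nu> (B \<inter> annulus n)) sums \<nu> B" if "B \<in> sets (outer_borel r)" for B
    proof -
      have "(\<lambda>n. \<nu> (B \<inter> annulus n)) sums \<nu> (\<Union>n. B \<inter> annulus n)"
        using that r disjoint_annulus by (intro finite_signed_measure_sums[OF fs[OF r]])
          (auto simp: sets_outer_borel intro: disjoint_family_on_bisimulation)
      moreover have "0 \<notin> B" using that r by (auto simp: sets_outer_borel)
      then have "(\<Union>n. B \<inter> annulus n) = B" using UN_annulus by auto
      ultimately show ?thesis by simp
    qed
    have out: "B \<inter> annulus n \<in> sets (outer_borel (rad n))" if "B \<in> sets (outer_borel r)" for B n
      using that by (intro Int_annulus_outer) (auto simp: sets_outer_borel)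
    show "hahn_set (outer_borel r) \<nu> (H \<inter> space (outer_borel r))"
      unfolding hahn_set_def
    proof (intro conjI ballI impI)
      show "H \<inter> space (outer_borel r) \<in> sets (outer_borel r)"
        using Hb by (auto simp: sp sets_outer_borel)
    next
      fix B assume B: "B \<in> sets (outer_borel r)" "B \<subseteq> H \<inter> space (outer_borel r)"
      have "0 \<le> \<nu> (B \<inter> annulus n)" for n
      proof -
        have "B \<inter> annulus n \<subseteq> H \<inter> annulus n" using B(2) by auto
        then have "B \<inter> annulus n \<subseteq> h n" unfolding Hann by auto
        then show ?thesis using h[of n] out[OF B(1), of n] by (auto simp: hahn_set_def)
      qed
      then show "0 \<le> \<nu> B" using sums_le[OF _ sums_zero sumsB[OF B(1)]] by simp
    next
      fix B assume B: "B \<in> sets (outer_borel r)"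
        "B \<subseteq> space (outer_borel r) - H \<inter> space (outer_borel r)"
      have "\<nu> (B \<inter> annulus n) \<le> 0" for n
      proof -
        have "B \<inter> annulus n \<subseteq> space (outer_borel (rad n)) - h n"
        proof -
          have "B \<inter> H = {}" using sets.sets_into_space[OF B(1)] B(2) by auto
          then have "B \<inter> annulus n \<inter> h n = {}" using Hann[of n] by auto
          then show ?thesis using sets.sets_into_space[OF out[OF B(1), of n]] by auto
        qed
        then show ?thesis using h[of n] out[OF B(1), of n] by (auto simp: hahn_set_def)
      qed
      then show "\<nu> B \<le> 0" using sums_le[OF _ sumsB[OF B(1)] sums_zero] by simp
    qed
  qed
qed

lemma quasi_levy_type_finite_signed_measure:
  "quasi_levy_type \<nu> \<Longrightarrow> 0 < r \<Longrightarrow> finite_signed_measure (outer_borel r) \<nu>"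
  by (simp add: quasi_levy_type_def)

text \<open>
  With a Hahn set \<open>H\<close> that works for every radius, the positive and negative variations are
  \<open>B \<mapsto> \<nu>(B \<inter> H)\<close> and \<open>B \<mapsto> -\<nu>(B - H)\<close> independently of the radius, so that the gluing applies.
\<close>

theorem jordan_decomposition:
  assumes fs: "\<And>r. 0 < r \<Longrightarrow> finite_signed_measure (outer_borel r) \<nu>"
  shows "sets (ql_pos \<nu>) = sets borel" "sets (ql_neg \<nu>) = sets borel" "sets (ql_abs \<nu>) = sets borel"
    and "emeasure (ql_pos \<nu>) {0} = 0" "emeasure (ql_neg \<nu>) {0} = 0"
    and "B \<in> sets borel \<Longrightarrow> emeasure (ql_abs \<nu>) B = emeasure (ql_pos \<nu>) B + emeasure (ql_neg \<nu>) B"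
    and "0 < r \<Longrightarrow> B \<in> sets (outer_borel r) \<Longrightarrow> emeasure (ql_pos \<nu>) B < \<infinity> \<and> emeasure (ql_neg \<nu>) B < \<infinity> \<and>
      \<nu> B = measure (ql_pos \<nu>) B - measure (ql_neg \<nu>) B"
    and "0 < r \<Longrightarrow> B \<in> sets (outer_borel r) \<Longrightarrow> \<exists>H\<in>sets borel. 
      measure (ql_pos \<nu>) B = \<nu> (B \<inter> H) \<and> measure (ql_neg \<nu>) B = - \<nu> (B - H)"
proof -
  obtain H where H: "H \<in> sets borel"
    "\<And>r. 0 < r \<Longrightarrow> hahn_set (outer_borel r) \<nu> (H \<inter> space (outer_borel r))"
    using global_hahn_set[OF fs] by metis
  define p where "p B = \<nu> (B \<inter> H)" for B
  define n where "n B = - \<nu> (B - H)" for B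
  have out: "B \<inter> H \<in> sets (outer_borel r)" "B - H \<in> sets (outer_borel r)"
    if "B \<in> sets (outer_borel r)" for B r using that H(1) by (auto simp: sets_outer_borel)
  have var: "pos_variation (outer_borel r) \<nu> B = p B" "neg_variation (outer_borel r) \<nu> B = n B"
    if "0 < r" "B \<in> sets (outer_borel r)" for r B
  proof -
    have "B \<subseteq> space (outer_borel r)" using that(2) by (rule sets.sets_into_space)
    then have "B \<inter> (H \<inter> space (outer_borel r)) = B \<inter> H" "B - (H \<inter> space (outer_borel r)) = B - H"
      by auto
    then show "pos_variation (outer_borel r) \<nu> B = p B" "neg_variation (outer_borel r) \<nu> B = n B"
      using variation_eq[OF fs[OF that(1)] H(2)[OF that(1)] that(2)] by (simp_all add: p_def n_def)
  qed
  have p_fs: "finite_signed_measure (outer_borel r) p" if "0 < r" for r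
    unfolding finite_signed_measure_iff p_def
  proof (intro conjI allI impI)
    fix A :: "nat \<Rightarrow> real set" assume A: "range A \<subseteq> sets (outer_borel r)" "disjoint_family A"
    have "(\<lambda>i. \<nu> (A i \<inter> H)) sums \<nu> (\<Union>i. A i \<inter> H)"
      using A by (intro finite_signed_measure_sums[OF fs[OF that]])
        (auto intro!: out intro: disjoint_family_on_bisimulation)
    then show "(\<lambda>i. \<nu> (A i \<inter> H)) sums \<nu> ((\<Union>i. A i) \<inter> H)" by simp
  qed (simp add: finite_signed_measure_empty[OF fs[OF that]])
  have n_fs: "finite_signed_measure (outer_borel r) n" if "0 < r" for r
    unfolding finite_signed_measure_iff n_def
  proof (intro conjI allI impI)
    fix A :: "nat \<Rightarrow> real set" assume A: "range A \<subseteq> sets (outer_borel r)" "disjoint_family A"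
    have "(\<lambda>i. \<nu> (A i - H)) sums \<nu> (\<Union>i. A i - H)"
      using A by (intro finite_signed_measure_sums[OF fs[OF that]])
        (auto intro!: out intro: disjoint_family_on_bisimulation)
    then show "(\<lambda>i. - \<nu> (A i - H)) sums - \<nu> ((\<Union>i. A i) - H)"
      by (simp add: sums_minus)
  qed (simp add: finite_signed_measure_empty[OF fs[OF that]])
  have sp: "B \<subseteq> space (outer_borel r)" if "B \<in> sets (outer_borel r)" for B r
    using that by (rule sets.sets_into_space)
  have p0: "0 \<le> p B" and n0: "0 \<le> n B" if "0 < r" "B \<in> sets (outer_borel r)" for r B
    using H(2)[OF that(1)] out[OF that(2)] sp[OF that(2)] unfolding hahn_set_def p_def n_def by force+
  obtain N1 where N1: "sets N1 = sets borel" "emeasure N1 {0} = 0"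
     "\<And>r B. 0 < r \<Longrightarrow> B \<in> sets (outer_borel r) \<Longrightarrow> emeasure N1 B = ennreal (p B)"
    by (rule glued_measure_exists[of p]) (use p_fs p0 in auto)
  obtain N2 where N2: "sets N2 = sets borel" "emeasure N2 {0} = 0"
     "\<And>r B. 0 < r \<Longrightarrow> B \<in> sets (outer_borel r) \<Longrightarrow> emeasure N2 B = ennreal (n B)"
    by (rule glued_measure_exists[of n]) (use n_fs n0 in auto)
  have pn_fs: "finite_signed_measure (outer_borel r) (\<lambda>B. p B + n B)" if "0 < r" for r
    using p_fs[OF that] n_fs[OF that] by (auto simp: finite_signed_measure_iff intro!: sums_add)
  obtain N3 where N3: "sets N3 = sets borel" "emeasure N3 {0} = 0"
     "\<And>r B. 0 < r \<Longrightarrow> B \<in> sets (outer_borel r) \<Longrightarrow> emeasure N3 B = ennreal (p B + n B)"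
    by (rule glued_measure_exists[of "\<lambda>B. p B + n B"]) (use pn_fs n0 p0 in auto)
  have pos: "ql_pos \<nu> = N1" unfolding ql_pos_def by (intro glued_measure_eqI N1) (simp add: N1 var)
  have neg: "ql_neg \<nu> = N2" unfolding ql_neg_def by (intro glued_measure_eqI N2) (simp add: N2 var)
  have abs: "ql_abs \<nu> = N3" unfolding ql_abs_def
    by (intro glued_measure_eqI N3) (simp add: N3 var total_variation_def)
  show "sets (ql_pos \<nu>) = sets borel" "sets (ql_neg \<nu>) = sets borel" "sets (ql_abs \<nu>) = sets borel"
    "emeasure (ql_pos \<nu>) {0} = 0" "emeasure (ql_neg \<nu>) {0} = 0"
    by (simp_all add: pos neg abs N1 N2 N3)
  show "emeasure (ql_abs \<nu>) B = emeasure (ql_pos \<nu>) B + emeasure (ql_neg \<nu>) B" if B: "B \<in> sets borel"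
  proof -
    have o: "B \<inter> annulus k \<in> sets (outer_borel (rad k))" for k
      by (rule Int_annulus_outer[OF B])
    have "emeasure N3 (B \<inter> annulus k) = emeasure N1 (B \<inter> annulus k) + emeasure N2 (B \<inter> annulus k)" for k
      using N1(3)[OF rad_pos o] N2(3)[OF rad_pos o] N3(3)[OF rad_pos o] p0[OF rad_pos o] n0[OF rad_pos o] by (simp add: ennreal_plus)
    then show ?thesis unfolding pos neg abs
      by (simp add: emeasure_annulus_sum[OF _ _ B] N1 N2 N3 suminf_add)
  qed
  assume rB: "0 < r" "B \<in> sets (outer_borel r)"
  have "\<nu> B = p B - n B"
  proof -
    have "\<nu> ((B \<inter> H) \<union> (B - H)) = \<nu> (B \<inter> H) + \<nu> (B - H)"
      using out[OF rB(2)] by (intro finite_signed_measure_Un[OF fs[OF rB(1)]]) auto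
    then show ?thesis by (simp add: p_def n_def Un_Diff_Int Int_Diff_Un)
  qed
  then show "emeasure (ql_pos \<nu>) B < \<infinity> \<and> emeasure (ql_neg \<nu>) B < \<infinity> \<and>
      \<nu> B = measure (ql_pos \<nu>) B - measure (ql_neg \<nu>) B"
    using N1(3)[OF rB] N2(3)[OF rB] p0[OF rB] n0[OF rB] by (simp add: pos neg measure_def)
  show "\<exists>H\<in>sets borel. measure (ql_pos \<nu>) B = \<nu> (B \<inter> H) \<and> measure (ql_neg \<nu>) B = - \<nu> (B - H)"
    using N1(3)[OF rB] N2(3)[OF rB] p0[OF rB] n0[OF rB] H(1)
    by (intro bexI[of _ H]) (auto simp: pos neg measure_def p_def n_def)
qed

section \<open>Integrals with respect to differences of Levy measures\<close>

definition levy_weight :: "real \<Rightarrow> real" where "levy_weight x = min 1 (x\<^sup>2)"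

lemma levy_weight_measurable [measurable]: "levy_weight \<in> borel_measurable borel"
  unfolding levy_weight_def[abs_def] by measurable

lemma levy_weight_bounds [simp]: "0 \<le> levy_weight x" "levy_weight x \<le> 1" "\<bar>levy_weight x\<bar> = levy_weight x"
  by (auto simp: levy_weight_def)

lemma levy_weight_pos: "x \<noteq> 0 \<Longrightarrow> 0 < levy_weight x"
  by (auto simp: levy_weight_def)

lemma levy_weight_zero [simp]: "levy_weight 0 = 0"
  by (auto simp: levy_weight_def)

lemma levy_measureD:
  assumes "levy_measure N"
  shows "sets N = sets borel" "emeasure N {0} = 0" "(\<integral>\<^sup>+x. ennreal (levy_weight x) \<partial>N) < \<infinity>"
  using assms by (auto simp: levy_measure_def levy_weight_def)

lemma levy_measure_integrable:
  fixes g :: "real \<Rightarrow> 'b::{banach, second_countable_topology}"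
  assumes N: "levy_measure N" and g: "g \<in> borel_measurable borel" "\<And>x. norm (g x) \<le> C * levy_weight x"
  shows "integrable N g"
proof (rule Bochner_Integration.integrable_bound)
  show "integrable N (\<lambda>x. C * levy_weight x)"
    using levy_measureD[OF N] by (intro integrable_mult_right integrableI_bounded)
      (auto simp: measurable_cong_sets[OF levy_measureD(1)[OF N] refl])
  show "g \<in> borel_measurable N" using g(1) by (simp add: measurable_cong_sets[OF levy_measureD(1)[OF N] refl])
  show "AE x in N. norm (g x) \<le> norm (C * levy_weight x)"
    by (intro AE_I2) (metis g(2) abs_ge_self order_trans real_norm_def)
qed

text \<open>
  On \<open>\<bar>x\<bar> \<ge> r\<close> the weight \<open>1 \<and> x\<^sup>2\<close> is bounded from below by its value at \<open>r\<close>.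
\<close>

lemma levy_measure_outer_finite:
  assumes N: "levy_measure N" and r: "0 < r" and B: "B \<in> sets (outer_borel r)"
  shows "emeasure N B < \<infinity>"
proof -
  note [measurable_cong] = levy_measureD(1)[OF N]
  have [measurable]: "B \<in> sets borel" using B by (auto simp: sets_outer_borel)
  have "levy_weight r \<le> levy_weight x" if "x \<in> B" for x
  proof -
    have "r \<le> \<bar>x\<bar>" using that B by (force simp: sets_outer_borel)
    then have "r\<^sup>2 \<le> x\<^sup>2" using power_mono[of r "\<bar>x\<bar>" 2] r by simp
    then show ?thesis by (auto simp: levy_weight_def)
  qed
  then have "(\<integral>\<^sup>+x. ennreal (levy_weight r) * indicator B x \<partial>N) \<le> (\<integral>\<^sup>+x. ennreal (levy_weight x) \<partial>N)"
    by (intro nn_integral_mono) (auto simp: indicator_def ennreal_leI)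
  also have "\<dots> < \<infinity>" by (rule levy_measureD(3)[OF N])
  finally have "ennreal (levy_weight r) * emeasure N B < \<infinity>"
    by (subst (asm) nn_integral_cmult) simp_all
  then show ?thesis using levy_weight_pos[of r] r by (auto simp: ennreal_mult_less_top)
qed

lemma nn_integral_sum_cong:
  assumes sets: "sets N1 = sets borel" "sets N2 = sets borel" "sets N3 = sets borel" "sets N4 = sets (borel :: real measure)"
    and eq: "\<And>B. B \<in> sets borel \<Longrightarrow> emeasure N1 B + emeasure N2 B = emeasure N3 B + emeasure N4 B"
    and h: "h \<in> borel_measurable borel"
  shows "(\<integral>\<^sup>+x. h x \<partial>N1) + (\<integral>\<^sup>+x. h x \<partial>N2) = (\<integral>\<^sup>+x. h x \<partial>N3) + (\<integral>\<^sup>+x. h x \<partial>N4)"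
  using h
proof (induction rule: borel_measurable_induct)
  note [measurable_cong] = sets
  case (cong f g)
  have "integral\<^sup>N N f = integral\<^sup>N N g" if "sets N = sets borel" for N
    using cong(3) sets_eq_imp_space_eq[OF that] by (intro nn_integral_cong) auto
  then show ?case using cong sets by simp
next
  case (set A)
  then show ?case using eq[of A] sets by simp
next
  note [measurable_cong] = sets
  case (mult u c)
  then show ?case by (simp add: nn_integral_cmult distrib_left[symmetric])
next
  note [measurable_cong] = sets
  case (add u v)
  then show ?case by (simp add: nn_integral_add) (metis add.assoc add.commute)
next
  note [measurable_cong] = sets
  case (seq U)
  have *: "(\<integral>\<^sup>+x. (SUP i. U i) x \<partial>N) = (SUP i. \<integral>\<^sup>+x. U i x \<partial>N)" if "sets N = sets borel" for N
    using seq(1,3) that unfolding SUP_apply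
    by (intro nn_integral_monotone_convergence_SUP) (auto simp: measurable_cong_sets[OF that refl])
  have inc: "incseq (\<lambda>i. \<integral>\<^sup>+x. U i x \<partial>N)" for N
    using seq(3) by (auto simp: incseq_def le_fun_def intro!: nn_integral_mono)
  have "(SUP i. \<integral>\<^sup>+x. U i x \<partial>N) + (SUP i. \<integral>\<^sup>+x. U i x \<partial>N') = (SUP i. (\<integral>\<^sup>+x. U i x \<partial>N) + (\<integral>\<^sup>+x. U i x \<partial>N'))" for N N'
    by (rule ennreal_SUP_add[symmetric]) (rule inc)+
  then show ?case
    unfolding *[OF sets(1)] *[OF sets(2)] *[OF sets(3)] *[OF sets(4)] using seq by simp
qed

text \<open>
  The hypothesis is \<open>N1 - N2 = N3 - N4\<close>, written additively because all four measures may be infinite.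
\<close>

lemma integral_diff_cong_real:
  fixes g :: "real \<Rightarrow> real"
  assumes sets: "sets N1 = sets borel" "sets N2 = sets borel" "sets N3 = sets borel" "sets N4 = sets (borel :: real measure)"
    and eq: "\<And>B. B \<in> sets borel \<Longrightarrow> emeasure N1 B + emeasure N4 B = emeasure N3 B + emeasure N2 B"
    and g: "integrable N1 g" "integrable N2 g" "integrable N3 g" "integrable N4 g"
  shows "(\<integral>x. g x \<partial>N1) - (\<integral>x. g x \<partial>N2) = (\<integral>x. g x \<partial>N3) - (\<integral>x. g x \<partial>N4)"
proof -
  have gm: "g \<in> borel_measurable borel"
    using g(1) sets(1) by (auto simp: measurable_cong_sets[OF sets(1) refl] dest!: borel_measurable_integrable)
  have key: "enn2real (\<integral>\<^sup>+x. ennreal (f x) \<partial>N1) + enn2real (\<integral>\<^sup>+x. ennreal (f x) \<partial>N4) =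
     enn2real (\<integral>\<^sup>+x. ennreal (f x) \<partial>N3) + enn2real (\<integral>\<^sup>+x. ennreal (f x) \<partial>N2)"
    if f: "integrable N1 f" "integrable N2 f" "integrable N3 f" "integrable N4 f" "f \<in> borel_measurable borel" for f
  proof -
    have fin: "(\<integral>\<^sup>+x. ennreal (f x) \<partial>N) < top" if "integrable N f" for N
      using that by (auto simp: real_integrable_def less_top)
    have "enn2real ((\<integral>\<^sup>+x. ennreal (f x) \<partial>N1) + (\<integral>\<^sup>+x. ennreal (f x) \<partial>N4)) =
        enn2real ((\<integral>\<^sup>+x. ennreal (f x) \<partial>N3) + (\<integral>\<^sup>+x. ennreal (f x) \<partial>N2))"
      using nn_integral_sum_cong[OF sets(1,4,3,2) eq, of "\<lambda>x. ennreal (f x)"] f(5) by simp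
    then show ?thesis
      by (simp only: enn2real_plus fin f)
  qed
  have "enn2real (\<integral>\<^sup>+x. ennreal (- g x) \<partial>N1) + enn2real (\<integral>\<^sup>+x. ennreal (- g x) \<partial>N4) =
     enn2real (\<integral>\<^sup>+x. ennreal (- g x) \<partial>N3) + enn2real (\<integral>\<^sup>+x. ennreal (- g x) \<partial>N2)"
    using g gm by (intro key) auto
  with key[OF g gm] show ?thesis
    by (simp add: real_lebesgue_integral_def g)
qed

lemma integral_diff_cong:
  fixes g :: "real \<Rightarrow> complex"
  assumes sets: "sets N1 = sets borel" "sets N2 = sets borel" "sets N3 = sets borel" "sets N4 = sets (borel :: real measure)"
    and eq: "\<And>B. B \<in> sets borel \<Longrightarrow> emeasure N1 B + emeasure N4 B = emeasure N3 B + emeasure N2 B"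
    and g: "integrable N1 g" "integrable N2 g" "integrable N3 g" "integrable N4 g"
  shows "(\<integral>x. g x \<partial>N1) - (\<integral>x. g x \<partial>N2) = (\<integral>x. g x \<partial>N3) - (\<integral>x. g x \<partial>N4)"
  using integral_diff_cong_real[OF sets eq, of "\<lambda>x. Re (g x)"] integral_diff_cong_real[OF sets eq, of "\<lambda>x. Im (g x)"] g
  by (simp add: complex_eq_iff)

lemma quasi_levy_typeD:
  assumes \<nu>: "quasi_levy_type \<nu>"
  shows "levy_measure (ql_pos \<nu>)" "levy_measure (ql_neg \<nu>)"
    and "h \<in> borel_measurable borel \<Longrightarrow> (\<integral>\<^sup>+x. h x \<partial>ql_abs \<nu>) = (\<integral>\<^sup>+x. h x \<partial>ql_pos \<nu>) + (\<integral>\<^sup>+x. h x \<partial>ql_neg \<nu>)"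
proof -
  note J = jordan_decomposition[of \<nu>, OF quasi_levy_type_finite_signed_measure[OF \<nu>]]
  show *: "(\<integral>\<^sup>+x. h x \<partial>ql_abs \<nu>) = (\<integral>\<^sup>+x. h x \<partial>ql_pos \<nu>) + (\<integral>\<^sup>+x. h x \<partial>ql_neg \<nu>)"
    if "h \<in> borel_measurable borel" for h
    using nn_integral_sum_cong[of "ql_abs \<nu>" "null_measure borel" "ql_pos \<nu>" "ql_neg \<nu>" h] that J
    by (simp add: nn_integral_null_measure)
  have "(\<integral>\<^sup>+x. ennreal (min 1 (x\<^sup>2)) \<partial>ql_abs \<nu>) < \<infinity>" using \<nu> by (simp add: quasi_levy_type_def)
  then show "levy_measure (ql_pos \<nu>)" "levy_measure (ql_neg \<nu>)"
    using J by (auto simp: levy_measure_def *)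
qed

lemma emeasure_Diff_zero:
  assumes "levy_measure N" "B \<in> sets borel" shows "emeasure N (B - {0}) = emeasure N B"
  using levy_measureD[OF assms(1)] assms(2) by (intro emeasure_Diff_null_set) (auto simp: null_sets_def)

text \<open>
  With the Hahn set \<open>H\<close>, \<open>\<nu>\<^sup>+(B) = N1(B \<inter> H) - N2(B \<inter> H) \<le> N1(B)\<close>, and likewise
  \<open>\<nu>\<^sup>- \<le> N2\<close>; this bounds the variation of \<open>\<nu>\<close>.  The identity
  \<open>\<nu>\<^sup>+ + N2 = N1 + \<nu>\<^sup>-\<close>, true away from \<open>0\<close>, extends to all Borel sets by summation over the annuli.
\<close>

theorem quasi_levy_type_diff:
  assumes N: "levy_measure N1" "levy_measure N2"
    and \<nu>: "\<And>r B. 0 < r \<Longrightarrow> B \<in> sets (outer_borel r) \<Longrightarrow> \<nu> B = measure N1 B - measure N2 B"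
  shows "quasi_levy_type \<nu>"
    and "g \<in> borel_measurable borel \<Longrightarrow> (\<And>x. norm (g x :: complex) \<le> C * levy_weight x) \<Longrightarrow>
      ql_integral \<nu> g = (\<integral>x. g x \<partial>N1) - (\<integral>x. g x \<partial>N2)"
proof -
  note fin = levy_measure_outer_finite[OF N(1)] levy_measure_outer_finite[OF N(2)]
  have fs: "finite_signed_measure (outer_borel r) \<nu>" if r: "0 < r" for r
    unfolding finite_signed_measure_iff
  proof (intro conjI allI impI)
    show "\<nu> {} = 0" by (simp add: \<nu>[OF r])
    fix A :: "nat \<Rightarrow> real set" assume A: "range A \<subseteq> sets (outer_borel r)" "disjoint_family A"
    have U: "(\<Union>n. A n) \<in> sets (outer_borel r)" using A(1) by blast
    have An: "A n \<in> sets (outer_borel r)" for n using A(1) by auto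
    have s: "(\<lambda>n. measure N (A n)) sums measure N (\<Union>n. A n)" if "levy_measure N" for N
      using levy_measure_outer_finite[OF that r U] levy_measureD(1)[OF that] A
      by (intro measure_UNION) (auto simp: sets_outer_borel image_subset_iff)
    show "(\<lambda>n. \<nu> (A n)) sums \<nu> (\<Union>n. A n)"
      using sums_diff[OF s[OF N(1)] s[OF N(2)]] by (simp add: \<nu>[OF r U] \<nu>[OF r An])
  qed
  note J = jordan_decomposition[of \<nu>, OF fs]
  have le: "emeasure (ql_pos \<nu>) B \<le> emeasure N1 B" "emeasure (ql_neg \<nu>) B \<le> emeasure N2 B"
    and eq: "emeasure (ql_pos \<nu>) B + emeasure N2 B = emeasure N1 B + emeasure (ql_neg \<nu>) B"
    if r: "0 < r" and B: "B \<in> sets (outer_borel r)" for r B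
  proof -
    obtain H where H: "H \<in> sets borel" "measure (ql_pos \<nu>) B = \<nu> (B \<inter> H)" "measure (ql_neg \<nu>) B = - \<nu> (B - H)"
      using J(8)[OF _ r B] by auto
    have o: "B \<inter> H \<in> sets (outer_borel r)" "B - H \<in> sets (outer_borel r)"
      using B H(1) by (auto simp: sets_outer_borel)
    have mono: "measure N A \<le> measure N B" if "levy_measure N" "A \<in> sets (outer_borel r)" "A \<subseteq> B" for A N
      using levy_measure_outer_finite[OF that(1) r B] levy_measureD(1)[OF that(1)] that B
      by (intro measure_mono_fmeasurable fmeasurableI) (auto simp: sets_outer_borel)
    have f: "emeasure N1 B = ennreal (measure N1 B)" "emeasure N2 B = ennreal (measure N2 B)"
      "emeasure (ql_pos \<nu>) B = ennreal (measure (ql_pos \<nu>) B)" "emeasure (ql_neg \<nu>) B = ennreal (measure (ql_neg \<nu>) B)"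
      using fin[OF r B] J(7)[OF _ r B] by (auto simp: emeasure_eq_ennreal_measure)
    show "emeasure (ql_pos \<nu>) B \<le> emeasure N1 B"
      unfolding f H(2) \<nu>[OF r o(1)] using mono[OF N(1) o(1)] by (intro ennreal_leI) (auto intro: order_trans[rotated])
    show "emeasure (ql_neg \<nu>) B \<le> emeasure N2 B"
      unfolding f H(3) \<nu>[OF r o(2)] using mono[OF N(2) o(2)] by (intro ennreal_leI) (auto intro: order_trans[rotated])
    show "emeasure (ql_pos \<nu>) B + emeasure N2 B = emeasure N1 B + emeasure (ql_neg \<nu>) B"
      unfolding f using J(7)[OF _ r B] \<nu>[OF r B] by (simp add: ennreal_plus[symmetric] del: ennreal_plus)
  qed
  have ann: "emeasure N B = (\<Sum>n. emeasure N (B \<inter> annulus n))"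
    if "N \<in> {N1, N2, ql_pos \<nu>, ql_neg \<nu>}" "B \<in> sets borel" for N B
    using that levy_measureD[OF N(1)] levy_measureD[OF N(2)] J by (intro emeasure_annulus_sum) auto
  have le': "emeasure (ql_pos \<nu>) B \<le> emeasure N1 B" "emeasure (ql_neg \<nu>) B \<le> emeasure N2 B"
    and eq': "emeasure (ql_pos \<nu>) B + emeasure N2 B = emeasure N1 B + emeasure (ql_neg \<nu>) B"
    if B: "B \<in> sets borel" for B
    using le[OF rad_pos Int_annulus_outer[OF B]] eq[OF rad_pos Int_annulus_outer[OF B]]
    by (auto simp: ann[OF _ B] suminf_add intro!: suminf_le)
  have nn_le: "(\<integral>\<^sup>+x. h x \<partial>N) \<le> (\<integral>\<^sup>+x. h x \<partial>N')"
    if "sets N = sets borel" "sets N' = sets borel" "\<And>B. B \<in> sets borel \<Longrightarrow> emeasure N B \<le> emeasure N' B"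
    for N N' and h :: "real \<Rightarrow> ennreal"
    by (intro nn_integral_mono_measure) (use that in \<open>auto simp: le_measure\<close>)
  have "(\<integral>\<^sup>+x. ennreal (min 1 (x\<^sup>2)) \<partial>ql_pos \<nu>) < \<infinity>" "(\<integral>\<^sup>+x. ennreal (min 1 (x\<^sup>2)) \<partial>ql_neg \<nu>) < \<infinity>"
    using N nn_le[OF _ _ le'(1)] nn_le[OF _ _ le'(2)] J unfolding levy_measure_def
    by (blast intro: le_less_trans)+
  then have L: "levy_measure (ql_pos \<nu>)" "levy_measure (ql_neg \<nu>)"
    using J by (auto simp: levy_measure_def)
  have "(\<integral>\<^sup>+x. ennreal (min 1 (x\<^sup>2)) \<partial>ql_abs \<nu>) =
      (\<integral>\<^sup>+x. ennreal (min 1 (x\<^sup>2)) \<partial>ql_pos \<nu>) + (\<integral>\<^sup>+x. ennreal (min 1 (x\<^sup>2)) \<partial>ql_neg \<nu>)"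
    using nn_integral_sum_cong[of "ql_abs \<nu>" "null_measure borel" "ql_pos \<nu>" "ql_neg \<nu>" "\<lambda>x. ennreal (min 1 (x\<^sup>2))"] J
    by (simp add: nn_integral_null_measure)
  then show "quasi_levy_type \<nu>"
    using fs L by (auto simp: quasi_levy_type_def levy_measure_def)
  assume g: "g \<in> borel_measurable borel" "\<And>x. norm (g x :: complex) \<le> C * levy_weight x"
  show "ql_integral \<nu> g = (\<integral>x. g x \<partial>N1) - (\<integral>x. g x \<partial>N2)"
    unfolding ql_integral_def
    by (rule integral_diff_cong) (use eq' N L levy_measureD(1) levy_measure_integrable[OF _ g] in auto)
qed

text \<open>
  A bimeasure such as \<open>J\<close> controls \<open>\<nu>\<close> only through the finite measures weighted by \<open>1 \<and> x\<^sup>2\<close>.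
  Integrating the reciprocal of the weight against them recovers the measures themselves, as a Levy
  measure has no mass at \<open>0\<close>.
\<close>

theorem ql_integral_eq_diff:
  fixes g :: "real \<Rightarrow> complex"
  assumes \<nu>: "quasi_levy_type \<nu>" and N: "levy_measure N1" "levy_measure N2"
    and w: "\<And>B. B \<in> sets borel \<Longrightarrow> ql_integral \<nu> (\<lambda>x. indicator B x * levy_weight x) =
      (\<integral>x. indicator B x * levy_weight x \<partial>N1) - (\<integral>x. indicator B x * levy_weight x \<partial>N2)"
    and g: "g \<in> borel_measurable borel" "\<And>x. norm (g x) \<le> C * levy_weight x"
  shows "ql_integral \<nu> g = (\<integral>x. g x \<partial>N1) - (\<integral>x. g x \<partial>N2)"
proof -
  note L = quasi_levy_typeD(1,2)[OF \<nu>]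
  let ?D = "\<lambda>N. density N (\<lambda>x. ennreal (levy_weight x))"
  have D: "emeasure (?D N) B = ennreal (\<integral>x. indicator B x * levy_weight x \<partial>N)"
    if N: "levy_measure N" and B: "B \<in> sets borel" for N B
  proof -
    note [measurable_cong] = levy_measureD(1)[OF N]
    have [measurable]: "B \<in> sets borel" by fact
    have "emeasure (?D N) B = (\<integral>\<^sup>+x. ennreal (indicator B x * levy_weight x) \<partial>N)"
      using B by (subst emeasure_density) (auto intro!: nn_integral_cong simp: indicator_def)
    also have "\<dots> = ennreal (\<integral>x. indicator B x * levy_weight x \<partial>N)"
      by (intro nn_integral_eq_integral levy_measure_integrable[OF N, of _ 1]) (auto simp: indicator_def)
    finally show ?thesis .
  qed
  have wD: "emeasure (?D (ql_pos \<nu>)) B + emeasure (?D N2) B = emeasure (?D N1) B + emeasure (?D (ql_neg \<nu>)) B"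
    if B: "B \<in> sets borel" for B
  proof -
    have nn: "0 \<le> (\<integral>x. indicator B x * levy_weight x \<partial>N)" for N
      by (intro Bochner_Integration.integral_nonneg) auto
    show ?thesis
      using w[OF B] unfolding D[OF L(1) B] D[OF L(2) B] D[OF N(1) B] D[OF N(2) B]
      by (simp add: ql_integral_def nn ennreal_plus[symmetric] del: ennreal_plus)
  qed
  have DN: "(\<integral>\<^sup>+x. indicator (B - {0}) x * ennreal (1 / levy_weight x) \<partial>?D N) = emeasure N B"
    if N: "levy_measure N" and B: "B \<in> sets borel" for N B
  proof -
    note [measurable_cong] = levy_measureD(1)[OF N]
    have [measurable]: "B \<in> sets borel" by fact
    have "(\<integral>\<^sup>+x. indicator (B - {0}) x * ennreal (1 / levy_weight x) \<partial>?D N) = (\<integral>\<^sup>+x. indicator (B - {0}) x \<partial>N)"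
    proof (subst nn_integral_density)
      have "ennreal (levy_weight x) * (indicator (B - {0}) x * ennreal (1 / levy_weight x)) = indicator (B - {0}) x" for x
        using levy_weight_pos[of x] by (cases "x = 0") (auto simp: indicator_def ennreal_mult[symmetric])
      then show "(\<integral>\<^sup>+x. ennreal (levy_weight x) * (indicator (B - {0}) x * ennreal (1 / levy_weight x)) \<partial>N) =
          (\<integral>\<^sup>+x. indicator (B - {0}) x \<partial>N)" by simp
    qed auto
    then show ?thesis using emeasure_Diff_zero[OF N B] by simp
  qed
  have "emeasure (ql_pos \<nu>) B + emeasure N2 B = emeasure N1 B + emeasure (ql_neg \<nu>) B" if B: "B \<in> sets borel" for B
  proof -
    have [measurable]: "B \<in> sets borel" by fact
    show ?thesis
      unfolding DN[OF L(1) B, symmetric] DN[OF L(2) B, symmetric] DN[OF N(1) B, symmetric] DN[OF N(2) B, symmetric]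
      by (rule nn_integral_sum_cong) (use wD N L levy_measureD(1) in auto)
  qed
  then show ?thesis
    unfolding ql_integral_def
    by (intro integral_diff_cong) (use N L levy_measureD(1) levy_measure_integrable[OF _ g] in auto)
qed

section \<open>Kernels of Levy measures and their mixtures\<close>

lemma levy_weight_mult_le: "levy_weight (c * x) \<le> (1 + c\<^sup>2) * levy_weight x"
proof -
  have 1: "c\<^sup>2 * x\<^sup>2 \<le> (1 + c\<^sup>2) * x\<^sup>2" by (intro mult_right_mono) auto
  show ?thesis
  proof (cases "x\<^sup>2 \<le> 1")
    case True
    then show ?thesis using 1 by (simp add: levy_weight_def power_mult_distrib min.coboundedI2)
  next
    case False
    then show ?thesis by (simp add: levy_weight_def min.coboundedI1)
  qed
qed

text \<open>
  Both \<open>s \<mapsto> \<rho>\<^sup>+(s,\<cdot>)\<close> and \<open>s \<mapsto> \<rho>\<^sup>-(s,\<cdot>)\<close> are of this form; the bound \<open>2\<close> is the one that comes with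
  \<open>\<rho>\<close>.
\<close>

locale levy_kernel = finite_measure L for L :: "'s measure" +
  fixes \<kappa> :: "'s \<Rightarrow> real measure"
  assumes kernel_levy: "s \<in> space L \<Longrightarrow> levy_measure (\<kappa> s)"
    and kernel_bound: "s \<in> space L \<Longrightarrow> (\<integral>\<^sup>+x. ennreal (levy_weight x) \<partial>\<kappa> s) \<le> 2"
    and kernel_measurable: "B \<in> sets borel \<Longrightarrow> (\<lambda>s. emeasure (\<kappa> s) B) \<in> borel_measurable L"
begin

lemma kernel_sets: "s \<in> space L \<Longrightarrow> sets (\<kappa> s) = sets borel"
  using kernel_levy levy_measureD(1) by blast

lemma kernel_measurable_iff: "s \<in> space L \<Longrightarrow> borel_measurable (\<kappa> s) = borel_measurable borel"
  using measurable_cong_sets[OF kernel_sets refl] by blast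

lemma kernel_nn_integral_measurable:
  assumes "h \<in> borel_measurable borel"
  shows "(\<lambda>s. \<integral>\<^sup>+x. h x \<partial>\<kappa> s) \<in> borel_measurable L"
  using assms
proof (induction rule: borel_measurable_induct)
  case (cong f g)
  then have "f = g" by (auto simp: fun_eq_iff)
  with cong show ?case by simp
next
  case (set A)
  then show ?case using kernel_measurable[of A]
    by (subst measurable_cong[of _ _ "\<lambda>s. emeasure (\<kappa> s) A"]) (auto simp: kernel_sets)
next
  case (mult u c)
  then show ?case
    by (subst measurable_cong[of _ _ "\<lambda>s. c * (\<integral>\<^sup>+x. u x \<partial>\<kappa> s)"])
      (auto simp: nn_integral_cmult kernel_measurable_iff)
next
  case (add u v)
  then show ?case
    by (subst measurable_cong[of _ _ "\<lambda>s. (\<integral>\<^sup>+x. u x \<partial>\<kappa> s) + (\<integral>\<^sup>+x. v x \<partial>\<kappa> s)"])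
      (auto simp: nn_integral_add kernel_measurable_iff)
next
  case (seq U)
  have *: "(\<integral>\<^sup>+x. (SUP i. U i) x \<partial>\<kappa> s) = (SUP i. \<integral>\<^sup>+x. U i x \<partial>\<kappa> s)" if "s \<in> space L" for s
    using seq(1,3) that unfolding SUP_apply
    by (intro nn_integral_monotone_convergence_SUP) (auto simp: kernel_measurable_iff)
  have "(\<lambda>s. SUP i. \<integral>\<^sup>+x. U i x \<partial>\<kappa> s) \<in> borel_measurable L"
    using seq by (intro borel_measurable_SUP) auto
  then show ?case by (subst measurable_cong[OF *])
qed

text \<open>
  The measures \<open>\<kappa> s\<close> are infinite in general, but weighted by \<open>(1 \<and> x\<^sup>2) / 2\<close> they form a
  subprobability kernel, for which joint measurability is known.
\<close>

lemma kernel_nn_integral_measurable2: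
  assumes g: "(\<lambda>(s, x). g s x) \<in> borel_measurable (L \<Otimes>\<^sub>M borel)"
  shows "(\<lambda>s. \<integral>\<^sup>+x. g s x \<partial>\<kappa> s) \<in> borel_measurable L"
proof -
  note [measurable] = g
  define k where "k s = density (\<kappa> s) (\<lambda>x. ennreal (levy_weight x / 2))" for s
  have k[measurable]: "k \<in> measurable L (subprob_algebra borel)"
  proof (rule measurable_subprob_algebra)
    fix s assume s: "s \<in> space L"
    have sp: "space (\<kappa> s) = UNIV" using sets_eq_imp_space_eq[OF kernel_sets[OF s]] by simp
    have "emeasure (k s) (space (k s)) = (\<integral>\<^sup>+x. ennreal (1 / 2) * ennreal (levy_weight x) \<partial>\<kappa> s)"
    proof -
      have "ennreal (levy_weight x / 2) = ennreal (1 / 2) * ennreal (levy_weight x)" for x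
        by (subst ennreal_mult[symmetric]) auto
      then show ?thesis unfolding k_def using s
        by (subst emeasure_density) (auto simp: sp kernel_measurable_iff kernel_sets intro!: nn_integral_cong)
    qed
    also have "\<dots> = ennreal (1 / 2) * (\<integral>\<^sup>+x. ennreal (levy_weight x) \<partial>\<kappa> s)"
      using s by (intro nn_integral_cmult) (simp add: kernel_measurable_iff)
    also have "\<dots> \<le> ennreal (1 / 2) * 2"
      by (intro mult_left_mono kernel_bound s) simp
    also have "\<dots> = ennreal (1 / 2) * ennreal 2" by (simp only: ennreal_numeral)
    also have "\<dots> = 1" by (subst ennreal_mult[symmetric]) auto
    finally show "subprob_space (k s)" by (intro subprob_spaceI) (auto simp: k_def sp)
    show "sets (k s) = sets borel" using s by (simp add: k_def kernel_sets)
  next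
    fix A :: "real set" assume A[measurable]: "A \<in> sets borel"
    have "(\<lambda>s. \<integral>\<^sup>+x. ennreal (levy_weight x / 2) * indicator A x \<partial>\<kappa> s) \<in> borel_measurable L"
      by (rule kernel_nn_integral_measurable) measurable
    then show "(\<lambda>s. emeasure (k s) A) \<in> borel_measurable L"
      by (subst measurable_cong) (auto simp: k_def emeasure_density kernel_measurable_iff kernel_sets)
  qed
  have "(\<lambda>s. \<integral>\<^sup>+x. g s x * (indicator (-{0}) x * ennreal (2 / levy_weight x)) \<partial>k s) \<in> borel_measurable L"
    by (rule nn_integral_measurable_subprob_algebra2[OF _ k]) measurable
  moreover have "(\<integral>\<^sup>+x. g s x \<partial>\<kappa> s) = (\<integral>\<^sup>+x. g s x * (indicator (-{0}) x * ennreal (2 / levy_weight x)) \<partial>k s)"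
    if s: "s \<in> space L" for s
  proof -
    have gs: "g s \<in> borel_measurable borel"
      using measurable_compose[OF measurable_Pair1'[OF s] g] by simp
    have "(\<integral>\<^sup>+x. g s x * (indicator (-{0}) x * ennreal (2 / levy_weight x)) \<partial>k s) =
       (\<integral>\<^sup>+x. ennreal (levy_weight x / 2) * (g s x * (indicator (-{0}) x * ennreal (2 / levy_weight x))) \<partial>\<kappa> s)"
      unfolding k_def using gs s by (intro nn_integral_density) (auto simp: kernel_measurable_iff)
    also have "\<dots> = (\<integral>\<^sup>+x. g s x * indicator (-{0}) x \<partial>\<kappa> s)"
    proof (rule nn_integral_cong)
      fix x
      have "ennreal (levy_weight x / 2) * ennreal (2 / levy_weight x) = 1" if "x \<noteq> 0"
        using levy_weight_pos[OF that] by (subst ennreal_mult[symmetric]) auto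
      then show "ennreal (levy_weight x / 2) * (g s x * (indicator (-{0}) x * ennreal (2 / levy_weight x))) = g s x * indicator (-{0}) x"
        by (cases "x = 0") (auto simp: mult.left_commute[of _ "g s x"])
    qed
    also have "\<dots> = (\<integral>\<^sup>+x. g s x \<partial>\<kappa> s)"
    proof (rule nn_integral_cong_AE)
      have "{0} \<in> null_sets (\<kappa> s)" using levy_measureD[OF kernel_levy[OF s]] by (auto simp: null_sets_def)
      from AE_not_in[OF this] show "AE x in \<kappa> s. g s x * indicator (-{0}) x = g s x"
        by eventually_elim auto
    qed
    finally show ?thesis by simp
  qed
  ultimately show ?thesis by (subst measurable_cong) auto
qed

lemma emeasure_F_tilde:
  assumes C: "C \<in> sets (L \<Otimes>\<^sub>M borel)"
  shows "emeasure (F_tilde L \<kappa>) C = (\<integral>\<^sup>+s. (\<integral>\<^sup>+x. indicator C (s, x) \<partial>\<kappa> s) \<partial>L)"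
proof (rule emeasure_measure_of[OF F_tilde_def])
  let ?\<mu> = "\<lambda>C. \<integral>\<^sup>+s. (\<integral>\<^sup>+x. indicator C (s, x) \<partial>\<kappa> s) \<partial>L"
  show "sets (L \<Otimes>\<^sub>M borel) \<subseteq> Pow (space (L \<Otimes>\<^sub>M borel))" using sets.space_closed by blast
  have S: "sets (F_tilde L \<kappa>) = sets (L \<Otimes>\<^sub>M borel)" by (simp add: F_tilde_def)
  show "positive (sets (F_tilde L \<kappa>)) ?\<mu>" by (simp add: positive_def)
  show "C \<in> sets (F_tilde L \<kappa>)" using C S by simp
  show "countably_additive (sets (F_tilde L \<kappa>)) ?\<mu>"
    unfolding S
  proof (rule countably_additiveI)
    fix A :: "nat \<Rightarrow> ('s \<times> real) set" assume A: "range A \<subseteq> sets (L \<Otimes>\<^sub>M borel)" "disjoint_family A"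
    have [measurable]: "A i \<in> sets (L \<Otimes>\<^sub>M borel)" for i using A(1) by auto
    have sec: "(\<lambda>x. indicator (A i) (s, x) :: ennreal) \<in> borel_measurable borel" if "s \<in> space L" for i s
      using measurable_compose[OF measurable_Pair1'[OF that], of "indicator (A i)" borel borel] by simp
    have "(\<Sum>i. ?\<mu> (A i)) = (\<integral>\<^sup>+s. (\<Sum>i. \<integral>\<^sup>+x. indicator (A i) (s, x) \<partial>\<kappa> s) \<partial>L)"
      by (rule nn_integral_suminf[symmetric], rule kernel_nn_integral_measurable2) simp
    also have "\<dots> = (\<integral>\<^sup>+s. (\<integral>\<^sup>+x. (\<Sum>i. indicator (A i) (s, x)) \<partial>\<kappa> s) \<partial>L)"
      using sec by (intro nn_integral_cong nn_integral_suminf[symmetric]) (auto simp: kernel_measurable_iff)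
    also have "\<dots> = ?\<mu> (\<Union>i. A i)"
      using A(2) by (simp add: suminf_indicator)
    finally show "(\<Sum>i. ?\<mu> (A i)) = ?\<mu> (\<Union>i. A i)" .
  qed
qed

context
  fixes f :: "'s \<Rightarrow> real"
  assumes f [measurable]: "f \<in> borel_measurable L"
begin

abbreviation "N\<^sub>f \<equiv> F_tilde_f L \<kappa> f"

lemma sets_F_tilde_f: "sets N\<^sub>f = sets borel"
  unfolding F_tilde_f_def using sets.sigma_sets_eq[of borel] by simp

lemma emeasure_F_tilde_f:
  assumes B: "B \<in> sets borel"
  shows "emeasure N\<^sub>f B = (\<integral>\<^sup>+s. (\<integral>\<^sup>+x. indicator (B - {0}) (f s * x) \<partial>\<kappa> s) \<partial>L)"
proof -
  let ?C = "\<lambda>B. {(s, x) \<in> space L \<times> UNIV. f s * x \<in> B - {0}}"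
  have Cm: "?C A \<in> sets (L \<Otimes>\<^sub>M borel)" if [measurable]: "A \<in> sets borel" for A
  proof -
    have "(\<lambda>(s, x). f s * x) -` (A - {0}) \<inter> space (L \<Otimes>\<^sub>M borel) \<in> sets (L \<Otimes>\<^sub>M borel)"
      by (rule measurable_sets[of _ _ borel]) measurable
    also have "(\<lambda>(s, x). f s * x) -` (A - {0}) \<inter> space (L \<Otimes>\<^sub>M borel) = ?C A"
      by (auto simp: space_pair_measure)
    finally show ?thesis .
  qed
  have sF: "sets (F_tilde L \<kappa>) = sets (L \<Otimes>\<^sub>M borel)" by (simp add: F_tilde_def)
  have "emeasure N\<^sub>f B = emeasure (F_tilde L \<kappa>) (?C B)"
  proof (rule emeasure_measure_of[OF F_tilde_f_def])
    show "positive (sets N\<^sub>f) (\<lambda>B. emeasure (F_tilde L \<kappa>) (?C B))"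
      by (simp add: positive_def)
    show "countably_additive (sets N\<^sub>f) (\<lambda>B. emeasure (F_tilde L \<kappa>) (?C B))"
      unfolding sets_F_tilde_f
    proof (rule countably_additiveI)
      fix A :: "nat \<Rightarrow> real set" assume A: "range A \<subseteq> sets borel" "disjoint_family A"
      have "(\<Sum>i. emeasure (F_tilde L \<kappa>) (?C (A i))) = emeasure (F_tilde L \<kappa>) (\<Union>i. ?C (A i))"
        using A Cm by (intro suminf_emeasure) (auto simp: sF disjoint_family_on_def)
      also have "(\<Union>i. ?C (A i)) = ?C (\<Union>i. A i)" by auto
      finally show "(\<Sum>i. emeasure (F_tilde L \<kappa>) (?C (A i))) = emeasure (F_tilde L \<kappa>) (?C (\<Union>i. A i))" .
    qed
  qed (use B sets_F_tilde_f in auto)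
  also have "\<dots> = (\<integral>\<^sup>+s. (\<integral>\<^sup>+x. indicator (?C B) (s, x) \<partial>\<kappa> s) \<partial>L)"
    by (rule emeasure_F_tilde[OF Cm[OF B]])
  also have "\<dots> = (\<integral>\<^sup>+s. (\<integral>\<^sup>+x. indicator (B - {0}) (f s * x) \<partial>\<kappa> s) \<partial>L)"
    by (intro nn_integral_cong) (auto simp: indicator_def)
  finally show ?thesis .
qed

lemma emeasure_F_tilde_f_zero: "emeasure N\<^sub>f {0} = 0"
  by (simp add: emeasure_F_tilde_f)

lemma nn_integral_F_tilde_f:
  assumes "h \<in> borel_measurable borel" "h 0 = 0"
  shows "(\<integral>\<^sup>+y. h y \<partial>N\<^sub>f) = (\<integral>\<^sup>+s. (\<integral>\<^sup>+x. h (f s * x) \<partial>\<kappa> s) \<partial>L)"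
proof -
  note [measurable_cong] = sets_F_tilde_f
  let ?I = "\<lambda>u. \<integral>\<^sup>+s. (\<integral>\<^sup>+x. indicator (-{0}) (f s * x) * u (f s * x) \<partial>\<kappa> s) \<partial>L"
  have m1: "(\<lambda>x. indicator (-{0}) (f s * x) * u (f s * x)) \<in> borel_measurable (\<kappa> s)"
    if "s \<in> space L" "u \<in> borel_measurable borel" for s and u :: "real \<Rightarrow> ennreal"
    using that by (simp add: kernel_measurable_iff)
  have m2: "(\<lambda>s. \<integral>\<^sup>+x. indicator (-{0}) (f s * x) * u (f s * x) \<partial>\<kappa> s) \<in> borel_measurable L"
    if [measurable]: "u \<in> borel_measurable borel" for u :: "real \<Rightarrow> ennreal"
    by (rule kernel_nn_integral_measurable2) measurable
  have "(\<integral>\<^sup>+y. h y \<partial>N\<^sub>f) = ?I h"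
    using assms(1)
  proof (induction rule: borel_measurable_induct)
    case (cong f g)
    then have "f = g" by (auto simp: fun_eq_iff)
    with cong show ?case by simp
  next
    case (set A)
    have "(\<integral>\<^sup>+y. indicator A y \<partial>N\<^sub>f) = emeasure N\<^sub>f A"
      using set by (intro nn_integral_indicator) (simp add: sets_F_tilde_f)
    also have "\<dots> = ?I (indicator A)"
      using set unfolding emeasure_F_tilde_f[OF set]
      by (intro nn_integral_cong) (auto simp: indicator_def)
    finally show ?case .
  next
    case (mult u c)
    have "?I (\<lambda>y. c * u y) = (\<integral>\<^sup>+s. c * (\<integral>\<^sup>+x. indicator (-{0}) (f s * x) * u (f s * x) \<partial>\<kappa> s) \<partial>L)"
      using mult m1 by (intro nn_integral_cong) (simp add: nn_integral_cmult[symmetric] mult.left_commute)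
    then show ?case using mult m2 by (simp add: nn_integral_cmult)
  next
    case (add u v)
    have "?I (\<lambda>y. v y + u y) = (\<integral>\<^sup>+s. (\<integral>\<^sup>+x. indicator (-{0}) (f s * x) * v (f s * x) \<partial>\<kappa> s) +
        (\<integral>\<^sup>+x. indicator (-{0}) (f s * x) * u (f s * x) \<partial>\<kappa> s) \<partial>L)"
      using add m1 by (intro nn_integral_cong) (simp add: nn_integral_add[symmetric] distrib_left)
    then show ?case using add m2 by (simp add: nn_integral_add)
  next
    case (seq U)
    have inc: "incseq (\<lambda>i x. indicator (-{0}) (f s * x) * U i (f s * x))" for s
      using seq(3) by (auto simp: incseq_def le_fun_def intro!: mult_left_mono)
    have "?I (SUP i. U i) = (\<integral>\<^sup>+s. (\<integral>\<^sup>+x. (SUP i. indicator (-{0}) (f s * x) * U i (f s * x)) \<partial>\<kappa> s) \<partial>L)"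
      by (simp add: SUP_mult_left_ennreal image_comp)
    also have "\<dots> = (\<integral>\<^sup>+s. (SUP i. \<integral>\<^sup>+x. indicator (-{0}) (f s * x) * U i (f s * x) \<partial>\<kappa> s) \<partial>L)"
      using seq(1) by (intro nn_integral_cong nn_integral_monotone_convergence_SUP inc m1) auto
    also have "\<dots> = (SUP i. ?I (U i))"
      using seq(1) inc by (intro nn_integral_monotone_convergence_SUP m2)
        (auto simp: incseq_def le_fun_def intro!: nn_integral_mono)
    also have "\<dots> = (SUP i. \<integral>\<^sup>+y. U i y \<partial>N\<^sub>f)" using seq by simp
    also have "\<dots> = (\<integral>\<^sup>+y. (SUP i. U i) y \<partial>N\<^sub>f)"
      using seq(1,3) unfolding SUP_apply
      by (intro nn_integral_monotone_convergence_SUP[symmetric]) auto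
    finally show ?case by simp
  qed
  also have "?I h = (\<integral>\<^sup>+s. (\<integral>\<^sup>+x. h (f s * x) \<partial>\<kappa> s) \<partial>L)"
    using assms(2) by (intro nn_integral_cong) (auto simp: indicator_def)
  finally show ?thesis .
qed

lemma levy_measure_F_tilde_f:
  assumes "(\<integral>\<^sup>+s. (\<integral>\<^sup>+x. ennreal (levy_weight (f s * x)) \<partial>\<kappa> s) \<partial>L) < \<infinity>"
  shows "levy_measure N\<^sub>f"
proof -
  have "(\<integral>\<^sup>+y. ennreal (levy_weight y) \<partial>N\<^sub>f) < \<infinity>"
    using assms by (subst nn_integral_F_tilde_f) simp_all
  then show ?thesis
    by (simp add: levy_measure_def levy_weight_def sets_F_tilde_f emeasure_F_tilde_f_zero)
qed

end

lemma kernel_integrable: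
  fixes g :: "real \<Rightarrow> 'b::{banach, second_countable_topology}"
  assumes s: "s \<in> space L" and g: "g \<in> borel_measurable borel" "\<And>x. norm (g x) \<le> C * levy_weight x"
  shows "integrable (\<kappa> s) (\<lambda>x. g (c * x))"
proof (rule levy_measure_integrable[OF kernel_levy[OF s]])
  show "(\<lambda>x. g (c * x)) \<in> borel_measurable borel" using g(1) by measurable
  have "0 \<le> C" using order_trans[OF norm_ge_zero g(2)[of 1]] by (simp add: levy_weight_def)
  then show "norm (g (c * x)) \<le> (C * (1 + c\<^sup>2)) * levy_weight x" for x
    using mult_left_mono[OF levy_weight_mult_le[of c x], of C] order_trans[OF g(2)[of "c * x"]]
    by (simp add: mult.assoc)
qed

text \<open>
  Fubini for the mixture \<open>F_tilde_f\<close>: it holds for nonnegative integrands by \<open>nn_integral_F_tilde_f\<close>,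
  and the bound by a multiple of \<open>1 \<and> x\<^sup>2\<close> makes all positive and negative parts integrable.
\<close>

lemma integral_F_tilde_f:
  fixes f :: "'s \<Rightarrow> real" and g :: "real \<Rightarrow> complex"
  assumes f [measurable]: "f \<in> borel_measurable L"
    and fin: "(\<integral>\<^sup>+s. (\<integral>\<^sup>+x. ennreal (levy_weight (f s * x)) \<partial>\<kappa> s) \<partial>L) < \<infinity>"
    and g [measurable]: "g \<in> borel_measurable borel" and gC: "\<And>x. norm (g x) \<le> C * levy_weight x"
  shows "integrable L (\<lambda>s. \<integral>x. g (f s * x) \<partial>\<kappa> s)"
    and "(\<integral>y. g y \<partial>F_tilde_f L \<kappa> f) = (\<integral>s. (\<integral>x. g (f s * x) \<partial>\<kappa> s) \<partial>L)"
proof -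
  let ?N = "F_tilde_f L \<kappa> f"
  note N = levy_measure_F_tilde_f[OF f fin]
  have pos: "integrable L (\<lambda>s. \<integral>x. h (f s * x) \<partial>\<kappa> s)"
      "(\<integral>y. h y \<partial>?N) = (\<integral>s. (\<integral>x. h (f s * x) \<partial>\<kappa> s) \<partial>L)"
    if h[measurable]: "h \<in> borel_measurable borel" and h0: "\<And>x. 0 \<le> h x" and hC: "\<And>x. h x \<le> C * levy_weight x" for h :: "real \<Rightarrow> real"
  proof -
    have hn: "norm (h x) \<le> C * levy_weight x" for x using h0 hC by simp
    have inner: "(\<integral>\<^sup>+x. ennreal (h (f s * x)) \<partial>\<kappa> s) = ennreal (\<integral>x. h (f s * x) \<partial>\<kappa> s)" if "s \<in> space L" for s
      using kernel_integrable[OF that h hn] h0 by (intro nn_integral_eq_integral) auto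
    have "(\<integral>\<^sup>+y. ennreal (h y) \<partial>?N) = ennreal (\<integral>y. h y \<partial>?N)"
      using levy_measure_integrable[OF N h hn] h0 by (intro nn_integral_eq_integral) auto
    moreover have "h 0 = 0" using h0[of 0] hC[of 0] by simp
    ultimately have eq: "(\<integral>\<^sup>+s. ennreal (\<integral>x. h (f s * x) \<partial>\<kappa> s) \<partial>L) = ennreal (\<integral>y. h y \<partial>?N)"
      using nn_integral_F_tilde_f[OF f, of "\<lambda>y. ennreal (h y)"] by (simp add: inner cong: nn_integral_cong)
    have "(\<lambda>s. enn2real (\<integral>\<^sup>+x. ennreal (h (f s * x)) \<partial>\<kappa> s)) \<in> borel_measurable L"
      by (intro borel_measurable_enn2real kernel_nn_integral_measurable2) measurable
    moreover have "enn2real (\<integral>\<^sup>+x. ennreal (h (f s * x)) \<partial>\<kappa> s) = (\<integral>x. h (f s * x) \<partial>\<kappa> s)" if "s \<in> space L" for s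
      by (simp add: inner[OF that] h0 Bochner_Integration.integral_nonneg)
    ultimately have m: "(\<lambda>s. \<integral>x. h (f s * x) \<partial>\<kappa> s) \<in> borel_measurable L"
      by (subst measurable_cong[of _ _ "\<lambda>s. enn2real (\<integral>\<^sup>+x. ennreal (h (f s * x)) \<partial>\<kappa> s)"]) auto
    show "integrable L (\<lambda>s. \<integral>x. h (f s * x) \<partial>\<kappa> s)"
      using m eq h0 by (intro integrableI_nonneg) (auto intro: Bochner_Integration.integral_nonneg)
    then show "(\<integral>y. h y \<partial>?N) = (\<integral>s. (\<integral>x. h (f s * x) \<partial>\<kappa> s) \<partial>L)"
      using eq h0 nn_integral_eq_integral[of L "\<lambda>s. \<integral>x. h (f s * x) \<partial>\<kappa> s"]
      by (simp add: Bochner_Integration.integral_nonneg)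
  qed
  have real: "integrable L (\<lambda>s. \<integral>x. h (f s * x) \<partial>\<kappa> s)"
      "(\<integral>y. h y \<partial>?N) = (\<integral>s. (\<integral>x. h (f s * x) \<partial>\<kappa> s) \<partial>L)"
    if h[measurable]: "h \<in> borel_measurable borel" and hC: "\<And>x. \<bar>h x\<bar> \<le> C * levy_weight x" for h :: "real \<Rightarrow> real"
  proof -
    let ?p = "\<lambda>x. max (h x) 0" and ?n = "\<lambda>x. max (- h x) 0"
    have m: "?p \<in> borel_measurable borel" "?n \<in> borel_measurable borel" by measurable
    have b: "?p x \<le> C * levy_weight x" "?n x \<le> C * levy_weight x" "0 \<le> ?p x" "0 \<le> ?n x" for x
      using hC[of x] by auto
    have bn: "norm (?p x) \<le> C * levy_weight x" "norm (?n x) \<le> C * levy_weight x" for x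
      using b[of x] by auto
    have h: "h = (\<lambda>x. ?p x - ?n x)" by (auto simp: fun_eq_iff max_def)
    have split: "(\<integral>x. h (f s * x) \<partial>\<kappa> s) = (\<integral>x. ?p (f s * x) \<partial>\<kappa> s) - (\<integral>x. ?n (f s * x) \<partial>\<kappa> s)" if "s \<in> space L" for s
      using kernel_integrable[OF that m(1) bn(1)] kernel_integrable[OF that m(2) bn(2)]
      by (subst h, subst Bochner_Integration.integral_diff[symmetric]) auto
    note P = pos[OF m(1) b(3) b(1)] and Q = pos[OF m(2) b(4) b(2)]
    have "integrable L (\<lambda>s. (\<integral>x. ?p (f s * x) \<partial>\<kappa> s) - (\<integral>x. ?n (f s * x) \<partial>\<kappa> s))"
      using P(1) Q(1) by (rule Bochner_Integration.integrable_diff)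
    then show "integrable L (\<lambda>s. \<integral>x. h (f s * x) \<partial>\<kappa> s)"
      using split by (subst Bochner_Integration.integrable_cong[OF refl]) auto
    have "(\<integral>y. h y \<partial>?N) = (\<integral>y. ?p y \<partial>?N) - (\<integral>y. ?n y \<partial>?N)"
      using levy_measure_integrable[OF N m(1) bn(1)] levy_measure_integrable[OF N m(2) bn(2)]
      by (subst h, subst Bochner_Integration.integral_diff[symmetric]) auto
    also have "\<dots> = (\<integral>s. (\<integral>x. ?p (f s * x) \<partial>\<kappa> s) - (\<integral>x. ?n (f s * x) \<partial>\<kappa> s) \<partial>L)"
      using P Q by simp
    also have "\<dots> = (\<integral>s. (\<integral>x. h (f s * x) \<partial>\<kappa> s) \<partial>L)"
      using split by (intro Bochner_Integration.integral_cong) auto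
    finally show "(\<integral>y. h y \<partial>?N) = (\<integral>s. (\<integral>x. h (f s * x) \<partial>\<kappa> s) \<partial>L)" .
  qed
  have "\<bar>Re (g x)\<bar> \<le> C * levy_weight x" "\<bar>Im (g x)\<bar> \<le> C * levy_weight x" for x
    using abs_Re_le_cmod[of "g x"] abs_Im_le_cmod[of "g x"] gC[of x] by linarith+
  then have RI: "integrable L (\<lambda>s. \<integral>x. Re (g (f s * x)) \<partial>\<kappa> s)" "integrable L (\<lambda>s. \<integral>x. Im (g (f s * x)) \<partial>\<kappa> s)"
    "(\<integral>y. Re (g y) \<partial>?N) = (\<integral>s. (\<integral>x. Re (g (f s * x)) \<partial>\<kappa> s) \<partial>L)"
    "(\<integral>y. Im (g y) \<partial>?N) = (\<integral>s. (\<integral>x. Im (g (f s * x)) \<partial>\<kappa> s) \<partial>L)"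
    using real[of "\<lambda>x. Re (g x)"] real[of "\<lambda>x. Im (g x)"] by auto
  have c: "(\<integral>x. g (f s * x) \<partial>\<kappa> s) = Complex (\<integral>x. Re (g (f s * x)) \<partial>\<kappa> s) (\<integral>x. Im (g (f s * x)) \<partial>\<kappa> s)" if "s \<in> space L" for s
    using kernel_integrable[OF that g gC] by (simp add: complex_eq_iff)
  have "integrable L (\<lambda>s. Complex (\<integral>x. Re (g (f s * x)) \<partial>\<kappa> s) (\<integral>x. Im (g (f s * x)) \<partial>\<kappa> s))"
    unfolding Complex_eq using RI(1,2) by (intro Bochner_Integration.integrable_add integrable_mult_right integrable_of_real)
  then show int: "integrable L (\<lambda>s. \<integral>x. g (f s * x) \<partial>\<kappa> s)"
    using c by (subst Bochner_Integration.integrable_cong[OF refl]) auto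
  have "(\<integral>s. Re (\<integral>x. g (f s * x) \<partial>\<kappa> s) \<partial>L) = (\<integral>s. (\<integral>x. Re (g (f s * x)) \<partial>\<kappa> s) \<partial>L)"
    "(\<integral>s. Im (\<integral>x. g (f s * x) \<partial>\<kappa> s) \<partial>L) = (\<integral>s. (\<integral>x. Im (g (f s * x)) \<partial>\<kappa> s) \<partial>L)"
    using c by (auto intro!: Bochner_Integration.integral_cong)
  then show "(\<integral>y. g y \<partial>?N) = (\<integral>s. (\<integral>x. g (f s * x) \<partial>\<kappa> s) \<partial>L)"
    using int levy_measure_integrable[OF N g gC] RI(3,4) by (simp add: complex_eq_iff)
qed

end

section \<open>The cumulant density of the random measure\<close>

lemma trunc_measurable [measurable]: "trunc \<in> borel_measurable borel"
  unfolding trunc_def[abs_def] by measurable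

lemma trunc_abs_le: "\<bar>trunc x\<bar> \<le> 1"
  by (simp add: trunc_def)

lemma trunc_zero [simp]: "trunc 0 = 0"
  by (simp add: trunc_def)

lemma levy_weight_eq: "\<bar>y\<bar> \<le> 1 \<Longrightarrow> levy_weight y = y\<^sup>2" "1 \<le> \<bar>y\<bar> \<Longrightarrow> levy_weight y = 1"
  using abs_square_le_1[of y] one_le_power[of "\<bar>y\<bar>" 2] by (simp_all add: levy_weight_def)

text \<open>
  The left-hand side vanishes if \<open>\<bar>y\<bar> \<le> 1\<close> and \<open>\<bar>ry\<bar> \<le> 1\<close>.  Otherwise it is at most \<open>1 + \<bar>r\<bar>\<close>, while
  \<open>1 \<and> y\<^sup>2\<close> is not smaller than \<open>1/(1 + r\<^sup>2)\<close>.
\<close>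

lemma trunc_mult_diff_le: "\<bar>trunc (r * y) - r * trunc y\<bar> \<le> ((1 + \<bar>r\<bar>) * (1 + r\<^sup>2)) * levy_weight y"
proof (cases "\<bar>y\<bar> \<le> 1 \<and> \<bar>r * y\<bar> \<le> 1")
  case True
  then show ?thesis by (simp add: trunc_def)
next
  case False
  have w: "1 \<le> (1 + r\<^sup>2) * levy_weight y"
  proof (cases "\<bar>y\<bar> \<le> 1")
    case True
    then have "1 \<le> \<bar>r * y\<bar>" "levy_weight y = y\<^sup>2" using False
      by (auto simp: levy_weight_eq)
    moreover have "1 \<le> \<bar>r * y\<bar>\<^sup>2" using \<open>1 \<le> \<bar>r * y\<bar>\<close> by (rule one_le_power)
    ultimately show ?thesis by (simp add: power_mult_distrib distrib_right add_increasing)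
  next
    case False
    then show ?thesis by (simp add: levy_weight_eq)
  qed
  have "\<bar>trunc (r * y) - r * trunc y\<bar> \<le> \<bar>trunc (r * y)\<bar> + \<bar>r * trunc y\<bar>" by (rule abs_triangle_ineq4)
  also have "\<dots> \<le> 1 + \<bar>r\<bar> * 1"
    unfolding abs_mult by (intro add_mono mult_left_mono trunc_abs_le) auto
  also have "\<dots> \<le> (1 + \<bar>r\<bar>) * ((1 + r\<^sup>2) * levy_weight y)"
    using mult_left_mono[OF w, of "1 + \<bar>r\<bar>"] by simp
  finally show ?thesis by (simp add: mult.assoc)
qed

definition levy_integrand :: "real \<Rightarrow> real \<Rightarrow> complex" where
  "levy_integrand \<theta> x = iexp (\<theta> * x) - 1 - \<i> * \<theta> * trunc x"

lemma levy_integrand_measurable [measurable]: "levy_integrand \<theta> \<in> borel_measurable borel"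
  unfolding levy_integrand_def[abs_def] by measurable

lemma levy_integrand_one_le: "cmod (levy_integrand 1 y) \<le> 3 * levy_weight y"
proof (cases "\<bar>y\<bar> \<le> 1")
  case True
  have "levy_integrand 1 y = iexp y - (\<Sum>k\<le>1. (\<i> * y) ^ k / fact k)"
    using True by (simp add: levy_integrand_def trunc_def)
  also have "cmod \<dots> \<le> \<bar>y\<bar> ^ 2 / 2"
    using iexp_approx1[of y 1] by (simp add: numeral_2_eq_2)
  also have "\<dots> \<le> 3 * levy_weight y"
    using True by (simp add: levy_weight_eq)
  finally show ?thesis .
next
  case False
  have "cmod (levy_integrand 1 y) \<le> cmod (iexp y) + 1 + \<bar>trunc y\<bar>"
    unfolding levy_integrand_def
    using norm_triangle_ineq4[of "iexp y - 1" "\<i> * trunc y"] norm_triangle_ineq4[of "iexp y" 1]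
    by (simp add: norm_mult)
  also have "\<dots> \<le> 3" using trunc_abs_le[of y] by simp
  also have "3 = 3 * levy_weight y"
    using False by (simp add: levy_weight_eq)
  finally show ?thesis .
qed

lemma levy_integrand_one_mult_le: "cmod (levy_integrand 1 (u * x)) \<le> (3 * (1 + u\<^sup>2)) * levy_weight x"
  using levy_integrand_one_le[of "u * x"] levy_weight_mult_le[of u x] by (simp only: mult.assoc)

lemma levy_integrand_le: "cmod (levy_integrand \<theta> x) \<le> (3 + (1 + \<bar>\<theta>\<bar>)) * (1 + \<theta>\<^sup>2) * levy_weight x"
proof -
  have "levy_integrand \<theta> x = levy_integrand 1 (\<theta> * x) + \<i> * (trunc (\<theta> * x) - \<theta> * trunc x)"
    by (simp add: levy_integrand_def algebra_simps)
  then have "cmod (levy_integrand \<theta> x) \<le> cmod (levy_integrand 1 (\<theta> * x)) + \<bar>trunc (\<theta> * x) - \<theta> * trunc x\<bar>"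
    using norm_triangle_ineq[of "levy_integrand 1 (\<theta> * x)" "\<i> * (trunc (\<theta> * x) - \<theta> * trunc x)"]
    by (simp add: norm_mult flip: of_real_mult of_real_diff)
  also have "\<dots> \<le> 3 * ((1 + \<theta>\<^sup>2) * levy_weight x) + ((1 + \<bar>\<theta>\<bar>) * (1 + \<theta>\<^sup>2)) * levy_weight x"
    using levy_integrand_one_le[of "\<theta> * x"] levy_weight_mult_le[of \<theta> x] trunc_mult_diff_le[of \<theta> x] by simp
  finally show ?thesis by (simp add: algebra_simps)
qed

lemma levy_integrand_zero [simp]: "levy_integrand 0 x = 0" "levy_integrand \<theta> 0 = 0"
  by (simp_all add: levy_integrand_def)

lemma (in levy_kernel) kernel_integral_measurable2:
  fixes g :: "'s \<Rightarrow> real \<Rightarrow> real"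
  assumes g [measurable]: "(\<lambda>(s, x). g s x) \<in> borel_measurable (L \<Otimes>\<^sub>M borel)"
    and int: "\<And>s. s \<in> space L \<Longrightarrow> integrable (\<kappa> s) (g s)"
  shows "(\<lambda>s. \<integral>x. g s x \<partial>\<kappa> s) \<in> borel_measurable L"
proof -
  have "(\<lambda>s. enn2real (\<integral>\<^sup>+x. ennreal (g s x) \<partial>\<kappa> s) - enn2real (\<integral>\<^sup>+x. ennreal (- g s x) \<partial>\<kappa> s)) \<in> borel_measurable L"
    by (intro borel_measurable_diff borel_measurable_enn2real kernel_nn_integral_measurable2) measurable
  then show ?thesis
    by (subst measurable_cong[OF real_lebesgue_integral_def[OF int]])
qed

context qid_setting
begin

lemma space_lam: "space lam = space M"
  using sets_eq_imp_space_eq[OF sets_lam] .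

lemma measurable_lam_iff: "borel_measurable lam = borel_measurable M"
  by (rule measurable_cong_sets[OF sets_lam refl])

lemma finite_lam: "finite_measure lam"
proof
  interpret \<nu>1: finite_measure \<nu>1 by (rule finite_\<nu>1)
  have "emeasure \<nu>1 (space M) < \<infinity>"
    using \<nu>1.emeasure_finite by (simp add: less_top[symmetric])
  then show "emeasure lam (space lam) \<noteq> \<infinity>"
    unfolding space_lam using finite_var by (subst emeasure_lam) (auto simp: less_top)
qed

sublocale pos: levy_kernel lam "\<lambda>s. ql_pos (\<rho> s)"
proof (intro levy_kernel.intro finite_lam levy_kernel_axioms.intro)
  fix s assume "s \<in> space lam"
  then have s: "s \<in> space M" by (simp add: space_lam)
  show "levy_measure (ql_pos (\<rho> s))" by (rule quasi_levy_typeD[OF \<rho>_quasi_levy_type[OF s]])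
  have "(\<integral>\<^sup>+x. ennreal (levy_weight x) \<partial>ql_pos (\<rho> s)) \<le> (\<integral>\<^sup>+x. ennreal (levy_weight x) \<partial>ql_abs (\<rho> s))"
    by (subst quasi_levy_typeD(3)[OF \<rho>_quasi_levy_type[OF s]]) auto
  then show "(\<integral>\<^sup>+x. ennreal (levy_weight x) \<partial>ql_pos (\<rho> s)) \<le> 2"
    using \<rho>_bound[OF s] by (auto simp: levy_weight_def)
qed (use \<rho>_pos_measurable in \<open>simp add: measurable_lam_iff\<close>)

sublocale neg: levy_kernel lam "\<lambda>s. ql_neg (\<rho> s)"
proof (intro levy_kernel.intro finite_lam levy_kernel_axioms.intro)
  fix s assume "s \<in> space lam"
  then have s: "s \<in> space M" by (simp add: space_lam)
  show "levy_measure (ql_neg (\<rho> s))" by (rule quasi_levy_typeD[OF \<rho>_quasi_levy_type[OF s]])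
  have "(\<integral>\<^sup>+x. ennreal (levy_weight x) \<partial>ql_neg (\<rho> s)) \<le> (\<integral>\<^sup>+x. ennreal (levy_weight x) \<partial>ql_abs (\<rho> s))"
    by (subst quasi_levy_typeD(3)[OF \<rho>_quasi_levy_type[OF s]]) auto
  then show "(\<integral>\<^sup>+x. ennreal (levy_weight x) \<partial>ql_neg (\<rho> s)) \<le> 2"
    using \<rho>_bound[OF s] by (auto simp: levy_weight_def)
qed (use \<rho>_neg_measurable in \<open>simp add: measurable_lam_iff\<close>)

lemma jump_V0_eq:
  assumes s: "s \<in> space lam"
  shows "jump_V0 \<rho> u s = (\<integral>\<^sup>+x. ennreal (levy_weight (u * x)) \<partial>ql_pos (\<rho> s)) +
    (\<integral>\<^sup>+x. ennreal (levy_weight (u * x)) \<partial>ql_neg (\<rho> s))"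
proof -
  have "s \<in> space M" using s by (simp add: space_lam)
  note Q = quasi_levy_typeD(3)[OF \<rho>_quasi_levy_type[OF this], of "\<lambda>x. ennreal (levy_weight (u * x))"]
  show ?thesis unfolding jump_V0_def by (subst Q[symmetric]) (simp_all add: levy_weight_def mult.commute)
qed

text \<open>
  The real value of \<^const>\<open>jump_V0\<close>, finite by the bound on \<open>\<rho>\<close>; see \<open>jump_V0_eq_V\<close>.
\<close>

definition V :: "real \<Rightarrow> 's \<Rightarrow> real" where
  "V u s = (\<integral>x. levy_weight (u * x) \<partial>ql_pos (\<rho> s)) + (\<integral>x. levy_weight (u * x) \<partial>ql_neg (\<rho> s))"

lemma levy_weight_kernel_integrable:
  assumes s: "s \<in> space lam"
  shows "integrable (ql_pos (\<rho> s)) (\<lambda>x. levy_weight (u * x))" "integrable (ql_neg (\<rho> s)) (\<lambda>x. levy_weight (u * x))"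
  using pos.kernel_integrable[OF s, of levy_weight 1 u] neg.kernel_integrable[OF s, of levy_weight 1 u] by auto

lemma V_nonneg [simp]: "0 \<le> V u s"
  unfolding V_def by (intro add_nonneg_nonneg Bochner_Integration.integral_nonneg) auto

lemma jump_V0_eq_V: "s \<in> space lam \<Longrightarrow> jump_V0 \<rho> u s = ennreal (V u s)"
  using levy_weight_kernel_integrable[of s u]
  by (simp add: jump_V0_eq V_def nn_integral_eq_integral Bochner_Integration.integral_nonneg)

lemma V_le: 
  assumes s: "s \<in> space lam" and uv: "\<bar>v\<bar> \<le> c * \<bar>u\<bar>" "0 \<le> c"
  shows "V v s \<le> (1 + c\<^sup>2) * V u s"
proof -
  have le: "levy_weight (v * x) \<le> (1 + c\<^sup>2) * levy_weight (u * x)" for x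
  proof (cases "u = 0")
    case True
    then show ?thesis using uv by simp
  next
    case False
    then have "levy_weight (v * x) \<le> (1 + (v / u)\<^sup>2) * levy_weight (u * x)"
      using levy_weight_mult_le[of "v / u" "u * x"] by simp
    also have "\<dots> \<le> (1 + c\<^sup>2) * levy_weight (u * x)"
    proof (intro mult_right_mono add_left_mono)
      have "\<bar>v / u\<bar> \<le> c" using uv False by (simp add: abs_divide divide_le_eq)
      then have "\<bar>v / u\<bar>\<^sup>2 \<le> c\<^sup>2" by (intro power_mono) auto
      then show "(v / u)\<^sup>2 \<le> c\<^sup>2" by (simp only: power2_abs)
    qed simp
    finally show ?thesis .
  qed
  have "(\<integral>x. levy_weight (v * x) \<partial>\<kappa>) \<le> (1 + c\<^sup>2) * (\<integral>x. levy_weight (u * x) \<partial>\<kappa>)"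
    if "\<And>u. integrable \<kappa> (\<lambda>x. levy_weight (u * x))" for \<kappa> :: "real measure"
    unfolding integral_mult_right_zero[symmetric] using that le by (intro integral_mono) auto
  from this[of "ql_pos (\<rho> s)"] this[of "ql_neg (\<rho> s)"] show ?thesis
    unfolding V_def using levy_weight_kernel_integrable[OF s] by (simp add: distrib_left)
qed

lemma kernel_integrable_ql:
  fixes g :: "real \<Rightarrow> 'b::{banach, second_countable_topology}"
  assumes "s \<in> space lam" "g \<in> borel_measurable borel" "\<And>x. norm (g x) \<le> C * levy_weight x"
  shows "integrable (ql_pos (\<rho> s)) g" "integrable (ql_neg (\<rho> s)) g"
  using pos.kernel_integrable[OF assms, of 1] neg.kernel_integrable[OF assms, of 1] by auto

lemma norm_ql_integral_le:
  fixes g :: "real \<Rightarrow> 'b::{banach, second_countable_topology}"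
  assumes s: "s \<in> space lam" and g: "g \<in> borel_measurable borel" and le: "\<And>x. norm (g x) \<le> C * levy_weight (u * x)"
  shows "norm (ql_integral (\<rho> s) g) \<le> C * V u s"
proof -
  have "norm (\<integral>x. g x \<partial>\<kappa>) \<le> C * (\<integral>x. levy_weight (u * x) \<partial>\<kappa>)"
    if "integrable \<kappa> (\<lambda>x. levy_weight (u * x))" "sets \<kappa> = sets borel" for \<kappa> :: "real measure"
  proof -
    have gm: "g \<in> borel_measurable \<kappa>" using g by (simp add: measurable_cong_sets[OF that(2) refl])
    have i: "integrable \<kappa> (\<lambda>x. C * levy_weight (u * x))" using that(1) by simp
    have "integrable \<kappa> g"
      by (rule Bochner_Integration.integrable_bound[OF i gm]) (use le in \<open>auto intro: order_trans[OF _ abs_ge_self]\<close>)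
    then have "norm (\<integral>x. g x \<partial>\<kappa>) \<le> (\<integral>x. C * levy_weight (u * x) \<partial>\<kappa>)"
      using le i by (intro Bochner_Integration.integral_norm_bound_integral) auto
    then show ?thesis by simp
  qed
  from this[of "ql_pos (\<rho> s)"] this[of "ql_neg (\<rho> s)"] show ?thesis
    unfolding V_def ql_integral_def using levy_weight_kernel_integrable[OF s, of u] pos.kernel_sets[OF s] neg.kernel_sets[OF s]
      norm_triangle_ineq4[of "\<integral>x. g x \<partial>ql_pos (\<rho> s)" "\<integral>x. g x \<partial>ql_neg (\<rho> s)"] by (simp add: distrib_left)
qed

abbreviation U :: "real \<Rightarrow> 's \<Rightarrow> real" where "U \<equiv> drift_U a \<rho>"

text \<open>
  The cumulant density.  The form chosen for the definition, centred at \<open>\<tau>(ux)\<close> instead of \<open>u \<tau>(x)\<close>,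
  is the one that can be bounded by conditions (i)-(iii); the classical form is \<open>K_eq\<close>.
\<close>

definition K :: "real \<Rightarrow> 's \<Rightarrow> complex" where
  "K u s = \<i> * U u s - u\<^sup>2 / 2 * sig2 s + ql_integral (\<rho> s) (\<lambda>x. levy_integrand 1 (u * x))"

lemma ql_integral_add:
  fixes g h :: "real \<Rightarrow> 'b::{banach, second_countable_topology}"
  assumes "s \<in> space lam" "g \<in> borel_measurable borel" "\<And>x. norm (g x) \<le> C * levy_weight x"
    "h \<in> borel_measurable borel" "\<And>x. norm (h x) \<le> D * levy_weight x"
  shows "ql_integral (\<rho> s) (\<lambda>x. g x + h x) = ql_integral (\<rho> s) g + ql_integral (\<rho> s) h"
  using kernel_integrable_ql[OF assms(1,2,3)] kernel_integrable_ql[OF assms(1,4,5)]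
  by (simp add: ql_integral_def)

lemma ql_integral_cmult:
  fixes g :: "real \<Rightarrow> 'b::{banach, real_normed_field, second_countable_topology}"
  shows "ql_integral \<nu> (\<lambda>x. c * g x) = c * ql_integral \<nu> g"
  by (simp add: ql_integral_def right_diff_distrib)

lemma ql_integral_of_real: "ql_integral \<nu> (\<lambda>x. complex_of_real (g x)) = ql_integral \<nu> g"
  by (simp add: ql_integral_def)

lemma drift_integrand_le: "\<bar>trunc (x * u) - u * trunc x\<bar> \<le> ((1 + \<bar>u\<bar>) * (1 + u\<^sup>2)) * levy_weight x"
  using trunc_mult_diff_le[of u x] by (simp add: mult.commute)

lemma U_mult:
  assumes s: "s \<in> space lam"
  shows "U (r * u) s = r * U u s + ql_integral (\<rho> s) (\<lambda>x. trunc (r * (u * x)) - r * trunc (u * x))"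
proof -
  have m: "(\<lambda>x. r * (trunc (x * u) - u * trunc x)) \<in> borel_measurable borel"
    "(\<lambda>x. trunc (r * (u * x)) - r * trunc (u * x)) \<in> borel_measurable borel"
    by measurable
  have b: "norm (trunc (r * (u * x)) - r * trunc (u * x)) \<le> (((1 + \<bar>r\<bar>) * (1 + r\<^sup>2)) * (1 + u\<^sup>2)) * levy_weight x" for x
    using order_trans[OF trunc_mult_diff_le[of r "u * x"] mult_left_mono[OF levy_weight_mult_le[of u x], of "(1 + \<bar>r\<bar>) * (1 + r\<^sup>2)"]]
    by (simp add: mult.assoc)
  have b1: "norm (r * (trunc (x * u) - u * trunc x)) \<le> (\<bar>r\<bar> * ((1 + \<bar>u\<bar>) * (1 + u\<^sup>2))) * levy_weight x" for x
    using mult_left_mono[OF drift_integrand_le[of x u], of "\<bar>r\<bar>"] by (simp only: real_norm_def abs_mult mult.assoc abs_ge_zero)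
  have "ql_integral (\<rho> s) (\<lambda>x. trunc (x * (r * u)) - (r * u) * trunc x) =
     ql_integral (\<rho> s) (\<lambda>x. r * (trunc (x * u) - u * trunc x) + (trunc (r * (u * x)) - r * trunc (u * x)))"
    by (simp add: algebra_simps)
  also have "\<dots> = r * ql_integral (\<rho> s) (\<lambda>x. trunc (x * u) - u * trunc x) +
      ql_integral (\<rho> s) (\<lambda>x. trunc (r * (u * x)) - r * trunc (u * x))"
    by (subst ql_integral_add[OF s m(1) b1 m(2) b]) (simp add: ql_integral_cmult)
  finally show ?thesis by (simp add: drift_U_def distrib_left)
qed

text \<open>
  The difference between \<open>i U(\<theta>u,s)\<close> and \<open>i \<theta> U(u,s)\<close> is exactly what changes the centring of the jump
  integral from \<open>\<tau>(\<theta>ux)\<close> to \<open>\<theta> \<tau>(ux)\<close>.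
\<close>

lemma K_mult:
  assumes s: "s \<in> space lam"
  shows "K (\<theta> * u) s = \<i> * \<theta> * U u s - (\<theta> * u)\<^sup>2 / 2 * sig2 s + ql_integral (\<rho> s) (\<lambda>x. levy_integrand \<theta> (u * x))"
proof -
  define h where "h x = trunc (\<theta> * (u * x)) - \<theta> * trunc (u * x)" for x
  have m: "(\<lambda>x. levy_integrand 1 (\<theta> * u * x)) \<in> borel_measurable borel" "(\<lambda>x. \<i> * complex_of_real (h x)) \<in> borel_measurable borel"
    unfolding h_def by measurable
  have b: "norm (levy_integrand 1 (\<theta> * u * x)) \<le> (3 * (1 + (\<theta> * u)\<^sup>2)) * levy_weight x" for x
    by (rule levy_integrand_one_mult_le)
  have b2: "norm (\<i> * complex_of_real (h x)) \<le> (((1 + \<bar>\<theta>\<bar>) * (1 + \<theta>\<^sup>2)) * (1 + u\<^sup>2)) * levy_weight x" for x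
    using order_trans[OF trunc_mult_diff_le[of \<theta> "u * x"] mult_left_mono[OF levy_weight_mult_le[of u x], of "(1 + \<bar>\<theta>\<bar>) * (1 + \<theta>\<^sup>2)"]]
    by (simp add: mult.assoc norm_mult h_def del: of_real_diff of_real_mult)
  have "ql_integral (\<rho> s) (\<lambda>x. levy_integrand \<theta> (u * x)) =
      ql_integral (\<rho> s) (\<lambda>x. levy_integrand 1 (\<theta> * u * x) + \<i> * complex_of_real (h x))"
    by (simp add: levy_integrand_def h_def algebra_simps)
  also have "\<dots> = ql_integral (\<rho> s) (\<lambda>x. levy_integrand 1 (\<theta> * u * x)) + \<i> * ql_integral (\<rho> s) h"
    by (subst ql_integral_add[OF s m(1) b m(2) b2]) (simp add: ql_integral_cmult ql_integral_of_real)
  finally show ?thesis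
    using U_mult[OF s, of \<theta> u] by (simp add: K_def h_def[abs_def] algebra_simps)
qed

lemma U_one: "U 1 s = a s"
  by (simp add: drift_U_def ql_integral_def)

lemma K_eq:
  assumes s: "s \<in> space lam"
  shows "K u s = \<i> * u * a s - u\<^sup>2 / 2 * sig2 s + ql_integral (\<rho> s) (levy_integrand u)"
  using K_mult[OF s, of u 1] by (simp add: U_one)

lemma K_zero [simp]: "K 0 s = 0"
  by (simp add: K_def drift_U_def ql_integral_def)

text \<open>
  The dominating function: its integral at \<open>u = f(s)\<close> is finite if and only if the integrals in
  conditions (i)-(iii) are.
\<close>

definition \<Phi> :: "real \<Rightarrow> 's \<Rightarrow> real" where
  "\<Phi> u s = \<bar>U u s\<bar> + u\<^sup>2 * \<bar>sig2 s\<bar> + V u s"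

definition dom_const :: "real \<Rightarrow> real" where
  "dom_const c = c + c\<^sup>2 + (1 + c) * (1 + c\<^sup>2) + 3 * (1 + c\<^sup>2)"

text \<open>
  Multiplying the argument by a bounded factor \<open>r\<close> changes \<open>U\<close> by \<open>r U\<close> plus a multiple of \<open>V\<close>, and the
  other two terms of \<open>K\<close> are bounded by multiples of \<open>u\<^sup>2 \<bar>\<sigma>\<^sup>2\<bar>\<close> and \<open>V\<close>.
\<close>

lemma norm_K_le:
  assumes s: "s \<in> space lam" and uv: "\<bar>v\<bar> \<le> c * \<bar>u\<bar>" "0 \<le> c"
  shows "cmod (K v s) \<le> dom_const c * \<Phi> u s"
proof -
  \<comment> \<open>If \<open>u = 0\<close> the hypothesis forces \<open>v = 0\<close>.\<close>
  define r where "r = (if u = 0 then 0 else v / u)"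
  have v: "v = r * u" and r: "\<bar>r\<bar> \<le> c"
    using uv by (auto simp: r_def abs_divide divide_le_eq)
  have r2: "r\<^sup>2 \<le> c\<^sup>2" using power_mono[OF r, of 2] by simp
  have "\<bar>ql_integral (\<rho> s) (\<lambda>x. trunc (r * (u * x)) - r * trunc (u * x))\<bar> \<le> ((1 + \<bar>r\<bar>) * (1 + r\<^sup>2)) * V u s"
    using norm_ql_integral_le[OF s, of "\<lambda>x. trunc (r * (u * x)) - r * trunc (u * x)" "(1 + \<bar>r\<bar>) * (1 + r\<^sup>2)" u]
      trunc_mult_diff_le[of r] by simp
  also have "\<dots> \<le> ((1 + c) * (1 + c\<^sup>2)) * V u s"
    using r r2 uv(2) by (intro mult_right_mono mult_mono) auto
  finally have 0: "\<bar>U v s\<bar> \<le> \<bar>r\<bar> * \<bar>U u s\<bar> + ((1 + c) * (1 + c\<^sup>2)) * V u s"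
    unfolding v U_mult[OF s]
    using abs_triangle_ineq[of "r * U u s" "ql_integral (\<rho> s) (\<lambda>x. trunc (r * (u * x)) - r * trunc (u * x))"]
    by (simp add: abs_mult)
  have "\<bar>r\<bar> * \<bar>U u s\<bar> \<le> c * \<bar>U u s\<bar>" using r by (intro mult_right_mono) auto
  with 0 have 1: "\<bar>U v s\<bar> \<le> c * \<bar>U u s\<bar> + ((1 + c) * (1 + c\<^sup>2)) * V u s" by linarith
  have "r\<^sup>2 * u\<^sup>2 \<le> c\<^sup>2 * u\<^sup>2" using r2 by (intro mult_right_mono) auto
  then have "v\<^sup>2 / 2 \<le> c\<^sup>2 * u\<^sup>2" unfolding v power_mult_distrib using zero_le_power2[of "r * u"]
    by (simp only: power_mult_distrib)
  then have "v\<^sup>2 / 2 * \<bar>sig2 s\<bar> \<le> (c\<^sup>2 * u\<^sup>2) * \<bar>sig2 s\<bar>" by (rule mult_right_mono) simp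
  then have 2: "cmod (v\<^sup>2 / 2 * sig2 s) \<le> c\<^sup>2 * (u\<^sup>2 * \<bar>sig2 s\<bar>)"
    by (simp add: norm_mult norm_divide norm_power mult.assoc)
  have "cmod (ql_integral (\<rho> s) (\<lambda>x. levy_integrand 1 (v * x))) \<le> 3 * V v s"
    by (rule norm_ql_integral_le[OF s]) (use levy_integrand_one_le in auto)
  also have "\<dots> \<le> 3 * ((1 + c\<^sup>2) * V u s)" using V_le[OF s uv] by simp
  finally have 3: "cmod (ql_integral (\<rho> s) (\<lambda>x. levy_integrand 1 (v * x))) \<le> (3 * (1 + c\<^sup>2)) * V u s" by (simp only: mult.assoc)
  have "cmod (K v s) \<le> \<bar>U v s\<bar> + cmod (v\<^sup>2 / 2 * sig2 s) + cmod (ql_integral (\<rho> s) (\<lambda>x. levy_integrand 1 (v * x)))"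
    unfolding K_def
    using norm_triangle_ineq[of "\<i> * U v s - v\<^sup>2 / 2 * sig2 s" "ql_integral (\<rho> s) (\<lambda>x. levy_integrand 1 (v * x))"]
      norm_triangle_ineq4[of "\<i> * U v s" "v\<^sup>2 / 2 * sig2 s"]
    by (simp add: norm_mult)
  also have "\<dots> \<le> c * \<bar>U u s\<bar> + c\<^sup>2 * (u\<^sup>2 * \<bar>sig2 s\<bar>) + ((1 + c) * (1 + c\<^sup>2) + 3 * (1 + c\<^sup>2)) * V u s"
    using 1 2 3 by (simp only: distrib_right[of "(1 + c) * (1 + c\<^sup>2)"])
  also have "\<dots> \<le> dom_const c * \<bar>U u s\<bar> + dom_const c * (u\<^sup>2 * \<bar>sig2 s\<bar>) + dom_const c * V u s"
    using uv(2) by (intro add_mono mult_right_mono) (auto simp: dom_const_def intro!: add_nonneg_nonneg mult_nonneg_nonneg)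
  finally show ?thesis by (simp add: \<Phi>_def distrib_left)
qed

lemma K_continuous:
  assumes s: "s \<in> space lam" and v: "v \<longlonglongrightarrow> u"
  shows "(\<lambda>n. K (v n) s) \<longlonglongrightarrow> K u s"
proof -
  obtain c where c: "\<And>n. \<bar>v n\<bar> \<le> c" "0 \<le> c"
    using convergent_imp_Bseq[of v] v by (auto simp: convergent_def Bseq_def intro: less_imp_le)
  define C where "C = (3 + (1 + c)) * (1 + c\<^sup>2)"
  have le: "cmod (levy_integrand (v n) x) \<le> C * levy_weight x" for n x
  proof -
    have "(v n)\<^sup>2 \<le> c\<^sup>2" using power_mono[OF c(1)[of n], of 2] by simp
    then have "(3 + (1 + \<bar>v n\<bar>)) * (1 + (v n)\<^sup>2) \<le> C"
      unfolding C_def using c by (intro mult_mono add_mono) auto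
    then have "(3 + (1 + \<bar>v n\<bar>)) * (1 + (v n)\<^sup>2) * levy_weight x \<le> C * levy_weight x"
      by (rule mult_right_mono) simp
    then show ?thesis using levy_integrand_le[of "v n" x] by linarith
  qed
  have lim: "(\<lambda>n. \<integral>x. levy_integrand (v n) x \<partial>\<kappa>) \<longlonglongrightarrow> (\<integral>x. levy_integrand u x \<partial>\<kappa>)"
    if L: "levy_measure \<kappa>" for \<kappa>
  proof (rule integral_dominated_convergence)
    note [measurable_cong] = levy_measureD(1)[OF L]
    show "levy_integrand u \<in> borel_measurable \<kappa>" "levy_integrand (v n) \<in> borel_measurable \<kappa>" for n
      by measurable
    show "integrable \<kappa> (\<lambda>x. C * levy_weight x)"
      using c(2) by (intro levy_measure_integrable[OF L, of _ C]) (auto simp: C_def)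
    show "AE x in \<kappa>. (\<lambda>n. levy_integrand (v n) x) \<longlonglongrightarrow> levy_integrand u x"
      unfolding levy_integrand_def by (intro AE_I2 tendsto_intros v)
    show "AE x in \<kappa>. cmod (levy_integrand (v n) x) \<le> C * levy_weight x" for n
      using le by simp
  qed
  show ?thesis
    unfolding K_eq[OF s] ql_integral_def
    by (intro tendsto_intros v lim pos.kernel_levy[OF s] neg.kernel_levy[OF s]) auto
qed

lemma a_measurable [measurable]: "a \<in> borel_measurable lam" and a_integrable: "integrable lam a"
  using deriv_a by (auto simp: signed_RN_deriv_def)

lemma sig2_measurable [measurable]: "sig2 \<in> borel_measurable lam" and sig2_integrable: "integrable lam sig2"
  using deriv_sig2 by (auto simp: signed_RN_deriv_def)

lemma ql_integral_measurable:
  fixes g :: "'s \<Rightarrow> real \<Rightarrow> real"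
  assumes "(\<lambda>(s, x). g s x) \<in> borel_measurable (lam \<Otimes>\<^sub>M borel)"
    and "\<And>s x. \<bar>g s x\<bar> \<le> C s * levy_weight x"
  shows "(\<lambda>s. ql_integral (\<rho> s) (g s)) \<in> borel_measurable lam"
proof -
  have m: "g s \<in> borel_measurable borel" if s: "s \<in> space lam" for s
    using measurable_compose[OF measurable_Pair1'[OF s] assms(1)] by simp
  have int: "integrable (ql_pos (\<rho> s)) (g s)" "integrable (ql_neg (\<rho> s)) (g s)" if s: "s \<in> space lam" for s
    using kernel_integrable_ql[OF s m[OF s], of "C s"] assms(2) by auto
  show ?thesis
    unfolding ql_integral_def
    by (intro borel_measurable_diff pos.kernel_integral_measurable2 neg.kernel_integral_measurable2 assms(1) int)
qed

lemma U_measurable: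
  assumes f [measurable]: "f \<in> borel_measurable lam"
  shows "(\<lambda>s. U (f s) s) \<in> borel_measurable lam"
  unfolding drift_U_def
  by (intro borel_measurable_add borel_measurable_times f a_measurable ql_integral_measurable[OF _ drift_integrand_le])
    measurable

lemma complex_ql_integral:
  assumes s: "s \<in> space lam"
    and g: "g \<in> borel_measurable borel" "\<And>x. cmod (g x) \<le> C * levy_weight x"
  shows "ql_integral (\<rho> s) g = ql_integral (\<rho> s) (\<lambda>x. Re (g x)) + \<i> * ql_integral (\<rho> s) (\<lambda>x. Im (g x))"
  using kernel_integrable_ql[OF s g] by (simp add: ql_integral_def complex_eq_iff)

lemma K_measurable:
  assumes f [measurable]: "f \<in> borel_measurable lam"
  shows "(\<lambda>s. K (f s) s) \<in> borel_measurable lam"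
proof -
  define G where "G s x = levy_integrand 1 (f s * x)" for s x
  have b: "cmod (G s x) \<le> (3 * (1 + (f s)\<^sup>2)) * levy_weight x" for s x
    unfolding G_def by (rule levy_integrand_one_mult_le)
  have ReIm: "\<bar>Re (G s x)\<bar> \<le> (3 * (1 + (f s)\<^sup>2)) * levy_weight x" "\<bar>Im (G s x)\<bar> \<le> (3 * (1 + (f s)\<^sup>2)) * levy_weight x" for s x
    using b[of s x] abs_Re_le_cmod[of "G s x"] abs_Im_le_cmod[of "G s x"] by linarith+
  have Gm: "(\<lambda>(s, x). Re (G s x)) \<in> borel_measurable (lam \<Otimes>\<^sub>M borel)" "(\<lambda>(s, x). Im (G s x)) \<in> borel_measurable (lam \<Otimes>\<^sub>M borel)"
    unfolding G_def by measurable
  have [measurable]: "(\<lambda>s. ql_integral (\<rho> s) (\<lambda>x. Re (G s x))) \<in> borel_measurable lam"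
    "(\<lambda>s. ql_integral (\<rho> s) (\<lambda>x. Im (G s x))) \<in> borel_measurable lam"
    using ql_integral_measurable[OF Gm(1) ReIm(1)] ql_integral_measurable[OF Gm(2) ReIm(2)] by auto
  note [measurable] = U_measurable[OF f]
  have "(\<lambda>s. \<i> * U (f s) s - (f s)\<^sup>2 / 2 * sig2 s +
      (ql_integral (\<rho> s) (\<lambda>x. Re (G s x)) + \<i> * ql_integral (\<rho> s) (\<lambda>x. Im (G s x)))) \<in> borel_measurable lam"
    by measurable
  moreover have "K (f s) s = \<i> * U (f s) s - (f s)\<^sup>2 / 2 * sig2 s +
      (ql_integral (\<rho> s) (\<lambda>x. Re (G s x)) + \<i> * ql_integral (\<rho> s) (\<lambda>x. Im (G s x)))" if "s \<in> space lam" for s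
  proof -
    have "G s \<in> borel_measurable borel" unfolding G_def by measurable
    from complex_ql_integral[OF that this b] show ?thesis by (simp add: K_def G_def)
  qed
  ultimately show ?thesis by (subst measurable_cong) auto
qed

lemma K_integrable:
  assumes \<Phi>: "integrable lam (\<lambda>s. \<Phi> (f s) s)" and g: "g \<in> borel_measurable lam"
    and le: "\<And>s. s \<in> space lam \<Longrightarrow> \<bar>g s\<bar> \<le> c * \<bar>f s\<bar>" and c: "0 \<le> c"
  shows "integrable lam (\<lambda>s. K (g s) s)"
proof (rule Bochner_Integration.integrable_bound)
  show "integrable lam (\<lambda>s. dom_const c * \<Phi> (f s) s)" using \<Phi> by simp
  show "AE s in lam. cmod (K (g s) s) \<le> norm (dom_const c * \<Phi> (f s) s)"
  proof (rule AE_I2)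
    fix s assume s: "s \<in> space lam"
    show "cmod (K (g s) s) \<le> norm (dom_const c * \<Phi> (f s) s)"
      using norm_K_le[OF s le[OF s] c] unfolding real_norm_def by linarith
  qed
qed (rule K_measurable[OF g])

lemma K_integral_continuous:
  assumes \<Phi>: "integrable lam (\<lambda>s. \<Phi> (f s) s)" and g: "\<And>n. g n \<in> borel_measurable lam" "h \<in> borel_measurable lam"
    and le: "\<And>n s. s \<in> space lam \<Longrightarrow> \<bar>g n s\<bar> \<le> c * \<bar>f s\<bar>" and c: "0 \<le> c"
    and lim: "\<And>s. s \<in> space lam \<Longrightarrow> (\<lambda>n. g n s) \<longlonglongrightarrow> h s"
  shows "(\<lambda>n. \<integral>s. K (g n s) s \<partial>lam) \<longlonglongrightarrow> (\<integral>s. K (h s) s \<partial>lam)"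
proof (rule integral_dominated_convergence)
  show "integrable lam (\<lambda>s. dom_const c * \<Phi> (f s) s)" using \<Phi> by simp
  show "AE s in lam. cmod (K (g n s) s) \<le> dom_const c * \<Phi> (f s) s" for n
    using norm_K_le[OF _ le c] by (auto intro!: AE_I2)
  show "AE s in lam. (\<lambda>n. K (g n s) s) \<longlonglongrightarrow> K (h s) s"
    using K_continuous lim by (auto intro!: AE_I2)
qed (rule K_measurable, rule g)+

end

section \<open>Characteristic functions of integrals of simple functions\<close>

context qid_setting
begin

lemma levy_weight_mixture_finite:
  assumes "(\<integral>\<^sup>+s. jump_V0 \<rho> (f s) s \<partial>lam) < \<infinity>"
  shows "(\<integral>\<^sup>+s. (\<integral>\<^sup>+x. ennreal (levy_weight (f s * x)) \<partial>ql_pos (\<rho> s)) \<partial>lam) < \<infinity>"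
    "(\<integral>\<^sup>+s. (\<integral>\<^sup>+x. ennreal (levy_weight (f s * x)) \<partial>ql_neg (\<rho> s)) \<partial>lam) < \<infinity>"
  by (rule le_less_trans[OF nn_integral_mono assms], simp add: jump_V0_eq)+

text \<open>
  Taken for \<open>f\<close> itself this evaluates the exponent of the theorem, and taken for an indicator function
  it disintegrates \<open>F\<^sub>A\<close>.
\<close>

lemma ql_mixture:
  assumes f: "f \<in> borel_measurable lam" and fin: "(\<integral>\<^sup>+s. jump_V0 \<rho> (f s) s \<partial>lam) < \<infinity>"
    and g: "g \<in> borel_measurable borel" "\<And>x. cmod (g x) \<le> C * levy_weight x"
  shows "integrable lam (\<lambda>s. ql_integral (\<rho> s) (\<lambda>x. g (f s * x)))"
    "(\<integral>s. ql_integral (\<rho> s) (\<lambda>x. g (f s * x)) \<partial>lam) =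
      (\<integral>y. g y \<partial>F_tilde_f lam (\<lambda>s. ql_pos (\<rho> s)) f) - (\<integral>y. g y \<partial>F_tilde_f lam (\<lambda>s. ql_neg (\<rho> s)) f)"
  using pos.integral_F_tilde_f[OF f levy_weight_mixture_finite(1)[OF fin] g]
    neg.integral_F_tilde_f[OF f levy_weight_mixture_finite(2)[OF fin] g]
  by (simp_all add: ql_integral_def)

lemma V_one_le: "s \<in> space lam \<Longrightarrow> V 1 s \<le> 2"
  using jump_V0_eq_V[of s 1] \<rho>_bound[of s] by (simp add: jump_V0_def space_lam ennreal_le_iff2 flip: ennreal_numeral)

lemma V_measurable:
  assumes [measurable]: "f \<in> borel_measurable lam"
  shows "(\<lambda>s. V (f s) s) \<in> borel_measurable lam"
  unfolding V_def
  by (intro borel_measurable_add pos.kernel_integral_measurable2 neg.kernel_integral_measurable2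
    levy_weight_kernel_integrable) measurable

lemma \<Phi>_one_integrable: "integrable lam (\<lambda>s. \<Phi> 1 s)"
proof -
  have "integrable lam (\<lambda>s. V 1 s)"
    using V_one_le V_measurable[of "\<lambda>_. 1"]
    by (intro finite_measure.integrable_const_bound[OF finite_lam, where B=2]) auto
  then show ?thesis
    unfolding \<Phi>_def U_one using a_integrable sig2_integrable by simp
qed

lemma jump_V0_bounded_finite:
  assumes f: "\<And>s. s \<in> space lam \<Longrightarrow> \<bar>f s\<bar> \<le> c" "0 \<le> c"
  shows "(\<integral>\<^sup>+s. jump_V0 \<rho> (f s) s \<partial>lam) < \<infinity>"
proof -
  define D where "D = (1 + c\<^sup>2) * 2"
  have "jump_V0 \<rho> (f s) s \<le> ennreal D" if s: "s \<in> space lam" for s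
    unfolding jump_V0_eq_V[OF s] D_def
    using order_trans[OF V_le[OF s, of "f s" c 1] mult_left_mono[OF V_one_le[OF s], of "1 + c\<^sup>2"]] f s
    by (intro ennreal_leI) simp
  then have "(\<integral>\<^sup>+s. jump_V0 \<rho> (f s) s \<partial>lam) \<le> (\<integral>\<^sup>+s. ennreal D \<partial>lam)"
    by (rule nn_integral_mono)
  also have "\<dots> < \<infinity>"
    using finite_measure.emeasure_finite[OF finite_lam] by (simp add: ennreal_mult_eq_top_iff less_top[symmetric])
  finally show ?thesis .
qed

text \<open>
  The disintegration of \<open>J\<close> says that \<open>F\<^sub>A\<close> and the mixture for \<open>f = 1\<^sub>A\<close> agree after weighting by
  \<open>1 \<and> x\<^sup>2\<close>, so \<open>ql_integral_eq_diff\<close> applies.  As \<open>K 0 s = 0\<close>, the restriction to \<open>A\<close> can be moved into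
  the argument of \<open>K\<close>.
\<close>

theorem char_\<Lambda>:
  assumes A: "A \<in> sets M"
  shows "char (distr P borel (\<Lambda> A)) \<theta> = exp (\<integral>s. K (\<theta> * indicator A s) s \<partial>lam)"
proof -
  have [measurable]: "A \<in> sets lam" using A by (simp add: sets_lam)
  let ?f = "indicator A :: 's \<Rightarrow> real"
  let ?N = "\<lambda>\<kappa>. F_tilde_f lam \<kappa> ?f"
  have f: "?f \<in> borel_measurable lam" by simp
  have fin: "(\<integral>\<^sup>+s. jump_V0 \<rho> (?f s) s \<partial>lam) < \<infinity>"
    by (rule jump_V0_bounded_finite[of _ 1]) (auto simp: indicator_def)
  note T = triplet[OF A, unfolded has_char_triplet_def]
  have N: "levy_measure (?N (\<lambda>s. ql_pos (\<rho> s)))" "levy_measure (?N (\<lambda>s. ql_neg (\<rho> s)))"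
    using pos.levy_measure_F_tilde_f[OF f levy_weight_mixture_finite(1)[OF fin]]
      neg.levy_measure_F_tilde_f[OF f levy_weight_mixture_finite(2)[OF fin]] by auto
  have w: "ql_integral (F A) (\<lambda>x. indicator B x * levy_weight x) =
      (\<integral>x. indicator B x * levy_weight x \<partial>?N (\<lambda>s. ql_pos (\<rho> s))) - (\<integral>x. indicator B x * levy_weight x \<partial>?N (\<lambda>s. ql_neg (\<rho> s)))"
    if B[measurable]: "B \<in> sets borel" for B
  proof -
    let ?g = "\<lambda>x. indicator B x * levy_weight x"
    have g: "(\<lambda>x. complex_of_real (?g x)) \<in> borel_measurable borel" by measurable
    have gC: "cmod (complex_of_real (?g x)) \<le> 1 * levy_weight x" for x by (auto simp: indicator_def)
    have "ql_integral (F A) ?g = (\<integral>s. indicator A s * ql_integral (\<rho> s) ?g \<partial>lam)"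
      using J_disintegration[OF A B] by (simp add: bimeasure_J_def levy_weight_def set_lebesgue_integral_def)
    also have "complex_of_real \<dots> = (\<integral>s. ql_integral (\<rho> s) (\<lambda>x. complex_of_real (?g (?f s * x))) \<partial>lam)"
      unfolding integral_complex_of_real[symmetric] ql_integral_of_real
      by (intro Bochner_Integration.integral_cong refl) (auto simp: indicator_def ql_integral_def)
    also have "\<dots> = complex_of_real ((\<integral>x. ?g x \<partial>?N (\<lambda>s. ql_pos (\<rho> s))) - (\<integral>x. ?g x \<partial>?N (\<lambda>s. ql_neg (\<rho> s))))"
      unfolding ql_mixture(2)[OF f fin g gC] by (simp del: of_real_mult)
    finally show ?thesis by (simp only: of_real_eq_iff)
  qed
  have "ql_integral (F A) (levy_integrand \<theta>) = (\<integral>s. ql_integral (\<rho> s) (\<lambda>x. levy_integrand \<theta> (?f s * x)) \<partial>lam)"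
    using ql_integral_eq_diff[OF _ N w levy_integrand_measurable levy_integrand_le] T
      ql_mixture(2)[OF f fin levy_integrand_measurable levy_integrand_le] by simp
  moreover have "complex_of_real (\<nu>0 A) = (\<integral>s. complex_of_real (indicator A s * a s) \<partial>lam)"
    using deriv_a A by (simp add: signed_RN_deriv_def sets_lam set_lebesgue_integral_def del: of_real_mult)
  moreover have "complex_of_real (measure \<nu>1 A) = (\<integral>s. complex_of_real (indicator A s * sig2 s) \<partial>lam)"
    using deriv_sig2 A by (simp add: signed_RN_deriv_def sets_lam set_lebesgue_integral_def del: of_real_mult)
  moreover have "integrable lam (\<lambda>s. complex_of_real (indicator A s * a s))" "integrable lam (\<lambda>s. complex_of_real (indicator A s * sig2 s))"
    using integrable_real_mult_indicator[OF \<open>A \<in> sets lam\<close> a_integrable] integrable_real_mult_indicator[OF \<open>A \<in> sets lam\<close> sig2_integrable]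
    by (auto simp: mult.commute simp del: of_real_mult)
  moreover have "levy_integrand 0 = (\<lambda>_. 0)" by (simp add: fun_eq_iff)
  then have "(\<integral>s. K (\<theta> * indicator A s) s \<partial>lam) =
     (\<integral>s. \<i> * \<theta> * complex_of_real (indicator A s * a s) - \<theta>\<^sup>2 / 2 * complex_of_real (indicator A s * sig2 s)
       + ql_integral (\<rho> s) (\<lambda>x. levy_integrand \<theta> (?f s * x)) \<partial>lam)"
    by (intro Bochner_Integration.integral_cong refl) (auto simp: K_eq indicator_def ql_integral_def)
  ultimately have "(\<integral>s. K (\<theta> * indicator A s) s \<partial>lam) =
      \<i> * \<theta> * \<nu>0 A - \<theta>\<^sup>2 / 2 * measure \<nu>1 A + ql_integral (F A) (levy_integrand \<theta>)"
    using ql_mixture(1)[OF f fin levy_integrand_measurable levy_integrand_le] by simp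
  then show ?thesis using T by (simp add: levy_integrand_def[abs_def])
qed

lemma \<Lambda>_empty: "AE w in P. \<Lambda> {} w = 0"
proof -
  have "AE w in P. (\<lambda>n::nat. \<Lambda> {} w) sums \<Lambda> {} w"
    using countably_additive_\<Lambda>[of "\<lambda>_. {}"] by (simp add: disjoint_family_on_def)
  then show ?thesis
  proof eventually_elim
    case (elim w)
    then show ?case using summable_LIMSEQ_zero[of "\<lambda>_. \<Lambda> {} w"] by (auto simp: summable_def LIMSEQ_const_iff)
  qed
qed

text \<open>
  Finite families are padded with empty sets, since \<open>\<Lambda>\<close> is given on sequences of disjoint sets.
\<close>

lemma nat_indexed_family:
  fixes I :: "'i set"
  assumes "finite I" "\<And>i. i \<in> I \<Longrightarrow> D i \<in> sets M" "disjoint_family_on D I"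
  obtains D' :: "nat \<Rightarrow> 's set" and e :: "'i \<Rightarrow> nat" where "inj_on e I" "range D' \<subseteq> sets M" "disjoint_family D'"
    "\<And>i. i \<in> I \<Longrightarrow> D' (e i) = D i" "\<And>n. n \<notin> e ` I \<Longrightarrow> D' n = {}"
proof -
  define e where "e = to_nat_on I"
  have e: "inj_on e I" using assms(1) by (simp add: e_def countable_finite inj_on_to_nat_on)
  define D' where "D' n = (if n \<in> e ` I then D (the_inv_into I e n) else {})" for n
  have eq: "D' (e i) = D i" if "i \<in> I" for i
    using that e by (simp add: D'_def the_inv_into_f_f)
  have em: "D' n = {}" if "n \<notin> e ` I" for n using that by (simp add: D'_def)
  have "D' n \<in> sets M" for n
    by (cases "n \<in> e ` I") (auto simp: em eq assms(2))
  moreover have "D' m \<inter> D' n = {}" if "m \<noteq> n" for m n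
  proof (cases "m \<in> e ` I \<and> n \<in> e ` I")
    case True
    then obtain i j where "i \<in> I" "j \<in> I" "m = e i" "n = e j" by auto
    with that have "i \<noteq> j" by auto
    with assms(3) \<open>i \<in> I\<close> \<open>j \<in> I\<close> show ?thesis
      by (simp add: eq \<open>m = e i\<close> \<open>n = e j\<close> disjoint_family_on_def)
  qed (auto simp: em)
  ultimately show thesis using e eq em by (intro that[of e D']) (auto simp: disjoint_family_on_def)
qed

lemma \<Lambda>_finite_additive:
  fixes I :: "'i set"
  assumes I: "finite I" "\<And>i. i \<in> I \<Longrightarrow> D i \<in> sets M" "disjoint_family_on D I"
  shows "AE w in P. \<Lambda> (\<Union>i\<in>I. D i) w = (\<Sum>i\<in>I. \<Lambda> (D i) w)"
proof -
  obtain D' :: "nat \<Rightarrow> 's set" and e :: "'i \<Rightarrow> nat" where D': "inj_on e I" "range D' \<subseteq> sets M" "disjoint_family D'"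
    "\<And>i. i \<in> I \<Longrightarrow> D' (e i) = D i" "\<And>n. n \<notin> e ` I \<Longrightarrow> D' n = {}"
    using nat_indexed_family[OF I] by metis
  have U: "(\<Union>n. D' n) = (\<Union>i\<in>I. D i)"
  proof -
    have "D' n \<subseteq> (\<Union>i\<in>I. D i)" for n using D'(5)[of n] D'(4) by (cases "n \<in> e ` I") auto
    moreover have "D i \<subseteq> (\<Union>n. D' n)" if "i \<in> I" for i using D'(4)[OF that] by auto
    ultimately show ?thesis by blast
  qed
  show ?thesis using countably_additive_\<Lambda>[OF D'(2,3)] \<Lambda>_empty
  proof eventually_elim
    case (elim w)
    have "(\<lambda>n. \<Lambda> (D' n) w) sums (\<Sum>n\<in>e ` I. \<Lambda> (D' n) w)"
      using I(1) elim(2) D'(5) by (intro sums_finite) auto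
    moreover have "(\<Sum>n\<in>e ` I. \<Lambda> (D' n) w) = (\<Sum>i\<in>I. \<Lambda> (D i) w)"
      using D'(1,4) by (simp add: sum.reindex)
    ultimately show ?case using elim(1) unfolding U by (metis sums_unique2)
  qed
qed

lemma char_scaled:
  assumes [measurable]: "X \<in> borel_measurable P"
  shows "char (distr P borel (\<lambda>w. c * X w)) \<theta> = char (distr P borel X) (\<theta> * c)"
  by (simp add: char_def integral_distr mult.assoc mult.left_commute)

lemma char_\<Lambda>_linear_combination:
  fixes I :: "'i set" and c :: "'i \<Rightarrow> real"
  assumes I: "finite I" "\<And>i. i \<in> I \<Longrightarrow> D i \<in> sets M" "disjoint_family_on D I"
  shows "char (distr P borel (\<lambda>w. \<Sum>i\<in>I. c i * \<Lambda> (D i) w)) \<theta> = (\<Prod>i\<in>I. char (distr P borel (\<Lambda> (D i))) (\<theta> * c i))"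
proof -
  obtain D' :: "nat \<Rightarrow> 's set" and e :: "'i \<Rightarrow> nat" where D': "inj_on e I" "range D' \<subseteq> sets M" "disjoint_family D'"
    "\<And>i. i \<in> I \<Longrightarrow> D' (e i) = D i" "\<And>n. n \<notin> e ` I \<Longrightarrow> D' n = {}"
    using nat_indexed_family[OF I] by metis
  define c' where "c' n = c (the_inv_into I e n)" for n
  have c': "c' (e i) = c i" if "i \<in> I" for i using D'(1) that by (simp add: c'_def the_inv_into_f_f)
  have [measurable]: "\<Lambda> (D' n) \<in> borel_measurable P" for n using D'(2) by (intro random_variable_\<Lambda>) auto
  have "indep_vars (\<lambda>_. borel) (\<lambda>n. \<Lambda> (D' n)) (e ` I)"
    using indep_\<Lambda>[OF D'(2,3)] by (rule indep_vars_subset) simp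
  then have ind: "indep_vars (\<lambda>_. borel) (\<lambda>n w. c' n * \<Lambda> (D' n) w) (e ` I)"
    using indep_vars_compose2[of "\<lambda>_. borel" _ "e ` I" "\<lambda>n x. c' n * x" "\<lambda>_. borel"] by simp
  have "(\<Sum>i\<in>I. c i * \<Lambda> (D i) w) = (\<Sum>n\<in>e ` I. c' n * \<Lambda> (D' n) w)" for w
    using D'(1,4) c' by (simp add: sum.reindex)
  then show ?thesis
    using char_distr_sum[OF ind, of \<theta>] D'(1,4) c' by (simp add: prod.reindex char_scaled)
qed

lemma simple_\<Lambda>_integral_measurable:
  assumes g: "simple_function M g" and A: "A \<in> sets M"
  shows "simple_\<Lambda>_integral M \<Lambda> g A \<in> borel_measurable P"
proof -
  have "A \<inter> (g -` {y} \<inter> space M) \<in> sets M" for y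
    using A simple_functionD(2)[OF g] by auto
  then show ?thesis
    unfolding simple_\<Lambda>_integral_def[abs_def]
    by (intro borel_measurable_sum borel_measurable_times random_variable_\<Lambda>) auto
qed

theorem char_simple_\<Lambda>_integral:
  assumes g: "simple_function M g" and A: "A \<in> sets M"
  shows "char (distr P borel (simple_\<Lambda>_integral M \<Lambda> g A)) \<theta> = exp (\<integral>s. K (\<theta> * (g s * indicator A s)) s \<partial>lam)"
proof -
  define I where "I = g ` space M"
  define D where "D y = A \<inter> (g -` {y} \<inter> space M)" for y
  have I: "finite I" using simple_functionD(1)[OF g] by (simp add: I_def)
  have D: "D y \<in> sets M" for y
    using A simple_functionD(2)[OF g] by (auto simp: D_def)
  have disj: "disjoint_family_on D I" by (auto simp: disjoint_family_on_def D_def)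
  have int: "integrable lam (\<lambda>s. K (\<theta> * y * indicator (D y) s) s)" for y
    using D[of y] \<Phi>_one_integrable
    by (intro K_integrable[of "\<lambda>_. 1" _ "\<bar>\<theta> * y\<bar>"]) (auto simp: sets_lam[symmetric] abs_mult indicator_def)
  have "char (distr P borel (simple_\<Lambda>_integral M \<Lambda> g A)) \<theta> = (\<Prod>y\<in>I. char (distr P borel (\<Lambda> (D y))) (\<theta> * y))"
    using char_\<Lambda>_linear_combination[OF I D disj, of "\<lambda>y. y"] by (simp add: simple_\<Lambda>_integral_def[abs_def] I_def D_def)
  also have "\<dots> = (\<Prod>y\<in>I. exp (\<integral>s. K (\<theta> * y * indicator (D y) s) s \<partial>lam))"
    by (simp add: char_\<Lambda>[OF D])
  also have "\<dots> = exp (\<integral>s. (\<Sum>y\<in>I. K (\<theta> * y * indicator (D y) s) s) \<partial>lam)"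
    using I int by (simp add: exp_sum)
  also have "(\<integral>s. (\<Sum>y\<in>I. K (\<theta> * y * indicator (D y) s) s) \<partial>lam) = (\<integral>s. K (\<theta> * (g s * indicator A s)) s \<partial>lam)"
  proof (intro Bochner_Integration.integral_cong refl)
    fix s assume s: "s \<in> space lam"
    then have "g s \<in> I" by (auto simp: I_def space_lam)
    have "(\<Sum>y\<in>I. K (\<theta> * y * indicator (D y) s) s) = (\<Sum>y\<in>{g s}. K (\<theta> * y * indicator (D y) s) s)"
      using I \<open>g s \<in> I\<close> by (intro sum.mono_neutral_right) (auto simp: D_def indicator_def)
    then show "(\<Sum>y\<in>I. K (\<theta> * y * indicator (D y) s) s) = K (\<theta> * (g s * indicator A s)) s"
      using s by (auto simp: D_def indicator_def space_lam)
  qed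
  finally show ?thesis .
qed

text \<open>
  The level sets of a pair \<open>p\<close> of simple functions refine those of both components and of every function
  of the two, so this form makes the integral additive.
\<close>

lemma simple_\<Lambda>_integral_refine:
  fixes p :: "'s \<Rightarrow> 'k"
  assumes p: "simple_function M p" and A: "A \<in> sets M"
  shows "AE w in P. simple_\<Lambda>_integral M \<Lambda> (\<lambda>s. G (p s)) A w = (\<Sum>k\<in>p ` space M. G k * \<Lambda> (A \<inter> (p -` {k} \<inter> space M)) w)"
proof -
  define I where "I = p ` space M"
  define D where "D k = A \<inter> (p -` {k} \<inter> space M)" for k
  have I: "finite I" using simple_functionD(1)[OF p] by (simp add: I_def)
  have D: "D k \<in> sets M" for k
    using A simple_functionD(2)[OF p] by (auto simp: D_def)
  have U: "A \<inter> ((\<lambda>s. G (p s)) -` {y} \<inter> space M) = (\<Union>k\<in>{k\<in>I. G k = y}. D k)" for y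
    by (auto simp: D_def I_def)
  have "AE w in P. \<Lambda> (A \<inter> ((\<lambda>s. G (p s)) -` {y} \<inter> space M)) w = (\<Sum>k\<in>{k\<in>I. G k = y}. \<Lambda> (D k) w)" for y
    unfolding U using I D by (intro \<Lambda>_finite_additive) (auto simp: disjoint_family_on_def D_def)
  then have "AE w in P. \<forall>y\<in>G ` I. \<Lambda> (A \<inter> ((\<lambda>s. G (p s)) -` {y} \<inter> space M)) w = (\<Sum>k\<in>{k\<in>I. G k = y}. \<Lambda> (D k) w)"
    using I by (intro AE_finite_allI) auto
  then show ?thesis
  proof eventually_elim
    case (elim w)
    have GI: "(\<lambda>s. G (p s)) ` space M = G ` I" by (auto simp: I_def)
    have "(\<Sum>k\<in>I. G k * \<Lambda> (D k) w) = (\<Sum>y\<in>G ` I. \<Sum>k\<in>{k\<in>I. G k = y}. G k * \<Lambda> (D k) w)"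
      by (rule sum.image_gen[OF I])
    also have "\<dots> = (\<Sum>y\<in>G ` I. y * \<Lambda> (A \<inter> ((\<lambda>s. G (p s)) -` {y} \<inter> space M)) w)"
      using elim by (intro sum.cong) (auto simp: sum_distrib_left)
    finally show ?case by (simp add: simple_\<Lambda>_integral_def GI I_def D_def)
  qed
qed

lemma simple_\<Lambda>_integral_diff:
  assumes g: "simple_function M g" "simple_function M h" and A: "A \<in> sets M"
  shows "AE w in P. simple_\<Lambda>_integral M \<Lambda> (\<lambda>s. g s - h s) A w =
    simple_\<Lambda>_integral M \<Lambda> g A w - simple_\<Lambda>_integral M \<Lambda> h A w"
proof -
  have p: "simple_function M (\<lambda>s. (g s, h s))" using g by (rule simple_function_Pair)
  show ?thesis
    using simple_\<Lambda>_integral_refine[OF p A, of "\<lambda>(x, y). x - y"] simple_\<Lambda>_integral_refine[OF p A, of fst]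
      simple_\<Lambda>_integral_refine[OF p A, of snd]
    by eventually_elim (simp add: sum_subtractf[symmetric] left_diff_distrib case_prod_beta)
qed

lemma simple_\<Lambda>_integral_diff_measurable:
  assumes g: "simple_function M g" "simple_function M h" and A: "A \<in> sets M"
  shows "(\<lambda>w. simple_\<Lambda>_integral M \<Lambda> g A w - simple_\<Lambda>_integral M \<Lambda> h A w) \<in> borel_measurable P"
  using simple_\<Lambda>_integral_measurable[OF g(1) A] simple_\<Lambda>_integral_measurable[OF g(2) A] by simp

corollary char_simple_\<Lambda>_integral_diff:
  assumes g: "simple_function M g" "simple_function M h" and A: "A \<in> sets M"
  shows "char (distr P borel (\<lambda>w. simple_\<Lambda>_integral M \<Lambda> g A w - simple_\<Lambda>_integral M \<Lambda> h A w)) \<theta> =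
    exp (\<integral>s. K (\<theta> * ((g s - h s) * indicator A s)) s \<partial>lam)"
proof -
  have d: "simple_function M (\<lambda>s. g s - h s)" using g by (rule simple_function_diff)
  have "distr P borel (\<lambda>w. simple_\<Lambda>_integral M \<Lambda> g A w - simple_\<Lambda>_integral M \<Lambda> h A w) =
      distr P borel (simple_\<Lambda>_integral M \<Lambda> (\<lambda>s. g s - h s) A)"
    by (intro distr_cong_AE refl simple_\<Lambda>_integral_measurable[OF d A] simple_\<Lambda>_integral_diff_measurable[OF g A])
      (use simple_\<Lambda>_integral_diff[OF g A] in \<open>auto elim: eventually_mono\<close>)
  then show ?thesis by (simp add: char_simple_\<Lambda>_integral[OF d A])
qed

end

section \<open>Convergence in probability\<close>

context prob_space
begin

lemma prob_abs_sum_le: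
  fixes Y Z :: "'a \<Rightarrow> real"
  assumes [measurable]: "Y \<in> borel_measurable M" "Z \<in> borel_measurable M"
  shows "prob {w \<in> space M. \<epsilon> < \<bar>Y w + Z w\<bar>} \<le> prob {w \<in> space M. \<epsilon> / 2 < \<bar>Y w\<bar>} + prob {w \<in> space M. \<epsilon> / 2 < \<bar>Z w\<bar>}"
proof -
  have "\<epsilon> / 2 < \<bar>Y w\<bar> \<or> \<epsilon> / 2 < \<bar>Z w\<bar>" if "\<epsilon> < \<bar>Y w + Z w\<bar>" for w
    using that abs_triangle_ineq[of "Y w" "Z w"] by linarith
  then have "prob {w \<in> space M. \<epsilon> < \<bar>Y w + Z w\<bar>} \<le> prob ({w \<in> space M. \<epsilon> / 2 < \<bar>Y w\<bar>} \<union> {w \<in> space M. \<epsilon> / 2 < \<bar>Z w\<bar>})"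
    by (intro finite_measure_mono) auto
  also have "\<dots> \<le> prob {w \<in> space M. \<epsilon> / 2 < \<bar>Y w\<bar>} + prob {w \<in> space M. \<epsilon> / 2 < \<bar>Z w\<bar>}"
    by (rule measure_Un_le) auto
  finally show ?thesis .
qed

lemma AE_tendsto_imp_prob_tendsto:
  fixes X :: "nat \<Rightarrow> 'a \<Rightarrow> real"
  assumes [measurable]: "\<And>n. X n \<in> borel_measurable M" "Y \<in> borel_measurable M"
    and lim: "AE w in M. (\<lambda>n. X n w) \<longlonglongrightarrow> Y w" and \<epsilon>: "0 < \<epsilon>"
  shows "(\<lambda>n. prob {w \<in> space M. \<epsilon> < \<bar>X n w - Y w\<bar>}) \<longlonglongrightarrow> 0"
proof -
  let ?E = "\<lambda>n. {w \<in> space M. \<epsilon> < \<bar>X n w - Y w\<bar>}"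
  have "(\<lambda>n. \<integral>w. indicator (?E n) w \<partial>M) \<longlonglongrightarrow> (\<integral>w. 0 \<partial>M :: real)"
  proof (rule integral_dominated_convergence[where w = "\<lambda>_. 1"])
    show "AE w in M. (\<lambda>n. indicator (?E n) w :: real) \<longlonglongrightarrow> 0"
      using lim
    proof eventually_elim
      case (elim w)
      have "\<forall>\<^sub>F n in sequentially. \<bar>X n w - Y w\<bar> < \<epsilon>"
        using tendstoD[OF elim \<epsilon>] by (simp add: dist_real_def)
      then have "\<forall>\<^sub>F n in sequentially. indicator (?E n) w = (0::real)"
        by eventually_elim (auto simp: indicator_def)
      then show ?case by (rule tendsto_eventually)
    qed
  qed (auto simp: indicator_def)
  then show ?thesis by simp
qed

lemma char_tendsto:
  assumes X [measurable]: "\<And>n. X n \<in> borel_measurable M" and conv: "converges_in_prob M X Y"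
  shows "(\<lambda>n. char (distr M borel (X n)) \<theta>) \<longlonglongrightarrow> char (distr M borel Y) \<theta>"
proof (rule tendstoI)
  fix e :: real assume e: "0 < e"
  have [measurable]: "Y \<in> borel_measurable M" using conv by (simp add: converges_in_prob_def)
  define \<epsilon> where "\<epsilon> = e / (2 * (\<bar>\<theta>\<bar> + 1))"
  have \<epsilon>: "0 < \<epsilon>" "\<bar>\<theta>\<bar> * \<epsilon> \<le> e / 2"
    using e by (auto simp: \<epsilon>_def field_simps intro!: add_pos_nonneg)
  let ?E = "\<lambda>n. {w \<in> space M. \<epsilon> < \<bar>X n w - Y w\<bar>}"
  have bound: "cmod (char (distr M borel (X n)) \<theta> - char (distr M borel Y) \<theta>) \<le> \<bar>\<theta>\<bar> * \<epsilon> + 2 * prob (?E n)" for n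
  proof -
    have i: "integrable M (\<lambda>w. iexp (\<theta> * Z w))" if [measurable]: "Z \<in> borel_measurable M" for Z :: "'a \<Rightarrow> real"
      by (rule integrable_const_bound[of _ 1]) auto
    have le: "cmod (iexp (\<theta> * X n w) - iexp (\<theta> * Y w)) \<le> \<bar>\<theta>\<bar> * \<epsilon> + 2 * indicator (?E n) w" if "w \<in> space M" for w
    proof (cases "w \<in> ?E n")
      case True
      have "cmod (iexp (\<theta> * X n w) - iexp (\<theta> * Y w)) \<le> 2"
        using norm_triangle_ineq4[of "iexp (\<theta> * X n w)" "iexp (\<theta> * Y w)"] by simp
      moreover have "0 \<le> \<bar>\<theta>\<bar> * \<epsilon>" using \<epsilon>(1) by simp
      ultimately show ?thesis using True by simp
    next
      case False
      have "iexp (\<theta> * X n w) - iexp (\<theta> * Y w) = iexp (\<theta> * Y w) * (iexp (\<theta> * (X n w - Y w)) - 1)"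
        by (simp add: algebra_simps flip: exp_add)
      then have "cmod (iexp (\<theta> * X n w) - iexp (\<theta> * Y w)) = cmod (iexp (\<theta> * (X n w - Y w)) - 1)"
        by (simp add: norm_mult)
      also have "\<dots> \<le> \<bar>\<theta> * (X n w - Y w)\<bar>"
        using iexp_approx1[of "\<theta> * (X n w - Y w)" 0] by simp
      also have "\<dots> \<le> \<bar>\<theta>\<bar> * \<epsilon>"
        unfolding abs_mult using False that by (intro mult_left_mono) auto
      finally show ?thesis using False by simp
    qed
    have "char (distr M borel (X n)) \<theta> - char (distr M borel Y) \<theta> = (\<integral>w. iexp (\<theta> * X n w) - iexp (\<theta> * Y w) \<partial>M)"
      using i[of "X n"] i[of Y] by (simp add: char_def integral_distr)
    also have "cmod \<dots> \<le> (\<integral>w. cmod (iexp (\<theta> * X n w) - iexp (\<theta> * Y w)) \<partial>M)"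
      by (rule integral_norm_bound)
    also have "\<dots> \<le> (\<integral>w. \<bar>\<theta>\<bar> * \<epsilon> + 2 * indicator (?E n) w \<partial>M)"
      using i[of "X n"] i[of Y] le by (intro integral_mono) (auto simp: integrable_real_indicator less_top[symmetric])
    also have "\<dots> = \<bar>\<theta>\<bar> * \<epsilon> + 2 * prob (?E n)"
      by (subst Bochner_Integration.integral_add) (auto simp: prob_space less_top[symmetric])
    finally show ?thesis .
  qed
  have "\<forall>\<^sub>F n in sequentially. prob (?E n) < e / 4"
    using conv \<epsilon>(1) e by (intro order_tendstoD(2)[of _ 0]) (auto simp: converges_in_prob_def)
  then show "\<forall>\<^sub>F n in sequentially. dist (char (distr M borel (X n)) \<theta>) (char (distr M borel Y) \<theta>) < e"
  proof eventually_elim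
    case (elim n)
    then show ?case using bound[of n] \<epsilon>(2) unfolding dist_norm by linarith
  qed
qed

text \<open>
  By Levy's continuity theorem the laws converge weakly to the point mass at \<open>0\<close>, and \<open>\<plusminus>\<epsilon>\<close> are
  continuity points of its distribution function.
\<close>

lemma prob_tendsto_zero_of_char:
  fixes X :: "nat \<Rightarrow> 'a \<Rightarrow> real"
  assumes X [measurable]: "\<And>n. X n \<in> borel_measurable M"
    and char: "\<And>\<theta>. (\<lambda>n. char (distr M borel (X n)) \<theta>) \<longlonglongrightarrow> 1" and \<epsilon>: "0 < \<epsilon>"
  shows "(\<lambda>n. prob {w \<in> space M. \<epsilon> < \<bar>X n w\<bar>}) \<longlonglongrightarrow> 0"
proof -
  let ?R = "return borel (0::real)"
  interpret R: prob_space ?R by (rule prob_space_return) simp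
  have R: "real_distribution ?R" by (simp add: real_distribution_def real_distribution_axioms_def R.prob_space_axioms)
  then interpret R: real_distribution ?R .
  have D: "real_distribution (distr M borel (X n))" for n by simp
  have "char ?R \<theta> = 1" for \<theta> by (simp add: char_def integral_return)
  then have "weak_conv_m (\<lambda>n. distr M borel (X n)) ?R"
    using char by (intro levy_continuity D R) simp
  moreover have "isCont (cdf ?R) x" if "x \<noteq> 0" for x
    using that by (subst R.isCont_cdf) (simp add: measure_return)
  ultimately have c: "(\<lambda>n. cdf (distr M borel (X n)) x) \<longlonglongrightarrow> cdf ?R x" if "x \<noteq> 0" for x
    using that by (simp add: weak_conv_m_def weak_conv_def)
  have "(\<lambda>n. 1 - cdf (distr M borel (X n)) \<epsilon> + cdf (distr M borel (X n)) (- \<epsilon>)) \<longlonglongrightarrow> 1 - cdf ?R \<epsilon> + cdf ?R (- \<epsilon>)"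
    using \<epsilon> by (intro tendsto_intros c) auto
  also have "1 - cdf ?R \<epsilon> + cdf ?R (- \<epsilon>) = 0"
    using \<epsilon> by (simp add: cdf_def measure_return)
  finally have lim: "(\<lambda>n. 1 - cdf (distr M borel (X n)) \<epsilon> + cdf (distr M borel (X n)) (- \<epsilon>)) \<longlonglongrightarrow> 0" .
  have "prob {w \<in> space M. \<epsilon> < \<bar>X n w\<bar>} \<le> 1 - cdf (distr M borel (X n)) \<epsilon> + cdf (distr M borel (X n)) (- \<epsilon>)" for n
  proof -
    have c: "cdf (distr M borel (X n)) x = prob {w \<in> space M. X n w \<le> x}" for x
      by (simp add: cdf_def measure_distr vimage_def Int_def conj_commute)
    have "prob {w \<in> space M. \<epsilon> < \<bar>X n w\<bar>} \<le> prob ({w \<in> space M. \<not> X n w \<le> \<epsilon>} \<union> {w \<in> space M. X n w \<le> - \<epsilon>})"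
      by (intro finite_measure_mono) auto
    also have "\<dots> \<le> prob {w \<in> space M. \<not> X n w \<le> \<epsilon>} + prob {w \<in> space M. X n w \<le> - \<epsilon>}"
      by (rule measure_Un_le) auto
    also have "prob {w \<in> space M. \<not> X n w \<le> \<epsilon>} = 1 - prob {w \<in> space M. X n w \<le> \<epsilon>}"
      by (rule prob_neg) simp
    finally show ?thesis unfolding c .
  qed
  then show ?thesis
    by (intro tendsto_sandwich[OF _ _ tendsto_const lim]) auto
qed

text \<open>
  Along a subsequence the increments exceed \<open>2\<^sup>-\<^sup>k\<close> with probability at most \<open>2\<^sup>-\<^sup>k\<close>, so that it
  converges almost surely by the Borel-Cantelli lemma.  The Cauchy property is stated for pairs of
  index sequences because it is verified by dominated convergence, which needs sequences.
\<close>

lemma Cauchy_in_prob_converges: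
  fixes X :: "nat \<Rightarrow> 'a \<Rightarrow> real"
  assumes X [measurable]: "\<And>n. X n \<in> borel_measurable M"
    and cauchy: "\<And>p q \<epsilon>. (\<And>k. k \<le> p k) \<Longrightarrow> (\<And>k. k \<le> q k) \<Longrightarrow> 0 < \<epsilon> \<Longrightarrow>
      (\<lambda>k. prob {w \<in> space M. \<epsilon> < \<bar>X (p k) w - X (q k) w\<bar>}) \<longlonglongrightarrow> 0"
  shows "\<exists>Y. converges_in_prob M X Y"
proof -
  define E where "E \<epsilon> m n = {w \<in> space M. \<epsilon> < \<bar>X m w - X n w\<bar>}" for \<epsilon> m n
  have [measurable]: "E \<epsilon> m n \<in> sets M" for \<epsilon> m n unfolding E_def by measurable
  have unif: "\<exists>N. \<forall>m\<ge>N. \<forall>n\<ge>N. prob (E \<epsilon> m n) < \<eta>" if "0 < \<epsilon>" "0 < \<eta>" for \<epsilon> \<eta>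
  proof (rule ccontr)
    assume "\<not> ?thesis"
    then have "\<forall>N. \<exists>m n. N \<le> m \<and> N \<le> n \<and> \<eta> \<le> prob (E \<epsilon> m n)" by (auto simp: not_less)
    then obtain p q where pq: "\<And>N. N \<le> p N" "\<And>N. N \<le> q N" "\<And>N. \<eta> \<le> prob (E \<epsilon> (p N) (q N))"
      by metis
    have "(\<lambda>k. prob (E \<epsilon> (p k) (q k))) \<longlonglongrightarrow> 0"
      unfolding E_def using pq that by (intro cauchy) auto
    from LIMSEQ_le_const[OF this] pq(3) have "\<eta> \<le> 0" by blast
    with that show False by simp
  qed
  have "\<exists>r. \<forall>k. (\<forall>m\<ge>r k. \<forall>n\<ge>r k. prob (E ((1/2)^k) m n) < (1/2)^k) \<and> r k < r (Suc k)"
  proof (rule dependent_nat_choice)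
    show "\<exists>x. \<forall>m\<ge>x. \<forall>n\<ge>x. prob (E ((1/2)^0) m n) < (1/2)^0" using unif[of 1 1] by simp
    fix x k
    obtain N where "\<forall>m\<ge>N. \<forall>n\<ge>N. prob (E ((1/2)^Suc k) m n) < (1/2)^Suc k"
      using unif[of "(1/2)^Suc k" "(1/2)^Suc k"] by auto
    then show "\<exists>y. (\<forall>m\<ge>y. \<forall>n\<ge>y. prob (E ((1/2)^Suc k) m n) < (1/2)^Suc k) \<and> x < y"
      by (intro exI[of _ "max N (Suc x)"]) auto
  qed
  then obtain r where r: "\<And>k m n. r k \<le> m \<Longrightarrow> r k \<le> n \<Longrightarrow> prob (E ((1/2)^k) m n) < (1/2)^k" "\<And>k. r k < r (Suc k)"
    by blast
  have mono: "strict_mono r" using r(2) by (simp add: strict_mono_Suc_iff)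
  have small: "prob (E ((1/2)^k) (r (Suc k)) (r k)) \<le> (1/2)^k" for k
    using r(1)[of k "r (Suc k)" "r k"] r(2)[of k] by simp
  have "AE w in M. \<forall>\<^sub>F k in sequentially. w \<in> space M - E ((1/2)^k) (r (Suc k)) (r k)"
  proof (rule borel_cantelli_AE1)
    show "emeasure M (E ((1/2)^k) (r (Suc k)) (r k)) < \<infinity>" for k by (simp add: less_top[symmetric])
    show "summable (\<lambda>k. prob (E ((1/2)^k) (r (Suc k)) (r k)))"
      by (rule summable_comparison_test'[of "\<lambda>k. (1/2)^k"]) (use small in \<open>auto intro: summable_geometric\<close>)
  qed simp
  then have conv: "AE w in M. convergent (\<lambda>k. X (r k) w)"
  proof eventually_elim
    case (elim w)
    then obtain N where N: "\<And>k. N \<le> k \<Longrightarrow> \<bar>X (r (Suc k)) w - X (r k) w\<bar> \<le> (1/2)^k"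
      by (auto simp: eventually_sequentially E_def not_less)
    have "summable (\<lambda>k. X (r (Suc k)) w - X (r k) w)"
      by (rule summable_comparison_test'[of "\<lambda>k. (1/2)^k" N]) (use N in \<open>auto intro: summable_geometric\<close>)
    then have "convergent (\<lambda>n. \<Sum>k<n. X (r (Suc k)) w - X (r k) w)"
      by (simp add: summable_iff_convergent)
    then have "convergent (\<lambda>n. X (r n) w - X (r 0) w)"
      using sum_lessThan_telescope[of "\<lambda>k. X (r k) w"] by simp
    then have "convergent (\<lambda>n. (X (r n) w - X (r 0) w) + X (r 0) w)"
      by (intro convergent_add convergent_const)
    then show ?case by simp
  qed
  define Y where "Y w = lim (\<lambda>k. X (r k) w)" for w
  have [measurable]: "Y \<in> borel_measurable M" unfolding Y_def by measurable
  have lim: "AE w in M. (\<lambda>k. X (r k) w) \<longlonglongrightarrow> Y w"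
    using conv by eventually_elim (simp add: Y_def convergent_LIMSEQ_iff)
  have "(\<lambda>n. prob {w \<in> space M. \<epsilon> < \<bar>X n w - Y w\<bar>}) \<longlonglongrightarrow> 0" if \<epsilon>: "0 < \<epsilon>" for \<epsilon>
  proof -
    have "(\<lambda>k. prob {w \<in> space M. \<epsilon> / 2 < \<bar>X k w - X (r k) w\<bar>}) \<longlonglongrightarrow> 0"
      using seq_suble[OF mono] \<epsilon> by (intro cauchy) auto
    moreover have "(\<lambda>k. prob {w \<in> space M. \<epsilon> / 2 < \<bar>X (r k) w - Y w\<bar>}) \<longlonglongrightarrow> 0"
      using lim \<epsilon> by (intro AE_tendsto_imp_prob_tendsto) auto
    ultimately have lim: "(\<lambda>k. prob {w \<in> space M. \<epsilon> / 2 < \<bar>X k w - X (r k) w\<bar>} +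
        prob {w \<in> space M. \<epsilon> / 2 < \<bar>X (r k) w - Y w\<bar>}) \<longlonglongrightarrow> 0"
      using tendsto_add by fastforce
    have "prob {w \<in> space M. \<epsilon> < \<bar>X k w - Y w\<bar>} \<le>
        prob {w \<in> space M. \<epsilon> / 2 < \<bar>X k w - X (r k) w\<bar>} + prob {w \<in> space M. \<epsilon> / 2 < \<bar>X (r k) w - Y w\<bar>}" for k
      using prob_abs_sum_le[of "\<lambda>w. X k w - X (r k) w" "\<lambda>w. X (r k) w - Y w" \<epsilon>] by simp
    then show ?thesis
      by (intro tendsto_sandwich[OF _ _ tendsto_const lim]) auto
  qed
  then show ?thesis by (intro exI[of _ Y]) (auto simp: converges_in_prob_def)
qed

lemma converges_in_prob_diff:
  assumes [measurable]: "\<And>n. X n \<in> borel_measurable M" "\<And>n. X' n \<in> borel_measurable M"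
    and conv: "converges_in_prob M X Y" "converges_in_prob M X' Y'"
  shows "converges_in_prob M (\<lambda>n w. X n w - X' n w) (\<lambda>w. Y w - Y' w)"
proof -
  have [measurable]: "Y \<in> borel_measurable M" "Y' \<in> borel_measurable M" using conv by (auto simp: converges_in_prob_def)
  have "(\<lambda>n. prob {w \<in> space M. \<epsilon> < \<bar>(X n w - X' n w) - (Y w - Y' w)\<bar>}) \<longlonglongrightarrow> 0" if \<epsilon>: "0 < \<epsilon>" for \<epsilon>
  proof -
    have "(\<lambda>k. prob {w \<in> space M. \<epsilon> / 2 < \<bar>X k w - Y w\<bar>} + prob {w \<in> space M. \<epsilon> / 2 < \<bar>X' k w - Y' w\<bar>}) \<longlonglongrightarrow> 0 + 0"
      using conv half_gt_zero[OF \<epsilon>] unfolding converges_in_prob_def by (intro tendsto_add) blast+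
    then have lim: "(\<lambda>k. prob {w \<in> space M. \<epsilon> / 2 < \<bar>X k w - Y w\<bar>} + prob {w \<in> space M. \<epsilon> / 2 < \<bar>X' k w - Y' w\<bar>}) \<longlonglongrightarrow> 0"
      by simp
    have "\<bar>(X k w - X' k w) - (Y w - Y' w)\<bar> = \<bar>(X k w - Y w) + (Y' w - X' k w)\<bar>" for k w by simp
    then have "prob {w \<in> space M. \<epsilon> < \<bar>(X k w - X' k w) - (Y w - Y' w)\<bar>} \<le>
        prob {w \<in> space M. \<epsilon> / 2 < \<bar>X k w - Y w\<bar>} + prob {w \<in> space M. \<epsilon> / 2 < \<bar>X' k w - Y' w\<bar>}" for k
      using prob_abs_sum_le[of "\<lambda>w. X k w - Y w" "\<lambda>w. Y' w - X' k w" \<epsilon>]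
      by (simp add: abs_minus_commute[of "Y' _"])
    then show ?thesis
      by (intro tendsto_sandwich[OF _ _ tendsto_const lim]) auto
  qed
  then show ?thesis by (auto simp: converges_in_prob_def)
qed

end

section \<open>A gliding hump argument\<close>

lemma (in finite_measure) set_integral_norm_diff_le:
  fixes f :: "'a \<Rightarrow> complex"
  assumes f: "integrable M f" and A: "A \<in> sets M"
  shows "cmod ((\<integral>s. indicator A s *\<^sub>R f s \<partial>M) - integral\<^sup>L M f) \<le> (\<integral>s. indicator (- A) s * cmod (f s) \<partial>M)"
proof -
  have i: "integrable M (\<lambda>s. indicator A s *\<^sub>R f s)" using A f by (rule integrable_mult_indicator)
  have "(\<integral>s. indicator A s *\<^sub>R f s \<partial>M) - integral\<^sup>L M f = (\<integral>s. indicator A s *\<^sub>R f s - f s \<partial>M)"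
    using i f by simp
  also have "cmod \<dots> \<le> (\<integral>s. cmod (indicator A s *\<^sub>R f s - f s) \<partial>M)"
    by (rule integral_norm_bound)
  also have "\<dots> = (\<integral>s. indicator (- A) s * cmod (f s) \<partial>M)"
    by (intro Bochner_Integration.integral_cong refl) (auto simp: indicator_def)
  finally show ?thesis .
qed

text \<open>
  Where \<open>\<bar>k\<^sub>n\<bar> \<le> 1\<close> dominated convergence applies, so all that \<open>k\<^sub>n\<close> contributes in the limit sits on the
  set \<open>E\<^sub>n\<close> where \<open>\<bar>k\<^sub>n\<bar> > 1\<close>, whose measure tends to \<open>0\<close>.  Along a sufficiently sparse subsequence these
  sets may be made disjoint, up to negligible parts.  On the union \<open>A\<close> of every other one of them the
  integrals of \<open>k\<^sub>n\<close> are alternately close to the full integral and close to \<open>0\<close>; as \<open>exp \<integral>\<^sub>A k\<^sub>n\<close>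
  converges, its limit is \<open>1\<close>, and so is that of \<open>exp \<integral> k\<^sub>n\<close>.  The exponential prevents a direct appeal
  to the Vitali-Hahn-Saks theorem, because it does not determine the integrals.
\<close>

theorem (in finite_measure) gliding_hump:
  fixes k :: "nat \<Rightarrow> 'a \<Rightarrow> complex"
  assumes k: "\<And>n. integrable M (k n)" and lim: "AE s in M. (\<lambda>n. k n s) \<longlonglongrightarrow> 0"
    and conv: "\<And>A. A \<in> sets M \<Longrightarrow> convergent (\<lambda>n. exp (\<integral>s. indicator A s *\<^sub>R k n s \<partial>M))"
  shows "(\<lambda>n. exp (\<integral>s. k n s \<partial>M)) \<longlonglongrightarrow> 1"
proof -
  note [measurable] = borel_measurable_integrable[OF k]
  define E where "E n = {s \<in> space M. 1 < cmod (k n s)}" for n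
  have E[measurable]: "E n \<in> sets M" for n unfolding E_def by measurable
  have ev: "AE s in M. \<forall>\<^sub>F n in sequentially. s \<notin> E n"
    using lim
  proof eventually_elim
    case (elim s)
    show ?case using tendstoD[OF elim zero_less_one] by eventually_elim (auto simp: E_def)
  qed
  have measE: "(\<lambda>n. measure M (E n)) \<longlonglongrightarrow> 0"
  proof -
    have "(\<lambda>n. \<integral>s. indicator (E n) s \<partial>M) \<longlonglongrightarrow> (\<integral>s. 0 \<partial>M :: real)"
    proof (rule integral_dominated_convergence[where w = "\<lambda>_. 1"])
      show "AE s in M. (\<lambda>n. indicator (E n) s :: real) \<longlonglongrightarrow> 0"
        using ev by eventually_elim (rule tendsto_eventually, auto elim: eventually_mono)
    qed (auto simp: indicator_def)
    then show ?thesis by simp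
  qed
  have outE: "(\<lambda>n. \<integral>s. indicator (- E n) s * cmod (k n s) \<partial>M) \<longlonglongrightarrow> 0"
  proof -
    have "(\<lambda>n. \<integral>s. indicator (- E n) s * cmod (k n s) \<partial>M) \<longlonglongrightarrow> (\<integral>s. 0 \<partial>M)"
    proof (rule integral_dominated_convergence[where w = "\<lambda>_. 1"])
      show "AE s in M. (\<lambda>n. indicator (- E n) s * cmod (k n s)) \<longlonglongrightarrow> 0"
        using lim
      proof eventually_elim
        case (elim s)
        show ?case
          by (rule tendsto_sandwich[OF _ _ tendsto_const tendsto_norm_zero[OF elim]]) (auto simp: indicator_def)
      qed
      show "AE s in M. norm (indicator (- E n) s * cmod (k n s)) \<le> 1" for n
        by (intro AE_I2) (auto simp: E_def indicator_def)
    qed (auto simp: indicator_def)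
    then show ?thesis by simp
  qed
  \<comment> \<open>First subsequence: the measures of the exceptional sets become summable, so that their tails
    \<open>G m\<close> decrease to a null set.\<close>
  have "\<exists>r. \<forall>i. measure M (E (r i)) \<le> (1/2)^i \<and> r i < r (Suc i)"
  proof (rule dependent_nat_choice)
    have *: "\<exists>y. measure M (E y) \<le> (1/2)^i \<and> x < y" for x i
    proof -
      have "\<forall>\<^sub>F n in sequentially. measure M (E n) < (1/2)^i"
        by (rule order_tendstoD(2)[OF measE]) simp
      then have "\<forall>\<^sub>F n in sequentially. measure M (E n) < (1/2)^i \<and> x < n"
        using eventually_gt_at_top[of x] by (rule eventually_conj)
      then show ?thesis by (auto simp: eventually_sequentially intro: less_imp_le)
    qed
    show "\<exists>x. measure M (E x) \<le> (1/2)^0" using *[of 0] by blast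
    show "\<exists>y. measure M (E y) \<le> (1/2)^Suc i \<and> x < y" for x i by (rule *)
  qed
  then obtain r where r: "\<And>i. measure M (E (r i)) \<le> (1/2)^i" "\<And>i. r i < r (Suc i)" by blast
  have r_mono: "strict_mono r" using r(2) by (simp add: strict_mono_Suc_iff)
  define G where "G m = (\<Union>l\<in>{m..}. E (r l))" for m
  have G[measurable]: "G m \<in> sets M" for m unfolding G_def by measurable
  have G_anti: "G n \<subseteq> G m" if "m \<le> n" for m n using that unfolding G_def by (intro UN_mono) auto
  have "AE s in M. \<forall>\<^sub>F i in sequentially. s \<in> space M - E (r i)"
  proof (rule borel_cantelli_AE1)
    show "summable (\<lambda>i. measure M (E (r i)))"
      by (rule summable_comparison_test'[of "\<lambda>i. (1/2)^i"]) (use r(1) in \<open>auto intro: summable_geometric\<close>)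
  qed (auto simp: less_top[symmetric])
  then have evG: "AE s in M. \<forall>\<^sub>F m in sequentially. s \<notin> G m"
  proof eventually_elim
    case (elim s)
    then obtain N where "\<And>i. N \<le> i \<Longrightarrow> s \<notin> E (r i)" by (auto simp: eventually_sequentially)
    then show ?case by (auto simp: eventually_sequentially G_def intro!: exI[of _ N])
  qed
  have tailG: "(\<lambda>m. \<integral>s. indicator (G m) s * cmod (k n s) \<partial>M) \<longlonglongrightarrow> 0" for n
  proof -
    have "(\<lambda>m. \<integral>s. indicator (G m) s * cmod (k n s) \<partial>M) \<longlonglongrightarrow> (\<integral>s. 0 \<partial>M)"
    proof (rule integral_dominated_convergence[where w = "\<lambda>s. cmod (k n s)"])
      show "AE s in M. (\<lambda>m. indicator (G m) s * cmod (k n s)) \<longlonglongrightarrow> 0"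
        using evG by eventually_elim (rule tendsto_eventually, auto elim: eventually_mono)
    qed (use k in \<open>auto simp: indicator_def\<close>)
    then show ?thesis by simp
  qed
  \<comment> \<open>Second subsequence: each tail is negligible for the function chosen just before.\<close>
  have "\<exists>q. \<forall>j. True \<and> (q j < q (Suc j) \<and> (\<integral>s. indicator (G (q (Suc j))) s * cmod (k (r (q j)) s) \<partial>M) \<le> (1/2)^j)"
  proof (rule dependent_nat_choice)
    fix x j :: nat
    have "\<forall>\<^sub>F m in sequentially. (\<integral>s. indicator (G m) s * cmod (k (r x) s) \<partial>M) < (1/2)^j"
      by (rule order_tendstoD(2)[OF tailG]) simp
    then have "\<forall>\<^sub>F m in sequentially. (\<integral>s. indicator (G m) s * cmod (k (r x) s) \<partial>M) < (1/2)^j \<and> x < m"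
      using eventually_gt_at_top[of x] by (rule eventually_conj)
    then show "\<exists>y. True \<and> x < y \<and> (\<integral>s. indicator (G y) s * cmod (k (r x) s) \<partial>M) \<le> (1/2)^j"
      by (auto simp: eventually_sequentially intro: less_imp_le)
  qed simp
  then obtain q where q: "\<And>j. q j < q (Suc j)"
      "\<And>j. (\<integral>s. indicator (G (q (Suc j))) s * cmod (k (r (q j)) s) \<partial>M) \<le> (1/2)^j" by blast
  have q_mono: "strict_mono q" using q(1) by (simp add: strict_mono_Suc_iff)
  define p where "p j = r (q j)" for j
  have p_mono: "strict_mono p" unfolding p_def using strict_mono_o[OF r_mono q_mono] by (simp add: comp_def)
  \<comment> \<open>Cutting off the later exceptional sets makes the humps disjoint.\<close>
  define D where "D j = E (p j) - G (q (Suc j))" for j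
  have D[measurable]: "D j \<in> sets M" for j unfolding D_def by measurable
  have D_disj: "D i \<inter> D j = {}" if "i < j" for i j
  proof -
    have "q (Suc i) \<le> q j" using that strict_mono_less_eq[OF q_mono] by (simp add: Suc_le_eq)
    moreover have "E (p j) \<subseteq> G (q j)" by (auto simp: G_def p_def)
    ultimately have "E (p j) \<subseteq> G (q (Suc i))" using G_anti by blast
    then show ?thesis by (auto simp: D_def)
  qed
  have ki[intro]: "integrable M (\<lambda>s. indicator A s * cmod (k n s))" if "A \<in> sets M" for A n
    using integrable_mult_indicator[OF that integrable_norm[OF k[of n]]] by simp
  have kc[intro]: "integrable M (\<lambda>s. indicator (- A) s * cmod (k n s))" if "A \<in> sets M" for A n
  proof -
    have "integrable M (\<lambda>s. indicator (space M - A) s * cmod (k n s))" using that by (intro ki) auto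
    then show ?thesis by (subst Bochner_Integration.integrable_cong[OF refl]) (auto simp: indicator_def)
  qed
  define c where "c j = (\<integral>s. indicator (- D j) s * cmod (k (p j) s) \<partial>M)" for j
  have c_lim: "c \<longlonglongrightarrow> 0"
  proof (rule tendsto_sandwich[OF _ _ tendsto_const])
    show "(\<lambda>j. (\<integral>s. indicator (- E (p j)) s * cmod (k (p j) s) \<partial>M) + (1/2)^j) \<longlonglongrightarrow> 0"
      using tendsto_add[OF LIMSEQ_subseq_LIMSEQ[OF outE p_mono] LIMSEQ_power_zero[of "1/2 :: real"]]
      by (simp add: comp_def)
    have "c j \<le> (\<integral>s. indicator (- E (p j)) s * cmod (k (p j) s) + indicator (G (q (Suc j))) s * cmod (k (p j) s) \<partial>M)" for j
      unfolding c_def by (intro integral_mono Bochner_Integration.integrable_add kc ki D E G) (auto simp: D_def indicator_def)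
    also have "\<dots> j \<le> (\<integral>s. indicator (- E (p j)) s * cmod (k (p j) s) \<partial>M) + (1/2)^j" for j
      using q(2)[of j] E G by (subst Bochner_Integration.integral_add) (auto simp: p_def)
    finally show "\<forall>\<^sub>F j in sequentially. c j \<le> (\<integral>s. indicator (- E (p j)) s * cmod (k (p j) s) \<partial>M) + (1/2)^j"
      by simp
  qed (auto simp: c_def intro!: always_eventually Bochner_Integration.integral_nonneg)
  \<comment> \<open>On \<open>A\<close> the even humps are complete and the odd ones are absent.\<close>
  define A where "A = (\<Union>i. D (2 * i))"
  have A[measurable]: "A \<in> sets M" unfolding A_def by measurable
  define \<kappa> where "\<kappa> n = (\<integral>s. indicator A s *\<^sub>R k n s \<partial>M)" for n
  have even: "cmod (\<kappa> (p (2 * i)) - (\<integral>s. k (p (2 * i)) s \<partial>M)) \<le> c (2 * i)" for i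
  proof -
    have "cmod (\<kappa> (p (2 * i)) - (\<integral>s. k (p (2 * i)) s \<partial>M)) \<le> (\<integral>s. indicator (- A) s * cmod (k (p (2 * i)) s) \<partial>M)"
      unfolding \<kappa>_def by (rule set_integral_norm_diff_le[OF k A])
    also have "\<dots> \<le> c (2 * i)"
      unfolding c_def by (intro integral_mono kc A D) (auto simp: A_def indicator_def)
    finally show ?thesis .
  qed
  have odd: "cmod (\<kappa> (p (2 * i + 1))) \<le> c (2 * i + 1)" for i
  proof -
    have "D (2 * i + 1) \<inter> D (2 * j) = {}" for j
      using D_disj[of "2 * i + 1" "2 * j"] D_disj[of "2 * j" "2 * i + 1"] by (cases "j \<le> i") auto
    then have "D (2 * i + 1) \<inter> A = {}" by (auto simp: A_def)
    have "cmod (\<kappa> (p (2 * i + 1))) \<le> (\<integral>s. cmod (indicator A s *\<^sub>R k (p (2 * i + 1)) s) \<partial>M)"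
      unfolding \<kappa>_def by (rule integral_norm_bound)
    also have "\<dots> \<le> c (2 * i + 1)"
      unfolding c_def using \<open>D (2 * i + 1) \<inter> A = {}\<close>
      by (intro integral_mono kc D integrable_norm integrable_mult_indicator k A) (auto simp: indicator_def)
    finally show ?thesis .
  qed
  have mono2: "strict_mono (\<lambda>i. 2 * i :: nat)" "strict_mono (\<lambda>i. 2 * i + 1 :: nat)" by (auto simp: strict_mono_def)
  have c_even: "(\<lambda>i. c (2 * i)) \<longlonglongrightarrow> 0" and c_odd: "(\<lambda>i. c (2 * i + 1)) \<longlonglongrightarrow> 0"
    using LIMSEQ_subseq_LIMSEQ[OF c_lim mono2(1)] LIMSEQ_subseq_LIMSEQ[OF c_lim mono2(2)] by (simp_all add: comp_def)
  obtain z where z: "(\<lambda>n. exp (\<kappa> n)) \<longlonglongrightarrow> z"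
    using conv[OF A] by (auto simp: convergent_def \<kappa>_def)
  have p2: "strict_mono (\<lambda>i. p (2 * i))" "strict_mono (\<lambda>i. p (2 * i + 1))"
    using strict_mono_o[OF p_mono mono2(1)] strict_mono_o[OF p_mono mono2(2)] by (simp_all add: comp_def)
  have "(\<lambda>i. \<kappa> (p (2 * i + 1))) \<longlonglongrightarrow> 0"
    by (rule Lim_null_comparison[OF _ c_odd]) (use odd in auto)
  from tendsto_exp[OF this] have "(\<lambda>i. exp (\<kappa> (p (2 * i + 1)))) \<longlonglongrightarrow> 1" by simp
  moreover have "(\<lambda>i. exp (\<kappa> (p (2 * i + 1)))) \<longlonglongrightarrow> z"
    using LIMSEQ_subseq_LIMSEQ[OF z p2(2)] by (simp add: comp_def)
  ultimately have "z = 1" by (metis LIMSEQ_unique)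
  have "(\<lambda>i. (\<integral>s. k (p (2 * i)) s \<partial>M) - \<kappa> (p (2 * i))) \<longlonglongrightarrow> 0"
    by (rule Lim_null_comparison[OF _ c_even]) (use even in \<open>auto simp: norm_minus_commute\<close>)
  from tendsto_mult[OF LIMSEQ_subseq_LIMSEQ[OF z p2(1)] tendsto_exp[OF this]]
  have "(\<lambda>i. exp (\<integral>s. k (p (2 * i)) s \<partial>M)) \<longlonglongrightarrow> 1"
    by (simp add: comp_def \<open>z = 1\<close> flip: exp_add)
  moreover obtain y where y: "(\<lambda>n. exp (\<integral>s. k n s \<partial>M)) \<longlonglongrightarrow> y"
  proof -
    have "(\<integral>s. indicator (space M) s *\<^sub>R k n s \<partial>M) = (\<integral>s. k n s \<partial>M)" for n
      by (intro Bochner_Integration.integral_cong) auto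
    then show ?thesis using conv[OF sets.top] that by (auto simp: convergent_def)
  qed
  moreover have "(\<lambda>i. exp (\<integral>s. k (p (2 * i)) s \<partial>M)) \<longlonglongrightarrow> y"
    using LIMSEQ_subseq_LIMSEQ[OF y p2(1)] by (simp add: comp_def)
  ultimately show ?thesis by (metis LIMSEQ_unique)
qed

section \<open>Existence, uniqueness and law of the integral\<close>

context qid_setting
begin

text \<open>
  The difference of two approximating sequences tends to \<open>0\<close> almost everywhere and its integrals
  converge in probability over every set; by \<open>gliding_hump\<close> the limit over the whole space has the
  characteristic function \<open>1\<close>, so it is \<open>0\<close>.
\<close>

lemma \<Lambda>_approx_seq_limit_unique:
  assumes g: "\<Lambda>_approx_seq P M \<Lambda> lam g f" and h: "\<Lambda>_approx_seq P M \<Lambda> lam h f"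
    and X: "converges_in_prob P (\<lambda>n. simple_\<Lambda>_integral M \<Lambda> (g n) (space M)) X"
    and Y: "converges_in_prob P (\<lambda>n. simple_\<Lambda>_integral M \<Lambda> (h n) (space M)) Y"
  shows "distr P borel X = distr P borel Y"
proof -
  have s: "simple_function M (g n)" "simple_function M (h n)" for n
    using g h by (auto simp: \<Lambda>_approx_seq_def)
  have gm: "g n \<in> borel_measurable lam" "h n \<in> borel_measurable lam" for n
    using s[of n] by (auto simp: measurable_lam_iff intro: borel_measurable_simple_function)
  have "char (distr P borel (\<lambda>w. X w - Y w)) \<theta> = 1" for \<theta>
  proof -
    define k where "k n s = K (\<theta> * (g n s - h n s)) s" for n s
    have kA: "indicator A s *\<^sub>R k n s = K (\<theta> * ((g n s - h n s) * indicator A s)) s" for n s A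
      by (simp add: k_def indicator_def)
    have chk: "(\<lambda>n. exp (\<integral>s. indicator A s *\<^sub>R k n s \<partial>lam)) \<longlonglongrightarrow> char (distr P borel (\<lambda>w. Z w - Z' w)) \<theta>"
      if A: "A \<in> sets M" and Z: "converges_in_prob P (\<lambda>n. simple_\<Lambda>_integral M \<Lambda> (g n) A) Z"
        "converges_in_prob P (\<lambda>n. simple_\<Lambda>_integral M \<Lambda> (h n) A) Z'" for A Z Z'
      using char_tendsto[OF simple_\<Lambda>_integral_diff_measurable[OF s A] converges_in_prob_diff[OF _ _ Z], of \<theta>]
        simple_\<Lambda>_integral_measurable[OF s(1) A] simple_\<Lambda>_integral_measurable[OF s(2) A]
      unfolding kA char_simple_\<Lambda>_integral_diff[OF s A] by simp
    have "(\<lambda>n. exp (\<integral>s. k n s \<partial>lam)) \<longlonglongrightarrow> 1"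
    proof (rule finite_measure.gliding_hump[OF finite_lam])
      fix n
      have "finite ((\<lambda>s. \<theta> * (g n s - h n s)) ` space M)"
        by (rule simple_functionD(1)[of M]) (intro simple_function_mult simple_function_diff s simple_function_const)
      then obtain c where c: "\<And>s. s \<in> space M \<Longrightarrow> \<bar>\<theta> * (g n s - h n s)\<bar> \<le> c"
        by (metis (no_types, lifting) finite_imp_bounded bounded_real imageI)
      show "integrable lam (k n)"
        unfolding k_def
      proof (rule K_integrable[OF \<Phi>_one_integrable, of _ "\<bar>c\<bar>"])
        show "\<bar>\<theta> * (g n s - h n s)\<bar> \<le> \<bar>c\<bar> * \<bar>1\<bar>" if "s \<in> space lam" for s
          using c[of s] that by (simp add: space_lam)
      qed (use gm in auto)
    next
      have "AE s in lam. (\<lambda>n. g n s) \<longlonglongrightarrow> f s" "AE s in lam. (\<lambda>n. h n s) \<longlonglongrightarrow> f s" "AE s in lam. s \<in> space lam"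
        using g h by (auto simp: \<Lambda>_approx_seq_def)
      then show "AE s in lam. (\<lambda>n. k n s) \<longlonglongrightarrow> 0"
      proof eventually_elim
        case (elim s)
        have "(\<lambda>n. \<theta> * (g n s - h n s)) \<longlonglongrightarrow> \<theta> * (f s - f s)" using elim by (intro tendsto_intros)
        from K_continuous[OF elim(3) this] show ?case by (simp add: k_def)
      qed
    next
      fix A assume "A \<in> sets lam"
      then have A: "A \<in> sets M" by (simp add: sets_lam)
      then show "convergent (\<lambda>n. exp (\<integral>s. indicator A s *\<^sub>R k n s \<partial>lam))"
        using g h chk[OF A] unfolding \<Lambda>_approx_seq_def convergent_def by blast
    qed
    moreover have "(\<lambda>n. exp (\<integral>s. k n s \<partial>lam)) \<longlonglongrightarrow> char (distr P borel (\<lambda>w. X w - Y w)) \<theta>"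
    proof -
      have "(\<integral>s. indicator (space M) s *\<^sub>R k n s \<partial>lam) = (\<integral>s. k n s \<partial>lam)" for n
        by (intro Bochner_Integration.integral_cong) (auto simp: space_lam)
      then show ?thesis using chk[OF sets.top X Y] by simp
    qed
    ultimately show ?thesis by (metis LIMSEQ_unique)
  qed
  moreover have XY[measurable]: "X \<in> borel_measurable P" "Y \<in> borel_measurable P"
    using X Y by (auto simp: converges_in_prob_def)
  ultimately have "(\<lambda>n::nat. prob {w \<in> space P. \<epsilon> < \<bar>X w - Y w\<bar>}) \<longlonglongrightarrow> 0" if "0 < \<epsilon>" for \<epsilon>
    using prob_tendsto_zero_of_char[of "\<lambda>_ w. X w - Y w", OF _ _ that] by simp
  then have "prob {w \<in> space P. \<epsilon> < \<bar>X w - Y w\<bar>} = 0" if "0 < \<epsilon>" for \<epsilon>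
    using that by (simp add: LIMSEQ_const_iff)
  then have "AE w in P. \<not> 1 / real (Suc n) < \<bar>X w - Y w\<bar>" for n
    by (subst AE_iff_measurable[OF _ refl]) (auto simp: emeasure_eq_measure)
  then have "AE w in P. \<forall>n. \<not> 1 / real (Suc n) < \<bar>X w - Y w\<bar>"
    by (simp add: AE_all_countable)
  then have "AE w in P. X w = Y w"
  proof eventually_elim
    case (elim w)
    then show ?case using reals_Archimedean[of "\<bar>X w - Y w\<bar>"] by (auto simp: inverse_eq_divide)
  qed
  then show ?thesis by (intro distr_cong_AE) auto
qed

text \<open>
  This makes condition (ii), in which negative values of the integrand are cut off at \<open>0\<close>, a statement
  about the integral of \<open>\<bar>f\<bar>\<^sup>2 \<sigma>\<^sup>2\<close> itself.
\<close>

lemma sig2_AE_nonneg: "AE s in lam. 0 \<le> sig2 s"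
proof -
  define B where "B = {s \<in> space lam. sig2 s < 0}"
  have B[measurable]: "B \<in> sets lam" unfolding B_def by measurable
  have i: "integrable lam (\<lambda>s. indicator B s * sig2 s)"
    using integrable_real_mult_indicator[OF B sig2_integrable] by (simp add: mult.commute)
  have "measure \<nu>1 B = (\<integral>s. indicator B s * sig2 s \<partial>lam)"
    using deriv_sig2 B by (simp add: signed_RN_deriv_def set_lebesgue_integral_def)
  then have "(\<integral>s. - (indicator B s * sig2 s) \<partial>lam) \<le> 0" using measure_nonneg[of \<nu>1 B] by simp
  moreover have nn: "0 \<le> - (indicator B s * sig2 s)" for s by (auto simp: B_def indicator_def)
  then have "0 \<le> (\<integral>s. - (indicator B s * sig2 s) \<partial>lam)" by (rule Bochner_Integration.integral_nonneg)
  ultimately have "(\<integral>s. - (indicator B s * sig2 s) \<partial>lam) = 0" by simp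
  then have "AE s in lam. - (indicator B s * sig2 s) = 0"
    using integral_nonneg_eq_0_iff_AE[of lam "\<lambda>s. - (indicator B s * sig2 s)"] i nn by simp
  with AE_space[of lam] show ?thesis
    by eventually_elim (auto simp: B_def indicator_def split: if_splits)
qed

lemma \<Phi>_integrable:
  assumes f: "f \<in> borel_measurable M"
    and i: "(\<integral>\<^sup>+s. ennreal \<bar>U (f s) s\<bar> \<partial>lam) < \<infinity>"
    and ii: "(\<integral>\<^sup>+s. ennreal (\<bar>f s\<bar>\<^sup>2 * sig2 s) \<partial>lam) < \<infinity>"
    and iii: "(\<integral>\<^sup>+s. jump_V0 \<rho> (f s) s \<partial>lam) < \<infinity>"
  shows "integrable lam (\<lambda>s. U (f s) s)" "integrable lam (\<lambda>s. \<bar>f s\<bar>\<^sup>2 * sig2 s)" "integrable lam (\<lambda>s. \<Phi> (f s) s)"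
proof -
  have f'[measurable]: "f \<in> borel_measurable lam" using f by (simp add: measurable_lam_iff)
  show U: "integrable lam (\<lambda>s. U (f s) s)"
    using i U_measurable[OF f'] by (intro integrableI_bounded) auto
  note pos = sig2_AE_nonneg
  show S: "integrable lam (\<lambda>s. \<bar>f s\<bar>\<^sup>2 * sig2 s)"
    using ii pos by (intro integrableI_nonneg) (auto elim: eventually_mono)
  have "integrable lam (\<lambda>s. V (f s) s)"
    using iii V_measurable[OF f'] by (intro integrableI_nonneg) (auto simp: jump_V0_eq_V cong: nn_integral_cong)
  moreover have "integrable lam (\<lambda>s. (f s)\<^sup>2 * \<bar>sig2 s\<bar>)"
    using integrable_norm[OF S] by (simp add: abs_mult)
  ultimately show "integrable lam (\<lambda>s. \<Phi> (f s) s)"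
    unfolding \<Phi>_def using U by simp
qed

text \<open>
  The sequence is chosen with \<open>\<bar>g\<^sub>n\<bar> \<le> 2\<bar>f\<bar>\<close>, so that \<open>K_integral_continuous\<close> applies to \<open>\<theta>g\<^sub>n\<close> with the
  constant \<open>2\<bar>\<theta>\<bar>\<close> and to \<open>\<theta>(g\<^sub>p - g\<^sub>q)\<close> with the constant \<open>4\<bar>\<theta>\<bar>\<close>.
\<close>

theorem exists_\<Lambda>_approx_seq:
  assumes f [measurable]: "f \<in> borel_measurable M" and \<Phi>: "integrable lam (\<lambda>s. \<Phi> (f s) s)"
  obtains g where "\<Lambda>_approx_seq P M \<Lambda> lam g f"
    "\<And>X \<theta>. converges_in_prob P (\<lambda>n. simple_\<Lambda>_integral M \<Lambda> (g n) (space M)) X \<Longrightarrow>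
      char (distr P borel X) \<theta> = exp (\<integral>s. K (\<theta> * f s) s \<partial>lam)"
proof -
  have fL[measurable]: "f \<in> borel_measurable lam" using f by (simp add: measurable_lam_iff)
  obtain g where g: "\<And>n. simple_function M (g n)" "\<And>s. s \<in> space M \<Longrightarrow> (\<lambda>n. g n s) \<longlonglongrightarrow> f s"
    and le: "\<And>n s. s \<in> space M \<Longrightarrow> \<bar>g n s\<bar> \<le> 2 * \<bar>f s\<bar>"
    using borel_measurable_implies_sequence_metric[OF f, of 0] unfolding dist_real_def diff_0_right by metis
  have gL[measurable]: "g n \<in> borel_measurable lam" for n
    using g(1)[of n] by (auto simp: measurable_lam_iff intro: borel_measurable_simple_function)
  note m = simple_\<Lambda>_integral_measurable[OF g(1)]
  have "\<exists>X. converges_in_prob P (\<lambda>n. simple_\<Lambda>_integral M \<Lambda> (g n) A) X" if A: "A \<in> sets M" for A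
  proof (rule Cauchy_in_prob_converges[OF m[OF A]])
    have A'[measurable]: "A \<in> sets lam" using A by (simp add: sets_lam)
    fix p q :: "nat \<Rightarrow> nat" and \<epsilon> :: real
    assume pq: "\<And>k. k \<le> p k" "\<And>k. k \<le> q k" and \<epsilon>: "0 < \<epsilon>"
    have top: "filterlim p at_top sequentially" "filterlim q at_top sequentially"
      using filterlim_at_top_mono[OF filterlim_ident] pq by (auto intro!: filterlim_at_top_mono[OF filterlim_ident] always_eventually)
    show "(\<lambda>k. prob {w \<in> space P. \<epsilon> < \<bar>simple_\<Lambda>_integral M \<Lambda> (g (p k)) A w - simple_\<Lambda>_integral M \<Lambda> (g (q k)) A w\<bar>}) \<longlonglongrightarrow> 0"
    proof (rule prob_tendsto_zero_of_char[OF simple_\<Lambda>_integral_diff_measurable[OF g(1) g(1) A] _ \<epsilon>])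
      fix \<theta>
      have "(\<lambda>k. \<integral>s. K (\<theta> * ((g (p k) s - g (q k) s) * indicator A s)) s \<partial>lam) \<longlonglongrightarrow> (\<integral>s. K 0 s \<partial>lam)"
      proof (rule K_integral_continuous[OF \<Phi>, where c = "4 * \<bar>\<theta>\<bar>"])
        fix k s assume "s \<in> space lam"
        then have s: "s \<in> space M" by (simp add: space_lam)
        have "\<bar>(g (p k) s - g (q k) s) * indicator A s\<bar> \<le> 4 * \<bar>f s\<bar>"
          using le[OF s, of "p k"] le[OF s, of "q k"] by (auto simp: indicator_def)
        from mult_left_mono[OF this, of "\<bar>\<theta>\<bar>"]
        show "\<bar>\<theta> * ((g (p k) s - g (q k) s) * indicator A s)\<bar> \<le> 4 * \<bar>\<theta>\<bar> * \<bar>f s\<bar>"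
          by (simp add: abs_mult[of \<theta>] mult.left_commute)
      next
        fix s assume "s \<in> space lam"
        then have s: "s \<in> space M" by (simp add: space_lam)
        have "(\<lambda>k. \<theta> * ((g (p k) s - g (q k) s) * indicator A s)) \<longlonglongrightarrow> \<theta> * ((f s - f s) * indicator A s)"
          by (intro tendsto_intros filterlim_compose[OF g(2)[OF s]] top)
        then show "(\<lambda>k. \<theta> * ((g (p k) s - g (q k) s) * indicator A s)) \<longlonglongrightarrow> 0" by simp
      qed (simp_all, measurable)
      from tendsto_exp[OF this]
      show "(\<lambda>k. char (distr P borel (\<lambda>w. simple_\<Lambda>_integral M \<Lambda> (g (p k)) A w - simple_\<Lambda>_integral M \<Lambda> (g (q k)) A w)) \<theta>) \<longlonglongrightarrow> 1"
        by (simp add: char_simple_\<Lambda>_integral_diff[OF g(1) g(1) A])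
    qed
  qed
  then have seq: "\<Lambda>_approx_seq P M \<Lambda> lam g f"
    using g by (auto simp: \<Lambda>_approx_seq_def space_lam intro!: AE_I2)
  show thesis
  proof (rule that[OF seq])
    fix X \<theta> assume X: "converges_in_prob P (\<lambda>n. simple_\<Lambda>_integral M \<Lambda> (g n) (space M)) X"
    have "(\<lambda>n. \<integral>s. K (\<theta> * (g n s * indicator (space M) s)) s \<partial>lam) \<longlonglongrightarrow> (\<integral>s. K (\<theta> * f s) s \<partial>lam)"
    proof (rule K_integral_continuous[OF \<Phi>, where c = "2 * \<bar>\<theta>\<bar>"])
      fix n s assume "s \<in> space lam"
      then have s: "s \<in> space M" by (simp add: space_lam)
      show "\<bar>\<theta> * (g n s * indicator (space M) s)\<bar> \<le> 2 * \<bar>\<theta>\<bar> * \<bar>f s\<bar>"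
        using mult_left_mono[OF le[OF s, of n], of "\<bar>\<theta>\<bar>"] s by (simp add: abs_mult mult.left_commute)
    next
      fix s assume "s \<in> space lam"
      then have s: "s \<in> space M" by (simp add: space_lam)
      show "(\<lambda>n. \<theta> * (g n s * indicator (space M) s)) \<longlonglongrightarrow> \<theta> * f s"
        using tendsto_mult_left[OF g(2)[OF s], of \<theta>] s by simp
    qed (simp_all add: space_lam[symmetric])
    from tendsto_exp[OF this]
    have 1: "(\<lambda>n. char (distr P borel (simple_\<Lambda>_integral M \<Lambda> (g n) (space M))) \<theta>) \<longlonglongrightarrow> exp (\<integral>s. K (\<theta> * f s) s \<partial>lam)"
      by (simp add: char_simple_\<Lambda>_integral[OF g(1) sets.top])
    have 2: "(\<lambda>n. char (distr P borel (simple_\<Lambda>_integral M \<Lambda> (g n) (space M))) \<theta>) \<longlonglongrightarrow> char (distr P borel X) \<theta>"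
      using m[OF sets.top] X by (intro char_tendsto)
    show "char (distr P borel X) \<theta> = exp (\<integral>s. K (\<theta> * f s) s \<partial>lam)"
      by (rule LIMSEQ_unique[OF 2 1])
  qed
qed

end

theorem theorem5p28:
  fixes P :: "'w measure" and M :: "'s measure" and \<Lambda> :: "'s set \<Rightarrow> 'w \<Rightarrow> real"
    and \<nu>0 :: "'s set \<Rightarrow> real" and \<nu>1 :: "'s measure" and F :: "'s set \<Rightarrow> real set \<Rightarrow> real"
    and lam :: "'s measure" and a sig2 :: "'s \<Rightarrow> real" and \<rho> :: "'s \<Rightarrow> real set \<Rightarrow> real"
    and f :: "'s \<Rightarrow> real"
  assumes setting: "qid_setting P M \<Lambda> \<nu>0 \<nu>1 F lam a sig2 \<rho>"
    and f: "f \<in> borel_measurable M"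
    and i: "(\<integral>\<^sup>+s. ennreal \<bar>drift_U a \<rho> (f s) s\<bar> \<partial>lam) < \<infinity>"
    and ii: "(\<integral>\<^sup>+s. ennreal (\<bar>f s\<bar>\<^sup>2 * sig2 s) \<partial>lam) < \<infinity>"
    and iii: "(\<integral>\<^sup>+s. jump_V0 \<rho> (f s) s \<partial>lam) < \<infinity>"
  shows "\<Lambda>_integrable P M \<Lambda> lam f \<and>
    (let a_f = (\<integral>s. drift_U a \<rho> (f s) s \<partial>lam);
         sig2_f = (\<integral>s. \<bar>f s\<bar>\<^sup>2 * sig2 s \<partial>lam);
         F_pos = F_tilde_f lam (\<lambda>s. ql_pos (\<rho> s)) f;
         F_neg = F_tilde_f lam (\<lambda>s. ql_neg (\<rho> s)) f;
         F_f = (\<lambda>B. measure F_pos B - measure F_neg B)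
     in levy_measure F_pos \<and> levy_measure F_neg \<and> quasi_levy_measure F_f \<and>
        (\<forall>X. has_\<Lambda>_integral P M \<Lambda> lam f (space M) X \<longrightarrow>
           (\<forall>\<theta>::real. (\<integral>w. iexp (\<theta> * X w) \<partial>P) =
              exp (\<i> * \<theta> * a_f - 1 / 2 * \<theta>\<^sup>2 * sig2_f
                   + ql_integral F_f (\<lambda>x. iexp (\<theta> * x) - 1 - \<i> * \<theta> * trunc x)))))"
proof -
  interpret qid_setting P M \<Lambda> \<nu>0 \<nu>1 F lam a sig2 \<rho> by (rule setting)
  have fL: "f \<in> borel_measurable lam" using f by (simp add: measurable_lam_iff)
  note int = \<Phi>_integrable[OF f i ii iii]
  define a_f where "a_f = (\<integral>s. drift_U a \<rho> (f s) s \<partial>lam)"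
  define sig2_f where "sig2_f = (\<integral>s. \<bar>f s\<bar>\<^sup>2 * sig2 s \<partial>lam)"
  define F_pos where "F_pos = F_tilde_f lam (\<lambda>s. ql_pos (\<rho> s)) f"
  define F_neg where "F_neg = F_tilde_f lam (\<lambda>s. ql_neg (\<rho> s)) f"
  define F_f where "F_f B = measure F_pos B - measure F_neg B" for B
  have levy: "levy_measure F_pos" "levy_measure F_neg"
    unfolding F_pos_def F_neg_def
    using pos.levy_measure_F_tilde_f[OF fL levy_weight_mixture_finite(1)[OF iii]]
      neg.levy_measure_F_tilde_f[OF fL levy_weight_mixture_finite(2)[OF iii]] by auto
  have type: "quasi_levy_type F_f"
    by (rule quasi_levy_type_diff(1)[OF levy]) (simp add: F_f_def)
  have cumulant: "(\<integral>s. K (\<theta> * f s) s \<partial>lam) = \<i> * \<theta> * a_f - \<theta>\<^sup>2 / 2 * sig2_f + ql_integral F_f (levy_integrand \<theta>)" for \<theta>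
  proof -
    have eq: "ql_integral F_f (levy_integrand \<theta>) = (\<integral>s. ql_integral (\<rho> s) (\<lambda>x. levy_integrand \<theta> (f s * x)) \<partial>lam)"
      unfolding ql_mixture(2)[OF fL iii levy_integrand_measurable levy_integrand_le] F_pos_def[symmetric] F_neg_def[symmetric]
      by (rule quasi_levy_type_diff(2)[OF levy _ levy_integrand_measurable levy_integrand_le]) (simp add: F_f_def)
    have "(\<integral>s. K (\<theta> * f s) s \<partial>lam) = (\<integral>s. \<i> * \<theta> * complex_of_real (U (f s) s) - \<theta>\<^sup>2 / 2 * complex_of_real (\<bar>f s\<bar>\<^sup>2 * sig2 s)
        + ql_integral (\<rho> s) (\<lambda>x. levy_integrand \<theta> (f s * x)) \<partial>lam)"
      by (intro Bochner_Integration.integral_cong refl) (simp add: K_mult power_mult_distrib)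
    also have "\<dots> = \<i> * \<theta> * a_f - \<theta>\<^sup>2 / 2 * sig2_f + ql_integral F_f (levy_integrand \<theta>)"
    proof -
      have c: "integrable lam (\<lambda>s. complex_of_real (U (f s) s))" "integrable lam (\<lambda>s. complex_of_real (\<bar>f s\<bar>\<^sup>2 * sig2 s))"
        using int(1,2) by (auto simp only: complex_of_real_integrable_eq)
      show ?thesis
        unfolding eq a_f_def sig2_f_def integral_complex_of_real[symmetric]
        using c ql_mixture(1)[OF fL iii levy_integrand_measurable levy_integrand_le]
        by (simp del: of_real_mult of_real_power power2_abs, simp)
    qed
    finally show ?thesis .
  qed
  obtain g where g: "\<Lambda>_approx_seq P M \<Lambda> lam g f"
    "\<And>X \<theta>. converges_in_prob P (\<lambda>n. simple_\<Lambda>_integral M \<Lambda> (g n) (space M)) X \<Longrightarrow>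
      char (distr P borel X) \<theta> = exp (\<integral>s. K (\<theta> * f s) s \<partial>lam)"
    using exists_\<Lambda>_approx_seq[OF f int(3)] by metis
  obtain Y where Y: "converges_in_prob P (\<lambda>n. simple_\<Lambda>_integral M \<Lambda> (g n) (space M)) Y"
    using g(1) sets.top unfolding \<Lambda>_approx_seq_def by blast
  have [measurable]: "Y \<in> borel_measurable P" using Y by (simp add: converges_in_prob_def)
  have "has_char_triplet (distr P borel Y) a_f sig2_f F_f"
    unfolding has_char_triplet_def
    using type g(2)[OF Y] by (simp add: cumulant levy_integrand_def[abs_def])
  then have "quasi_levy_measure F_f" by (auto simp: quasi_levy_measure_def)
  moreover have "\<Lambda>_integrable P M \<Lambda> lam f" using f g(1) by (auto simp: \<Lambda>_integrable_def)
  moreover have "(\<integral>w. iexp (\<theta> * X w) \<partial>P) =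
      exp (\<i> * \<theta> * a_f - 1 / 2 * \<theta>\<^sup>2 * sig2_f + ql_integral F_f (\<lambda>x. iexp (\<theta> * x) - 1 - \<i> * \<theta> * trunc x))"
    if X: "has_\<Lambda>_integral P M \<Lambda> lam f (space M) X" for X \<theta>
  proof -
    obtain h where h: "\<Lambda>_approx_seq P M \<Lambda> lam h f"
      "converges_in_prob P (\<lambda>n. simple_\<Lambda>_integral M \<Lambda> (h n) (space M)) X"
      using X by (auto simp: has_\<Lambda>_integral_def)
    have [measurable]: "X \<in> borel_measurable P" using h(2) by (simp add: converges_in_prob_def)
    have "(\<integral>w. iexp (\<theta> * X w) \<partial>P) = char (distr P borel X) \<theta>"
      by (simp add: char_def integral_distr)
    also have "\<dots> = char (distr P borel Y) \<theta>"
      by (simp add: \<Lambda>_approx_seq_limit_unique[OF h(1) g(1) h(2) Y])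
    also have "\<dots> = exp (\<i> * \<theta> * a_f - \<theta>\<^sup>2 / 2 * sig2_f + ql_integral F_f (levy_integrand \<theta>))"
      by (simp add: g(2)[OF Y] cumulant)
    finally show ?thesis by (simp add: levy_integrand_def[abs_def])
  qed
  ultimately show ?thesis
    using levy unfolding Let_def F_f_def[abs_def] F_pos_def F_neg_def a_f_def sig2_f_def by blast
qed

end
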